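(* Let $R$ be a commutative ring with unity, let $G$ be a finite group, and let $F$ be a destriction functor or a biset functor for $G$ over $R$. Let $\mathcal{D}_G^*$ be the orbit category of sections over the collection of all sections $(U,V)$ of $G$ with $V\neq 1$, and let $T$ be the $R\mathcal{D}_G$-module which is the constant functor $R$ on the sections $(U,V)$ with $V=1$ and zero on all other sections. Then there is an isomorphism $$\varprojlim_{1<H\le G}F(N_G(H)/H)\;\cong\;\varprojlim_{(U,V)\in\mathcal{D}_G^*}F(U/V),$$ which gives isomorphisms of $R$-modules $$\mathrm{Obs}(F(G))\cong \mathrm{Ext}^1_{R\mathcal{D}_G}(T,F)\qquad\text{and}\qquad \mathrm{Ker}(r^F_G)\cong \mathrm{Hom}_{R\mathcal{D}_G}(T,F).$$
   Context: Sections. A section of $G$ is a pair $(U,V)$ with $V\trianglelefteq U\le G$. Write $(U,V)\preceq(M,L)$ if $L\le V\le U\le M$, and ${}^g(U,V)=(gUg^{-1},gVg^{-1})$. A collection is a set of sections closed under conjugation. For a collection $\mathcal{C}$, the orbit category of sections $\mathcal{D}_G^{\mathcal{C}}$ has object set $\mathcal{C}$, morphisms $\mathrm{Hom}((U,V),(M,L))=\{Mg : g\in G,\ {}^g(U,V)\preceq(M,L)\}$ (right cosets), and composition $Nh\circ Mg=Nhg$. $\mathcal{D}_G$ is the category for the collection of all sections. An $R\mathcal{D}_G^{\mathcal{C}}$-module is a contravariant functor $F$ from $\mathcal{D}_G^{\mathcal{C}}$ to $R$-modules; write $F(U/V)$ for $F((U,V))$ and $F(G)$ for $F((G,1))$.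 $\mathrm{Hom}$ and $\mathrm{Ext}$ over $R\mathcal{D}_G$ are taken in this abelian functor category, and $\varprojlim_{(U,V)\in\mathcal{D}_G^*}F(U/V)$ is the limit of the contravariant functor $F|_{\mathcal{D}_G^*}$. The module $T$ is $\underline{R}/J$, where $\underline{R}$ is the constant functor on $\mathcal{D}_G$ (value $R$, all maps identities) and $J\subseteq\underline{R}$ is the subfunctor with value $R$ on sections with $V\ne1$ and $0$ on sections with $V=1$. Functors. The $R$-biset category has objects finite groups, morphisms from $H$ to $K$ given by $R\otimes_{\mathbb{Z}}B(K,H)$ ($B(K,H)$ the Burnside group of $(K,H)$-bisets), and composition induced by $X\times_H Y$. A biset functor for $G$ over $R$ is an $R$-linear functor to $R$-modules from the $R$-biset category on the quotient groups $U/V$ indexed by the sections $(U,V)$ of $G$. A destriction functor for $G$ over $R$ is equivalently an $R\mathcal{D}_G$-module. A biset functor is regarded as an $R\mathcal{D}_G$-module by letting $Mg:(U,V)\to(M,L)$ act as restriction from $M/L$ to ${}^gU/L$, followed by deflation to ${}^gU/{}^gV$, followed by the isomorphism ${}^gU/{}^gV\to U/V$ induced by conjugation by $g^{-1}$. For $(U,V)\preceq(M,L)$ let $\mathrm{Defres}^{M/L}_{U/V}:F(M/L)\to F(U/V)$ be the map induced by the morphism $M\cdot 1$ (written $\mathrm{Res}$ if $V=L$); conjugation by $g$ gives isomorphisms $F(U/V)\to F({}^gU/{}^gV)$, $x\mapsto {}^gx$. Gluing. Write $N_G(H,K)=N_G(H)\cap N_G(K)$. A gluing data for $F(G)$ is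 a tuple $(f_H)_{1<H\le G}$ with $f_H\in F(N_G(H)/H)$ such that (i) ${}^gf_H=f_{{}^gH}$ for all $g\in G$ and all $H$; (ii) for all $1<K\trianglelefteq H\le G$, $\mathrm{Defres}^{N_G(K)/K}_{N_G(H,K)/H}f_K=\mathrm{Res}^{N_G(H)/H}_{N_G(H,K)/H}f_H$. The $R$-module of all gluing data is denoted $\varprojlim_{1<H\le G}F(N_G(H)/H)$. The map $r^F_G:F(G)\to\varprojlim_{1<H\le G}F(N_G(H)/H)$ sends $f$ to $(\mathrm{Defres}^G_{N_G(H)/H}f)_{H}$, and $\mathrm{Obs}(F(G))$ is the cokernel of $r^F_G$. *)

theory Defs
  imports "HOL-Algebra.Module" "HOL-Algebra.QuotRing" "HOL-Algebra.Group_Action"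
begin

section \<open>Modules over a commutative ring\<close>

definition module_hom ::
  "('r, 'k) ring_scheme \<Rightarrow> ('r, 'm, 'c) module_scheme \<Rightarrow> ('r, 'n, 'd) module_scheme \<Rightarrow> ('m \<Rightarrow> 'n) set" where
  "module_hom R M N = {f \<in> carrier M \<rightarrow> carrier N.
     (\<forall>x\<in>carrier M. \<forall>y\<in>carrier M. f (x \<oplus>\<^bsub>M\<^esub> y) = f x \<oplus>\<^bsub>N\<^esub> f y) \<and>
     (\<forall>r\<in>carrier R. \<forall>x\<in>carrier M. f (r \<odot>\<^bsub>M\<^esub> x) = r \<odot>\<^bsub>N\<^esub> f x)}"

definition module_iso ::
  "('r, 'k) ring_scheme \<Rightarrow> ('r, 'm, 'c) module_scheme \<Rightarrow> ('r, 'n, 'd) module_scheme \<Rightarrow> ('m \<Rightarrow> 'n) set" where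
  "module_iso R M N = {f \<in> module_hom R M N. bij_betw f (carrier M) (carrier N)}"

definition module_isomorphic ::
  "('r, 'k) ring_scheme \<Rightarrow> ('r, 'm, 'c) module_scheme \<Rightarrow> ('r, 'n, 'd) module_scheme \<Rightarrow> bool" where
  "module_isomorphic R M N \<longleftrightarrow> module_iso R M N \<noteq> {}"

text \<open>The ring-multiplication fields of a \<^typ>\<open>('r, 'm) module\<close> record play no role in the
  locale \<^locale>\<open>module\<close>; they are left undefined in the constructions below.\<close>

definition regular_module :: "('r, 'k) ring_scheme \<Rightarrow> ('r, 'r) module" where
  "regular_module R = \<lparr>carrier = carrier R, mult = mult R, one = one R,
     zero = zero R, add = add R, smult = mult R\<rparr>"

definition quot_module :: "('r, 'm, 'c) module_scheme \<Rightarrow> 'm set \<Rightarrow> ('r, 'm set) module" where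
  "quot_module M N = \<lparr>carrier = a_rcosets\<^bsub>M\<^esub> N, mult = undefined, one = undefined,
     zero = N, add = set_add M, smult = (\<lambda>r A. \<Union>x\<in>A. N +>\<^bsub>M\<^esub> (r \<odot>\<^bsub>M\<^esub> x))\<rparr>"

definition prod_module :: "'i set \<Rightarrow> ('i \<Rightarrow> ('r, 'm) module) \<Rightarrow> ('r, 'i \<Rightarrow> 'm) module" where
  "prod_module I M = \<lparr>carrier = (\<Pi>\<^sub>E i\<in>I. carrier (M i)), mult = undefined, one = undefined,
     zero = (\<lambda>i\<in>I. \<zero>\<^bsub>M i\<^esub>), add = (\<lambda>x y. \<lambda>i\<in>I. x i \<oplus>\<^bsub>M i\<^esub> y i),
     smult = (\<lambda>r x. \<lambda>i\<in>I. r \<odot>\<^bsub>M i\<^esub> x i)\<rparr>"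

text \<open>The free module on a set \<open>S\<close>: finitely supported functions from \<open>S\<close> to \<open>R\<close>,
  extended by zero.\<close>

definition free_module :: "('r, 'k) ring_scheme \<Rightarrow> 's set \<Rightarrow> ('r, 's \<Rightarrow> 'r) module" where
  "free_module R S = \<lparr>carrier = {c. (\<forall>s. c s \<in> carrier R) \<and> (\<forall>s. s \<notin> S \<longrightarrow> c s = \<zero>\<^bsub>R\<^esub>) \<and>
       finite {s. c s \<noteq> \<zero>\<^bsub>R\<^esub>}}, mult = undefined, one = undefined,
     zero = (\<lambda>_. \<zero>\<^bsub>R\<^esub>), add = (\<lambda>c d s. c s \<oplus>\<^bsub>R\<^esub> d s), smult = (\<lambda>r c s. r \<otimes>\<^bsub>R\<^esub> c s)\<rparr>"

definition basis_elem :: "('r, 'k) ring_scheme \<Rightarrow> 's \<Rightarrow> 's \<Rightarrow> 'r" where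
  "basis_elem R s = (\<lambda>t. if t = s then \<one>\<^bsub>R\<^esub> else \<zero>\<^bsub>R\<^esub>)"

definition gen_submodule :: "('r, 'k) ring_scheme \<Rightarrow> ('r, 'm, 'c) module_scheme \<Rightarrow> 'm set \<Rightarrow> 'm set" where
  "gen_submodule R M S = \<Inter>{N. submodule N R M \<and> S \<subseteq> N}"

text \<open>Homomorphisms are taken extensional here so that equality of homomorphisms is equality
  of functions.\<close>

definition hom_module ::
  "('r, 'k) ring_scheme \<Rightarrow> ('r, 'm) module \<Rightarrow> ('r, 'n) module \<Rightarrow> ('r, 'm \<Rightarrow> 'n) module" where
  "hom_module R M N =
     (prod_module (carrier M) (\<lambda>_. N))\<lparr>carrier := module_hom R M N \<inter> extensional (carrier M)\<rparr>"


section \<open>Modules over a small category\<close>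

text \<open>\<open>Comp C b a\<close> is the composite \<open>b \<circ> a\<close>. A morphism need not determine its source and target,
  so these are passed to functors separately.\<close>

record ('o, 'a) cat =
  Obj :: "'o set"
  Hom :: "'o \<Rightarrow> 'o \<Rightarrow> 'a set"
  Comp :: "'a \<Rightarrow> 'a \<Rightarrow> 'a"
  Ident :: "'o \<Rightarrow> 'a"

text \<open>The data of a functor to \<open>R\<close>-modules, covariant or contravariant: for a morphism
  \<open>a : x \<rightarrow> y\<close>, \<open>ar F x y a\<close> is a map from \<open>F y\<close> to \<open>F x\<close> in the contravariant case and from \<open>F x\<close>
  to \<open>F y\<close> in the covariant case.\<close>

record ('o, 'a, 'r, 'm) fun_data =
  ob :: "'o \<Rightarrow> ('r, 'm) module"
  ar :: "'o \<Rightarrow> 'o \<Rightarrow> 'a \<Rightarrow> 'm \<Rightarrow> 'm"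

definition cat_module ::
  "('r, 'k) ring_scheme \<Rightarrow> ('o, 'a) cat \<Rightarrow> ('o, 'a, 'r, 'm) fun_data \<Rightarrow> bool" where
  "cat_module R C F \<longleftrightarrow>
     (\<forall>x\<in>Obj C. module R (ob F x)) \<and>
     (\<forall>x\<in>Obj C. \<forall>y\<in>Obj C. \<forall>a\<in>Hom C x y. ar F x y a \<in> module_hom R (ob F y) (ob F x)) \<and>
     (\<forall>x\<in>Obj C. \<forall>m\<in>carrier (ob F x). ar F x x (Ident C x) m = m) \<and>
     (\<forall>x\<in>Obj C. \<forall>y\<in>Obj C. \<forall>z\<in>Obj C. \<forall>a\<in>Hom C x y. \<forall>b\<in>Hom C y z. \<forall>m\<in>carrier (ob F z).
        ar F x z (Comp C b a) m = ar F x y a (ar F y z b m))"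

definition nat_module ::
  "('r, 'k) ring_scheme \<Rightarrow> ('o, 'a) cat \<Rightarrow> ('o, 'a, 'r, 'm) fun_data \<Rightarrow> ('o, 'a, 'r, 'n) fun_data
    \<Rightarrow> ('r, 'o \<Rightarrow> 'm \<Rightarrow> 'n) module" where
  "nat_module R C M N =
     (prod_module (Obj C) (\<lambda>x. hom_module R (ob M x) (ob N x)))
       \<lparr>carrier := {\<eta> \<in> (\<Pi>\<^sub>E x\<in>Obj C. carrier (hom_module R (ob M x) (ob N x))).
          \<forall>x\<in>Obj C. \<forall>y\<in>Obj C. \<forall>a\<in>Hom C x y. \<forall>m\<in>carrier (ob M y).
            \<eta> x (ar M x y a m) = ar N x y a (\<eta> y m)}\<rparr>"

definition lim_module :: "('o, 'a) cat \<Rightarrow> ('o, 'a, 'r, 'm) fun_data \<Rightarrow> ('r, 'o \<Rightarrow> 'm) module" where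
  "lim_module C F =
     (prod_module (Obj C) (ob F))
       \<lparr>carrier := {v \<in> (\<Pi>\<^sub>E x\<in>Obj C. carrier (ob F x)).
          \<forall>x\<in>Obj C. \<forall>y\<in>Obj C. \<forall>a\<in>Hom C x y. ar F x y a (v y) = v x}\<rparr>"

definition const_functor :: "('r, 'k) ring_scheme \<Rightarrow> ('o, 'a, 'r, 'r) fun_data" where
  "const_functor R = \<lparr>ob = (\<lambda>_. regular_module R), ar = (\<lambda>_ _ _ r. r)\<rparr>"

definition sub_functor ::
  "('o, 'a, 'r, 'm) fun_data \<Rightarrow> ('o \<Rightarrow> 'm set) \<Rightarrow> ('o, 'a, 'r, 'm) fun_data" where
  "sub_functor F S = F\<lparr>ob := (\<lambda>x. (ob F x)\<lparr>carrier := S x\<rparr>)\<rparr>"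

definition quot_functor ::
  "('o, 'a, 'r, 'm) fun_data \<Rightarrow> ('o \<Rightarrow> 'm set) \<Rightarrow> ('o, 'a, 'r, 'm set) fun_data" where
  "quot_functor F S = \<lparr>ob = (\<lambda>x. quot_module (ob F x) (S x)),
     ar = (\<lambda>x y a A. \<Union>m\<in>A. S x +>\<^bsub>ob F x\<^esub> ar F x y a m)\<rparr>"

subsection \<open>Ext\<close>

text \<open>The standard projective functor mapping onto a contravariant functor \<open>M\<close>: the direct sum, over all objects
  \<open>X\<close> and all \<open>t \<in> M X\<close>, of copies of the representable functor \<open>R Hom(-, X)\<close>. Its value at
  \<open>Y\<close> is free on the triples \<open>(X, t, a)\<close> with \<open>a : Y \<rightarrow> X\<close>, and \<open>b : Y' \<rightarrow> Y\<close> sends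
  \<open>(X, t, a)\<close> to \<open>(X, t, a \<circ> b)\<close>. By Yoneda, the basis element \<open>(X, t, a)\<close> goes to \<open>M(a)(t)\<close>
  under the canonical epimorphism onto \<open>M\<close>.\<close>

definition free_functor ::
  "('r, 'k) ring_scheme \<Rightarrow> ('o, 'a) cat \<Rightarrow> ('o, 'a, 'r, 'm) fun_data
    \<Rightarrow> ('o, 'a, 'r, ('o \<times> 'm \<times> 'a) \<Rightarrow> 'r) fun_data" where
  "free_functor R C M = \<lparr>
     ob = (\<lambda>Y. free_module R {(X, t, a). X \<in> Obj C \<and> t \<in> carrier (ob M X) \<and> a \<in> Hom C Y X}),
     ar = (\<lambda>Y' Y b c. \<lambda>(X, t, a').
       \<Oplus>\<^bsub>R\<^esub> a \<in> {a \<in> Hom C Y X. Comp C a b = a' \<and> c (X, t, a) \<noteq> \<zero>\<^bsub>R\<^esub>}. c (X, t, a))\<rparr>"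

definition free_counit ::
  "('r, 'k) ring_scheme \<Rightarrow> ('o, 'a, 'r, 'm) fun_data \<Rightarrow> 'o \<Rightarrow> (('o \<times> 'm \<times> 'a) \<Rightarrow> 'r) \<Rightarrow> 'm" where
  "free_counit R M Y c =
     (\<Oplus>\<^bsub>ob M Y\<^esub> s \<in> {s. c s \<noteq> \<zero>\<^bsub>R\<^esub>}.
        c s \<odot>\<^bsub>ob M Y\<^esub> (case s of (X, t, a) \<Rightarrow> ar M Y X a t))"

definition free_kernel ::
  "('r, 'k) ring_scheme \<Rightarrow> ('o, 'a) cat \<Rightarrow> ('o, 'a, 'r, 'm) fun_data
    \<Rightarrow> ('o, 'a, 'r, ('o \<times> 'm \<times> 'a) \<Rightarrow> 'r) fun_data" where
  "free_kernel R C M = sub_functor (free_functor R C M)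
     (\<lambda>Y. {c \<in> carrier (ob (free_functor R C M) Y). free_counit R M Y c = \<zero>\<^bsub>ob M Y\<^esub>})"

definition precomp ::
  "('o, 'a) cat \<Rightarrow> ('o, 'a, 'r, 'p) fun_data \<Rightarrow> ('o \<Rightarrow> 'p \<Rightarrow> 'q) \<Rightarrow> ('o \<Rightarrow> 'q \<Rightarrow> 'n) \<Rightarrow> 'o \<Rightarrow> 'p \<Rightarrow> 'n" where
  "precomp C P d \<eta> = (\<lambda>x\<in>Obj C. \<lambda>p\<in>carrier (ob P x). \<eta> x (d x p))"

text \<open>\<open>Ext\<^sup>1(M, N)\<close> is the first cohomology of \<open>Hom(P\<^sub>\<bullet>, N)\<close>, where \<open>P\<^sub>\<bullet>\<close> is the standard free
  resolution of \<open>M\<close>: \<open>P\<^sub>n\<close> is the free functor on the \<open>n\<close>-th syzygy \<open>K\<^sub>n\<close> (with \<open>K\<^sub>0 = M\<close>),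
  \<open>K\<^sub>n\<^sub>+\<^sub>1\<close> is the kernel of \<open>P\<^sub>n \<rightarrow> K\<^sub>n\<close>, and the differential from \<open>P\<^sub>n\<^sub>+\<^sub>1\<close> to \<open>P\<^sub>n\<close> is the
  counit onto \<open>K\<^sub>n\<^sub>+\<^sub>1\<close> followed by its inclusion into \<open>P\<^sub>n\<close>.\<close>

definition Ext1 ::
  "('r, 'k) ring_scheme \<Rightarrow> ('o, 'a) cat \<Rightarrow> ('o, 'a, 'r, 'm) fun_data \<Rightarrow> ('o, 'a, 'r, 'n) fun_data
    \<Rightarrow> ('r, ('o \<Rightarrow> (('o \<times> (('o \<times> 'm \<times> 'a) \<Rightarrow> 'r) \<times> 'a) \<Rightarrow> 'r) \<Rightarrow> 'n) set) module" where
  "Ext1 R C M N =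
    (let K1 = free_kernel R C M;
         K2 = free_kernel R C K1;
         P0 = free_functor R C M;
         P1 = free_functor R C K1;
         P2 = free_functor R C K2;
         cocycles = {\<eta> \<in> carrier (nat_module R C P1 N).
           precomp C P2 (free_counit R K2) \<eta> = \<zero>\<^bsub>nat_module R C P2 N\<^esub>};
         coboundaries = precomp C P1 (free_counit R K1) ` carrier (nat_module R C P0 N)
     in quot_module ((nat_module R C P1 N)\<lparr>carrier := cocycles\<rparr>) coboundaries)"


section \<open>The orbit category of sections\<close>

type_synonym 'g sec = "'g set \<times> 'g set"

definition sections :: "('g, 'l) monoid_scheme \<Rightarrow> 'g sec set" where
  "sections G = {(U, V). subgroup U G \<and> V \<lhd> G\<lparr>carrier := U\<rparr>}"

definition conj_set :: "('g, 'l) monoid_scheme \<Rightarrow> 'g \<Rightarrow> 'g set \<Rightarrow> 'g set" where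
  "conj_set G g A = g <#\<^bsub>G\<^esub> A #>\<^bsub>G\<^esub> inv\<^bsub>G\<^esub> g"

definition conj_sec :: "('g, 'l) monoid_scheme \<Rightarrow> 'g \<Rightarrow> 'g sec \<Rightarrow> 'g sec" where
  "conj_sec G g = (\<lambda>(U, V). (conj_set G g U, conj_set G g V))"

definition sec_le :: "'g sec \<Rightarrow> 'g sec \<Rightarrow> bool" where
  "sec_le = (\<lambda>(U, V) (M, L). L \<subseteq> V \<and> V \<subseteq> U \<and> U \<subseteq> M)"

text \<open>The composite of \<open>Mg\<close> followed by \<open>Nh\<close> is \<open>Nhg\<close>, which is the product of the subsets \<open>Nh\<close>
  and \<open>Mg\<close> of \<open>G\<close>; see \<open>rcos_comp\<close> below. The identity of \<open>(U, V)\<close> is the coset \<open>U1 = U\<close>.\<close>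

definition orbit_cat :: "('g, 'l) monoid_scheme \<Rightarrow> 'g sec set \<Rightarrow> ('g sec, 'g set) cat" where
  "orbit_cat G \<C> = \<lparr>
     Obj = \<C>,
     Hom = (\<lambda>s t. {fst t #>\<^bsub>G\<^esub> g | g. g \<in> carrier G \<and> sec_le (conj_sec G g s) t}),
     Comp = set_mult G,
     Ident = fst\<rparr>"

lemma (in group) rcos_comp:
  assumes N: "subgroup N G" and M: "subgroup M G" and h: "h \<in> carrier G" and g: "g \<in> carrier G"
    and le: "conj_set G h M \<subseteq> N"
  shows "(N #> h) <#> (M #> g) = N #> (h \<otimes> g)"
proof
  note [simp] = subgroup.mem_carrier[OF N] subgroup.mem_carrier[OF M] h g
  show "(N #> h) <#> (M #> g) \<subseteq> N #> (h \<otimes> g)"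
  proof
    fix x assume "x \<in> (N #> h) <#> (M #> g)"
    then obtain n m where n: "n \<in> N" and m: "m \<in> M" and x: "x = n \<otimes> h \<otimes> (m \<otimes> g)"
      by (auto simp: set_mult_def r_coset_def)
    have "h \<otimes> m \<otimes> inv h \<in> N"
      using le m by (auto simp: conj_set_def r_coset_def l_coset_def)
    then have "n \<otimes> (h \<otimes> m \<otimes> inv h) \<in> N"
      using n subgroup.m_closed[OF N] by blast
    moreover have "x = n \<otimes> (h \<otimes> m \<otimes> inv h) \<otimes> (h \<otimes> g)"
      using n m by (simp add: x m_assoc inv_solve_left' l_inv_ex) (simp add: m_assoc[symmetric])
    ultimately show "x \<in> N #> (h \<otimes> g)"
      by (auto simp: r_coset_def)
  qed
  show "N #> (h \<otimes> g) \<subseteq> (N #> h) <#> (M #> g)"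
  proof
    fix x assume "x \<in> N #> (h \<otimes> g)"
    then obtain n where n: "n \<in> N" and x: "x = n \<otimes> (h \<otimes> g)"
      by (auto simp: r_coset_def)
    have "n \<otimes> h \<in> N #> h" and "\<one> \<otimes> g \<in> M #> g"
      using n subgroup.one_closed[OF M] unfolding r_coset_def by blast+
    moreover have "x = (n \<otimes> h) \<otimes> (\<one> \<otimes> g)"
      using n by (simp add: x m_assoc)
    ultimately show "x \<in> (N #> h) <#> (M #> g)"
      unfolding set_mult_def by blast
  qed
qed

abbreviation DG :: "('g, 'l) monoid_scheme \<Rightarrow> ('g sec, 'g set) cat" where
  "DG G \<equiv> orbit_cat G (sections G)"

abbreviation DG_star :: "('g, 'l) monoid_scheme \<Rightarrow> ('g sec, 'g set) cat" where
  "DG_star G \<equiv> orbit_cat G {(U, V) \<in> sections G. V \<noteq> {\<one>\<^bsub>G\<^esub>}}"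

abbreviation destriction_functor ::
  "('r, 'k) ring_scheme \<Rightarrow> ('g, 'l) monoid_scheme \<Rightarrow> ('g sec, 'g set, 'r, 'm) fun_data \<Rightarrow> bool" where
  "destriction_functor R G F \<equiv> cat_module R (DG G) F"

definition T_functor ::
  "('r, 'k) ring_scheme \<Rightarrow> ('g, 'l) monoid_scheme \<Rightarrow> ('g sec, 'g set, 'r, 'r set) fun_data" where
  "T_functor R G = quot_functor (const_functor R)
     (\<lambda>(U, V). if V \<noteq> {\<one>\<^bsub>G\<^esub>} then carrier R else {\<zero>\<^bsub>R\<^esub>})"


section \<open>Bisets and the biset category\<close>

text \<open>A \<open>(K, H)\<close>-biset: \<open>K\<close> acts on the left, \<open>H\<close> on the right.\<close>

record ('k, 'h, 'x) biset =
  pts :: "'x set"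
  lact :: "'k \<Rightarrow> 'x \<Rightarrow> 'x"
  ract :: "'x \<Rightarrow> 'h \<Rightarrow> 'x"

definition fin_biset ::
  "('k, 'l1) monoid_scheme \<Rightarrow> ('h, 'l2) monoid_scheme \<Rightarrow> ('k, 'h, 'x) biset \<Rightarrow> bool" where
  "fin_biset K H X \<longleftrightarrow> finite (pts X) \<and>
     (\<forall>k\<in>carrier K. \<forall>x\<in>pts X. lact X k x \<in> pts X) \<and>
     (\<forall>x\<in>pts X. lact X \<one>\<^bsub>K\<^esub> x = x) \<and>
     (\<forall>k\<in>carrier K. \<forall>k'\<in>carrier K. \<forall>x\<in>pts X. lact X (k \<otimes>\<^bsub>K\<^esub> k') x = lact X k (lact X k' x)) \<and>
     (\<forall>h\<in>carrier H. \<forall>x\<in>pts X. ract X x h \<in> pts X) \<and>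
     (\<forall>x\<in>pts X. ract X x \<one>\<^bsub>H\<^esub> = x) \<and>
     (\<forall>h\<in>carrier H. \<forall>h'\<in>carrier H. \<forall>x\<in>pts X. ract X x (h \<otimes>\<^bsub>H\<^esub> h') = ract X (ract X x h) h') \<and>
     (\<forall>k\<in>carrier K. \<forall>h\<in>carrier H. \<forall>x\<in>pts X. lact X k (ract X x h) = ract X (lact X k x) h)"

definition biset_iso ::
  "('k, 'l1) monoid_scheme \<Rightarrow> ('h, 'l2) monoid_scheme \<Rightarrow> ('k, 'h, 'x) biset \<Rightarrow> ('k, 'h, 'y) biset \<Rightarrow> bool" where
  "biset_iso K H X Y \<longleftrightarrow> (\<exists>f. bij_betw f (pts X) (pts Y) \<and>
     (\<forall>k\<in>carrier K. \<forall>x\<in>pts X. f (lact X k x) = lact Y k (f x)) \<and>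
     (\<forall>h\<in>carrier H. \<forall>x\<in>pts X. f (ract X x h) = ract Y (f x) h))"

definition biset_sum :: "('k, 'h, 'x) biset \<Rightarrow> ('k, 'h, 'y) biset \<Rightarrow> ('k, 'h, 'x + 'y) biset" where
  "biset_sum X Y = \<lparr>pts = pts X <+> pts Y,
     lact = (\<lambda>k. map_sum (lact X k) (lact Y k)),
     ract = (\<lambda>z h. map_sum (\<lambda>x. ract X x h) (\<lambda>y. ract Y y h) z)\<rparr>"

text \<open>The product \<open>X \<times>\<^sub>H Y\<close> of a \<open>(K, H)\<close>-biset and an \<open>(H, J)\<close>-biset: the set of orbits of \<open>H\<close> on
  \<open>X \<times> Y\<close> under \<open>h \<cdot> (x, y) = (x h, h\<inverse> y)\<close>.\<close>

definition biset_prod ::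
  "('h, 'l) monoid_scheme \<Rightarrow> ('k, 'h, 'x) biset \<Rightarrow> ('h, 'j, 'y) biset \<Rightarrow> ('k, 'j, ('x \<times> 'y) set) biset" where
  "biset_prod H X Y = \<lparr>
     pts = {{(ract X x h, lact Y (inv\<^bsub>H\<^esub> h) y) | h. h \<in> carrier H} | x y. x \<in> pts X \<and> y \<in> pts Y},
     lact = (\<lambda>k Q. (\<lambda>(x, y). (lact X k x, y)) ` Q),
     ract = (\<lambda>Q j. (\<lambda>(x, y). (x, ract Y y j)) ` Q)\<rparr>"

text \<open>Every finite biset is isomorphic to one whose points are natural numbers, so isomorphism
  classes of finite bisets can be represented by sets of bisets on \<^typ>\<open>nat\<close>.\<close>

definition biset_class ::
  "('k, 'l1) monoid_scheme \<Rightarrow> ('h, 'l2) monoid_scheme \<Rightarrow> ('k, 'h, 'x) biset \<Rightarrow> ('k, 'h, nat) biset set" where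
  "biset_class K H X = {Z. fin_biset K H Z \<and> biset_iso K H X Z}"

definition biset_classes ::
  "('k, 'l1) monoid_scheme \<Rightarrow> ('h, 'l2) monoid_scheme \<Rightarrow> ('k, 'h, nat) biset set set" where
  "biset_classes K H = {biset_class K H X | X :: ('k, 'h, nat) biset. fin_biset K H X}"

text \<open>\<open>R \<otimes> B(K, H)\<close>: the \<open>R\<close>-module generated by the isomorphism classes \<open>[X]\<close> of finite bisets,
  subject to \<open>[X \<squnion> Y] = [X] + [Y]\<close>.\<close>

definition burnside_rels ::
  "('r, 'c) ring_scheme \<Rightarrow> ('k, 'l1) monoid_scheme \<Rightarrow> ('h, 'l2) monoid_scheme
    \<Rightarrow> (('k, 'h, nat) biset set \<Rightarrow> 'r) set" where
  "burnside_rels R K H =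
    (let E = free_module R (biset_classes K H); e = (\<lambda>A. basis_elem R A)
     in gen_submodule R E
       {e (biset_class K H (biset_sum X Y)) \<ominus>\<^bsub>E\<^esub>
          (e (biset_class K H X) \<oplus>\<^bsub>E\<^esub> e (biset_class K H Y)) |
        (X :: ('k, 'h, nat) biset) (Y :: ('k, 'h, nat) biset). fin_biset K H X \<and> fin_biset K H Y})"

definition burnside ::
  "('r, 'c) ring_scheme \<Rightarrow> ('k, 'l1) monoid_scheme \<Rightarrow> ('h, 'l2) monoid_scheme
    \<Rightarrow> ('r, (('k, 'h, nat) biset set \<Rightarrow> 'r) set) module" where
  "burnside R K H = quot_module (free_module R (biset_classes K H)) (burnside_rels R K H)"

definition burnside_elem ::
  "('r, 'c) ring_scheme \<Rightarrow> ('k, 'l1) monoid_scheme \<Rightarrow> ('h, 'l2) monoid_scheme \<Rightarrow> ('k, 'h, 'x) biset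
    \<Rightarrow> (('k, 'h, nat) biset set \<Rightarrow> 'r) set" where
  "burnside_elem R K H X =
     burnside_rels R K H +>\<^bsub>free_module R (biset_classes K H)\<^esub> basis_elem R (biset_class K H X)"

text \<open>The composition \<open>R \<otimes> B(K, H) \<times> R \<otimes> B(H, J) \<rightarrow> R \<otimes> B(K, J)\<close>, first on isomorphism classes,
  then bilinearly on formal combinations of these, then on cosets. The unions over
  representatives are unions of equal sets, as in \<^const>\<open>rcoset_mult\<close>.\<close>

definition class_comp ::
  "('k, 'l1) monoid_scheme \<Rightarrow> ('h, 'l2) monoid_scheme \<Rightarrow> ('j, 'l3) monoid_scheme
    \<Rightarrow> ('k, 'h, nat) biset set \<Rightarrow> ('h, 'j, nat) biset set \<Rightarrow> ('k, 'j, nat) biset set" where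
  "class_comp K H J A B = (\<Union>X\<in>A. \<Union>Y\<in>B. biset_class K J (biset_prod H X Y))"

definition chain_comp ::
  "('r, 'c) ring_scheme \<Rightarrow> ('k, 'l1) monoid_scheme \<Rightarrow> ('h, 'l2) monoid_scheme \<Rightarrow> ('j, 'l3) monoid_scheme
    \<Rightarrow> (('k, 'h, nat) biset set \<Rightarrow> 'r) \<Rightarrow> (('h, 'j, nat) biset set \<Rightarrow> 'r)
    \<Rightarrow> ('k, 'j, nat) biset set \<Rightarrow> 'r" where
  "chain_comp R K H J c d = (\<lambda>Z.
     \<Oplus>\<^bsub>R\<^esub> p \<in> {(A, B). c A \<noteq> \<zero>\<^bsub>R\<^esub> \<and> d B \<noteq> \<zero>\<^bsub>R\<^esub> \<and> class_comp K H J A B = Z}.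
       c (fst p) \<otimes>\<^bsub>R\<^esub> d (snd p))"

definition burnside_comp ::
  "('r, 'c) ring_scheme \<Rightarrow> ('k, 'l1) monoid_scheme \<Rightarrow> ('h, 'l2) monoid_scheme \<Rightarrow> ('j, 'l3) monoid_scheme
    \<Rightarrow> (('k, 'h, nat) biset set \<Rightarrow> 'r) set \<Rightarrow> (('h, 'j, nat) biset set \<Rightarrow> 'r) set
    \<Rightarrow> (('k, 'j, nat) biset set \<Rightarrow> 'r) set" where
  "burnside_comp R K H J \<alpha> \<beta> = (\<Union>c\<in>\<alpha>. \<Union>d\<in>\<beta>.
     burnside_rels R K J +>\<^bsub>free_module R (biset_classes K J)\<^esub> chain_comp R K H J c d)"

text \<open>For \<open>K\<close> a subgroup of \<open>H\<close>, \<open>mult_biset H\<close> viewed as a \<open>(K, H)\<close>-biset is the restriction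
  biset from \<open>H\<close> to \<open>K\<close>; for \<open>K = H\<close> it is the identity of \<open>H\<close>. For a homomorphism \<open>\<phi> : H \<rightarrow> K\<close>,
  \<open>twist_biset K \<phi>\<close> is the \<open>(K, H)\<close>-biset \<open>K\<close> on which \<open>H\<close> acts through \<open>\<phi>\<close>: the deflation biset
  if \<open>\<phi>\<close> is a quotient map, and the isomorphism biset if \<open>\<phi>\<close> is an isomorphism.\<close>

definition mult_biset :: "('h, 'l) monoid_scheme \<Rightarrow> ('h, 'h, 'h) biset" where
  "mult_biset H = \<lparr>pts = carrier H, lact = mult H, ract = mult H\<rparr>"

definition twist_biset :: "('k, 'l) monoid_scheme \<Rightarrow> ('h \<Rightarrow> 'k) \<Rightarrow> ('k, 'h, 'k) biset" where
  "twist_biset K \<phi> = \<lparr>pts = carrier K, lact = mult K, ract = (\<lambda>x h. x \<otimes>\<^bsub>K\<^esub> \<phi> h)\<rparr>"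


section \<open>Biset functors\<close>

definition sec_quot :: "('g, 'l) monoid_scheme \<Rightarrow> 'g sec \<Rightarrow> 'g set monoid" where
  "sec_quot G = (\<lambda>(U, V). (G\<lparr>carrier := U\<rparr>) Mod V)"

text \<open>The objects are the groups \<open>U/V\<close>, named by the section \<open>(U, V)\<close>; a morphism from \<open>s\<close> to \<open>t\<close> is
  an element of \<open>R \<otimes> B(t, s)\<close>, and the functor is covariant and \<open>R\<close>-linear.\<close>

type_synonym ('g, 'r) biset_mor = "(('g set, 'g set, nat) biset set \<Rightarrow> 'r) set"

definition biset_functor ::
  "('r, 'k) ring_scheme \<Rightarrow> ('g, 'l) monoid_scheme
    \<Rightarrow> ('g sec, ('g, 'r) biset_mor, 'r, 'm) fun_data \<Rightarrow> bool" where
  "biset_functor R G B \<longleftrightarrow>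
     (\<forall>s\<in>sections G. module R (ob B s)) \<and>
     (\<forall>s\<in>sections G. \<forall>t\<in>sections G. \<forall>\<alpha>\<in>carrier (burnside R (sec_quot G t) (sec_quot G s)).
        ar B s t \<alpha> \<in> module_hom R (ob B s) (ob B t)) \<and>
     (\<forall>s\<in>sections G. \<forall>t\<in>sections G. \<forall>\<alpha>\<in>carrier (burnside R (sec_quot G t) (sec_quot G s)).
        \<forall>\<beta>\<in>carrier (burnside R (sec_quot G t) (sec_quot G s)). \<forall>m\<in>carrier (ob B s).
        ar B s t (\<alpha> \<oplus>\<^bsub>burnside R (sec_quot G t) (sec_quot G s)\<^esub> \<beta>) m
          = ar B s t \<alpha> m \<oplus>\<^bsub>ob B t\<^esub> ar B s t \<beta> m) \<and>
     (\<forall>s\<in>sections G. \<forall>t\<in>sections G. \<forall>r\<in>carrier R.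
        \<forall>\<alpha>\<in>carrier (burnside R (sec_quot G t) (sec_quot G s)). \<forall>m\<in>carrier (ob B s).
        ar B s t (r \<odot>\<^bsub>burnside R (sec_quot G t) (sec_quot G s)\<^esub> \<alpha>) m
          = r \<odot>\<^bsub>ob B t\<^esub> ar B s t \<alpha> m) \<and>
     (\<forall>s\<in>sections G. \<forall>m\<in>carrier (ob B s).
        ar B s s (burnside_elem R (sec_quot G s) (sec_quot G s) (mult_biset (sec_quot G s))) m = m) \<and>
     (\<forall>s\<in>sections G. \<forall>t\<in>sections G. \<forall>u\<in>sections G.
        \<forall>\<beta>\<in>carrier (burnside R (sec_quot G u) (sec_quot G t)).
        \<forall>\<alpha>\<in>carrier (burnside R (sec_quot G t) (sec_quot G s)). \<forall>m\<in>carrier (ob B s).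
        ar B s u (burnside_comp R (sec_quot G u) (sec_quot G t) (sec_quot G s) \<beta> \<alpha>) m
          = ar B t u \<beta> (ar B s t \<alpha> m))"

text \<open>The action of the \<open>(t, s)\<close>-biset \<open>X\<close>.\<close>

definition biset_act ::
  "('r, 'k) ring_scheme \<Rightarrow> ('g, 'l) monoid_scheme \<Rightarrow> ('g sec, ('g, 'r) biset_mor, 'r, 'm) fun_data
    \<Rightarrow> 'g sec \<Rightarrow> 'g sec \<Rightarrow> ('g set, 'g set, 'x) biset \<Rightarrow> 'm \<Rightarrow> 'm" where
  "biset_act R G B s t X = ar B s t (burnside_elem R (sec_quot G t) (sec_quot G s) X)"

text \<open>A biset functor as a contravariant functor on the orbit category of sections: the coset
  \<open>a = Mg : (U, V) \<rightarrow> (M, L)\<close> acts as restriction from \<open>M/L\<close> to \<open>U'/L\<close>, then deflation to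
  \<open>U'/V'\<close>, then the isomorphism to \<open>U/V\<close> induced by conjugation by \<open>g\<inverse>\<close>, where \<open>(U', V')\<close> is
  the conjugate of \<open>(U, V)\<close> by \<open>g\<close>. Every \<open>g \<in> a\<close> gives the same map.\<close>

definition biset_to_destriction ::
  "('r, 'k) ring_scheme \<Rightarrow> ('g, 'l) monoid_scheme \<Rightarrow> ('g sec, ('g, 'r) biset_mor, 'r, 'm) fun_data
    \<Rightarrow> ('g sec, 'g set, 'r, 'm) fun_data" where
  "biset_to_destriction R G B = \<lparr>ob = ob B,
     ar = (\<lambda>(U, V) (M, L) a.
       let g = (SOME g. g \<in> a); U' = conj_set G g U; V' = conj_set G g V;
           rest = biset_act R G B (M, L) (U', L) (mult_biset (sec_quot G (M, L)));
           defl = biset_act R G B (U', L) (U', V')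
                    (twist_biset (sec_quot G (U', V')) (\<lambda>x. V' <#>\<^bsub>G\<^esub> x));
           isom = biset_act R G B (U', V') (U, V)
                    (twist_biset (sec_quot G (U, V)) (conj_set G (inv\<^bsub>G\<^esub> g)))
       in isom \<circ> defl \<circ> rest)\<rparr>"


section \<open>Gluing data\<close>

definition nontrivial_subgroups :: "('g, 'l) monoid_scheme \<Rightarrow> 'g set set" where
  "nontrivial_subgroups G = {H. subgroup H G \<and> H \<noteq> {\<one>\<^bsub>G\<^esub>}}"

definition norm_sec :: "('g, 'l) monoid_scheme \<Rightarrow> 'g set \<Rightarrow> 'g sec" where
  "norm_sec G H = (normalizer G H, H)"

definition full_sec :: "('g, 'l) monoid_scheme \<Rightarrow> 'g sec" where
  "full_sec G = (carrier G, {\<one>\<^bsub>G\<^esub>})"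

text \<open>\<open>defres G F t s\<close> goes from \<open>F t\<close> to \<open>F s\<close>, for \<open>s\<close> below \<open>t\<close>.\<close>

definition defres ::
  "('g, 'l) monoid_scheme \<Rightarrow> ('g sec, 'g set, 'r, 'm) fun_data \<Rightarrow> 'g sec \<Rightarrow> 'g sec \<Rightarrow> 'm \<Rightarrow> 'm" where
  "defres G F t s = ar F s t (fst t #>\<^bsub>G\<^esub> \<one>\<^bsub>G\<^esub>)"

text \<open>Conjugation by \<open>g\<close>, from \<open>F(U/V)\<close> to the value at the conjugate section, is the action of the
  morphism \<open>U g\<inverse>\<close> from that section to \<open>(U, V)\<close>.\<close>

definition conj_act ::
  "('g, 'l) monoid_scheme \<Rightarrow> ('g sec, 'g set, 'r, 'm) fun_data \<Rightarrow> 'g \<Rightarrow> 'g sec \<Rightarrow> 'm \<Rightarrow> 'm" where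
  "conj_act G F g s = ar F (conj_sec G g s) s (fst s #>\<^bsub>G\<^esub> inv\<^bsub>G\<^esub> g)"

definition gluing_module ::
  "('g, 'l) monoid_scheme \<Rightarrow> ('g sec, 'g set, 'r, 'm) fun_data \<Rightarrow> ('r, 'g set \<Rightarrow> 'm) module" where
  "gluing_module G F =
     (prod_module (nontrivial_subgroups G) (\<lambda>H. ob F (norm_sec G H)))
       \<lparr>carrier := {f \<in> (\<Pi>\<^sub>E H\<in>nontrivial_subgroups G. carrier (ob F (norm_sec G H))).
          (\<forall>g\<in>carrier G. \<forall>H\<in>nontrivial_subgroups G.
             conj_act G F g (norm_sec G H) (f H) = f (conj_set G g H)) \<and>
          (\<forall>H\<in>nontrivial_subgroups G. \<forall>K\<in>nontrivial_subgroups G. K \<lhd> G\<lparr>carrier := H\<rparr> \<longrightarrow>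
             defres G F (norm_sec G K) (normalizer G H \<inter> normalizer G K, H) (f K)
               = defres G F (norm_sec G H) (normalizer G H \<inter> normalizer G K, H) (f H))}\<rparr>"

definition gluing_map ::
  "('g, 'l) monoid_scheme \<Rightarrow> ('g sec, 'g set, 'r, 'm) fun_data \<Rightarrow> 'm \<Rightarrow> 'g set \<Rightarrow> 'm" where
  "gluing_map G F x = (\<lambda>H\<in>nontrivial_subgroups G. defres G F (full_sec G) (norm_sec G H) x)"

definition Obs ::
  "('g, 'l) monoid_scheme \<Rightarrow> ('g sec, 'g set, 'r, 'm) fun_data \<Rightarrow> ('r, ('g set \<Rightarrow> 'm) set) module" where
  "Obs G F = quot_module (gluing_module G F) (gluing_map G F ` carrier (ob F (full_sec G)))"

definition gluing_kernel ::
  "('g, 'l) monoid_scheme \<Rightarrow> ('g sec, 'g set, 'r, 'm) fun_data \<Rightarrow> ('r, 'm) module" where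
  "gluing_kernel G F = (ob F (full_sec G))
     \<lparr>carrier := {x \<in> carrier (ob F (full_sec G)). gluing_map G F x = \<zero>\<^bsub>gluing_module G F\<^esub>}\<rparr>"

definition lim_map ::
  "('g, 'l) monoid_scheme \<Rightarrow> ('g sec, 'g set, 'r, 'm) fun_data \<Rightarrow> 'm \<Rightarrow> 'g sec \<Rightarrow> 'm" where
  "lim_map G F x = (\<lambda>s\<in>Obj (DG_star G). defres G F (full_sec G) s x)"

end

theory Submission
  imports Defs
begin

text \<open>
  Write \<open>D\<close> for the orbit category of all sections and \<open>D*\<close> for its full subcategory on the sections
  \<open>(U, V)\<close> with \<open>V \<noteq> 1\<close>.

  Gluing data are compatible families on \<open>D*\<close>. Every section \<open>(U, V)\<close> lies below \<open>(N(V), V)\<close>, so a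
  compatible family on \<open>D*\<close> is determined by its members at the sections \<open>(N(H), H)\<close>, and these form a
  gluing datum. Conversely, a gluing datum \<open>f\<close> spreads to the family of the elements
  \<open>Defres f\<^sub>V \<in> F(U/V)\<close>; that this family is compatible with all morphisms of \<open>D*\<close> is
  \<open>gluing_natural\<close>, and \<open>glue_to_lim_iso\<close> is the resulting isomorphism, which takes the gluing map to
  the map from \<open>F(G)\<close> to the limit.

  The section \<open>(G, 1)\<close> is a terminal object of \<open>D\<close>, and \<open>D*\<close> is a sieve: an object with a morphism into
  \<open>D*\<close> belongs to \<open>D*\<close>. Hence the constant functor \<open>R\<close> is representable, so projective with
  \<open>Hom(R, F) = F(G)\<close>, and a homomorphism from \<open>J\<close>, which is \<open>R\<close> on \<open>D*\<close> and zero elsewhere, is a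
  compatible family on \<open>D*\<close>. The long exact sequence of \<open>0 \<rightarrow> J \<rightarrow> R \<rightarrow> T \<rightarrow> 0\<close> becomes
  \<open>0 \<rightarrow> Hom(T, F) \<rightarrow> F(G) \<rightarrow> lim F \<rightarrow> Ext\<^sup>1(T, F) \<rightarrow> 0\<close>, in which the map out of \<open>F(G)\<close> is the gluing map up to
  the isomorphism above. So \<open>Hom(T, F)\<close> is its kernel and \<open>Ext\<^sup>1(T, F)\<close> its cokernel.

  The exactness is shown directly for the \<open>Ext\<^sup>1\<close> of the standard free resolution. For any \<open>M\<close> with free
  cover \<open>P \<rightarrow> M\<close> and kernel \<open>K\<close>, that group is the cokernel of the restriction \<open>Hom(P, F) \<rightarrow> Hom(K, F)\<close>
  (\<open>ext_class_presentation\<close>). For \<open>M = T\<close> the cover lifts to an augmentation \<open>P \<rightarrow> R\<close>, which maps \<open>K\<close>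
  into \<open>J\<close>, so a family on \<open>D*\<close> gives a homomorphism \<open>K \<rightarrow> F\<close>. It extends to \<open>P\<close> exactly if the family comes from
  \<open>F(G)\<close> (\<open>family_hom_extends_iff\<close>), and every homomorphism \<open>K \<rightarrow> F\<close> is of this form up to extendable ones
  (\<open>hom_K_eq_family_hom_plus_extendable\<close>). All this is done for an
  arbitrary category with a terminal object and a sieve.

  For a biset functor it remains to see that the prescribed actions of the cosets \<open>Mg\<close> are functorial.
  The coset \<open>Mg : (U, V) \<rightarrow> (M, L)\<close> acts through one biset, namely the set of all \<open>Vy\<close> with
  \<open>y\<inverse> \<in> Mg\<close> on which \<open>U/V\<close> and \<open>M/L\<close> act by multiplication of subsets of \<open>G\<close>
  (\<open>biset_to_destriction_ar\<close>), and multiplication of subsets also identifies the product of two such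
  bisets with the biset of the composite coset (\<open>coset_biset_prod\<close>). To use this, the composition
  of Burnside modules must be computed on classes of bisets (\<open>burnside_comp_elem\<close>), which amounts to its being
  well defined modulo the relations \<open>[X \<squnion> Y] = [X] + [Y]\<close>.
\<close>

section \<open>Modules\<close>

lemma module_homI:
  assumes "\<And>x. x \<in> carrier M \<Longrightarrow> f x \<in> carrier N"
    and "\<And>x y. x \<in> carrier M \<Longrightarrow> y \<in> carrier M \<Longrightarrow> f (x \<oplus>\<^bsub>M\<^esub> y) = f x \<oplus>\<^bsub>N\<^esub> f y"
    and "\<And>r x. r \<in> carrier R \<Longrightarrow> x \<in> carrier M \<Longrightarrow> f (r \<odot>\<^bsub>M\<^esub> x) = r \<odot>\<^bsub>N\<^esub> f x"
  shows "f \<in> module_hom R M N"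
  using assms by (auto simp: module_hom_def)

lemma module_homD:
  assumes "f \<in> module_hom R M N"
  shows module_hom_closed: "x \<in> carrier M \<Longrightarrow> f x \<in> carrier N"
    and module_hom_add:
      "x \<in> carrier M \<Longrightarrow> y \<in> carrier M \<Longrightarrow> f (x \<oplus>\<^bsub>M\<^esub> y) = f x \<oplus>\<^bsub>N\<^esub> f y"
    and module_hom_smult: "r \<in> carrier R \<Longrightarrow> x \<in> carrier M \<Longrightarrow> f (r \<odot>\<^bsub>M\<^esub> x) = r \<odot>\<^bsub>N\<^esub> f x"
  using assms by (auto simp: module_hom_def)

lemma module_hom_zero:
  assumes "module R M" "module R N" "f \<in> module_hom R M N"
  shows "f \<zero>\<^bsub>M\<^esub> = \<zero>\<^bsub>N\<^esub>"
proof -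
  interpret M: module R M by fact
  interpret N: module R N by fact
  have "f (\<zero>\<^bsub>R\<^esub> \<odot>\<^bsub>M\<^esub> \<zero>\<^bsub>M\<^esub>) = \<zero>\<^bsub>R\<^esub> \<odot>\<^bsub>N\<^esub> f \<zero>\<^bsub>M\<^esub>"
    by (intro module_hom_smult[OF assms(3)]) auto
  with module_hom_closed[OF assms(3)] show ?thesis by simp
qed

lemma (in module) minus_eq_smult:
  "x \<in> carrier M \<Longrightarrow> \<ominus>\<^bsub>M\<^esub> x = (\<ominus> \<one>) \<odot>\<^bsub>M\<^esub> x"
  by (simp add: smult_l_minus)

lemma module_hom_minus:
  assumes "module R M" "module R N" "f \<in> module_hom R M N" "x \<in> carrier M" "y \<in> carrier M"
  shows "f (x \<ominus>\<^bsub>M\<^esub> y) = f x \<ominus>\<^bsub>N\<^esub> f y"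
proof -
  interpret M: module R M by fact
  interpret N: module R N by fact
  show ?thesis
    using assms(4,5) module_homD[OF assms(3)]
    by (simp add: M.minus_eq N.minus_eq M.minus_eq_smult N.minus_eq_smult)
qed

lemma module_hom_compose:
  assumes "f \<in> module_hom R M N" "g \<in> module_hom R N P"
  shows "(\<lambda>x. g (f x)) \<in> module_hom R M P"
  using assms by (auto simp: module_hom_def Pi_iff)

lemma module_hom_cong:
  assumes "f \<in> module_hom R M N" "module R M" "\<And>x. x \<in> carrier M \<Longrightarrow> f x = g x"
  shows "g \<in> module_hom R M N"
proof -
  interpret M: module R M by fact
  show ?thesis
    using assms(1) by (auto simp: module_hom_def assms(3)[symmetric])
qed

lemma module_hom_finsum:
  assumes "module R M" "module R N" "f \<in> module_hom R M N" "finite A" "h \<in> A \<rightarrow> carrier M"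
  shows "f (finsum M h A) = finsum N (\<lambda>a. f (h a)) A"
proof -
  interpret M: module R M by fact
  interpret N: module R N by fact
  show ?thesis
    using assms(4,5)
  proof (induction A rule: finite_induct)
    case empty
    then show ?case using module_hom_zero[OF assms(1-3)] by simp
  next
    case (insert a A)
    then have h: "h \<in> A \<rightarrow> carrier M" "h a \<in> carrier M" by auto
    moreover from h have "(\<lambda>a. f (h a)) \<in> A \<rightarrow> carrier N" "f (h a) \<in> carrier N"
      using module_hom_closed[OF assms(3)] by auto
    ultimately show ?case
      using insert by (simp add: module_hom_add[OF assms(3)])
  qed
qed

lemma (in module) submoduleI_linear:
  assumes "N \<subseteq> carrier M" "\<zero>\<^bsub>M\<^esub> \<in> N"
    and "\<And>x y. x \<in> N \<Longrightarrow> y \<in> N \<Longrightarrow> x \<oplus>\<^bsub>M\<^esub> y \<in> N"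
    and "\<And>r x. r \<in> carrier R \<Longrightarrow> x \<in> N \<Longrightarrow> r \<odot>\<^bsub>M\<^esub> x \<in> N"
  shows "submodule N R M"
  using assms by (intro submoduleI) (auto simp: minus_eq_smult subset_iff)

lemma (in abelian_group) minus_eq_zero_iff:
  "x \<in> carrier G \<Longrightarrow> y \<in> carrier G \<Longrightarrow> x \<ominus> y = \<zero> \<longleftrightarrow> x = y"
  using add.inv_solve_right'[of \<zero> x y] by (auto simp: minus_eq r_neg)

lemma (in abelian_group) minus_zero_right: "x \<in> carrier G \<Longrightarrow> x \<ominus> \<zero> = x"
  using add.inv_one by (simp add: minus_eq a_inv_def)

lemma submodule_kernel:
  assumes "module R M" "module R N" "f \<in> module_hom R M N"
  shows "submodule {x \<in> carrier M. f x = \<zero>\<^bsub>N\<^esub>} R M"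
proof -
  interpret M: module R M by fact
  interpret N: module R N by fact
  show ?thesis
    using module_homD[OF assms(3)] module_hom_zero[OF assms]
    by (intro M.submoduleI_linear) auto
qed

lemma submodule_image:
  assumes "module R M" "module R N" "f \<in> module_hom R M N"
  shows "submodule (f ` carrier M) R N"
proof -
  interpret M: module R M by fact
  interpret N: module R N by fact
  note f = module_homD[OF assms(3)]
  show ?thesis
  proof (intro N.submoduleI_linear)
    show "f ` carrier M \<subseteq> carrier N" using f(1) by auto
    show "\<zero>\<^bsub>N\<^esub> \<in> f ` carrier M"
      using module_hom_zero[OF assms] M.zero_closed by (metis imageI)
    show "x \<oplus>\<^bsub>N\<^esub> y \<in> f ` carrier M" if "x \<in> f ` carrier M" "y \<in> f ` carrier M" for x y
      using that by (auto simp: f(2)[symmetric])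
    show "r \<odot>\<^bsub>N\<^esub> x \<in> f ` carrier M" if "r \<in> carrier R" "x \<in> f ` carrier M" for r x
      using that by (auto simp: f(3)[symmetric])
  qed
qed

lemma submodule_carrier_module:
  assumes "module R M" "submodule N R M"
  shows "module R (M\<lparr>carrier := N\<rparr>)"
  using submodule.submodule_is_module[OF assms(2,1)] .

lemma submodule_zero: "module R M \<Longrightarrow> submodule N R M \<Longrightarrow> \<zero>\<^bsub>M\<^esub> \<in> N"
  using subgroup.one_closed[OF submodule.axioms(1)] by force

lemma submodule_subset: "module R M \<Longrightarrow> submodule N R M \<Longrightarrow> x \<in> N \<Longrightarrow> x \<in> carrier M"
  using module.submoduleE(1) by blast

lemma submodule_smult: "submodule N R M \<Longrightarrow> r \<in> carrier R \<Longrightarrow> x \<in> N \<Longrightarrow> r \<odot>\<^bsub>M\<^esub> x \<in> N"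
  by (rule submodule.smult_closed)

lemma submodule_add: "module R M \<Longrightarrow> submodule N R M \<Longrightarrow> x \<in> N \<Longrightarrow> y \<in> N \<Longrightarrow> x \<oplus>\<^bsub>M\<^esub> y \<in> N"
  by (rule module.submoduleE(5))

lemma submodule_preimage:
  assumes M: "module R M" and N: "module R N" and f: "f \<in> module_hom R M N" and S: "submodule S R N"
  shows "submodule {x \<in> carrier M. f x \<in> S} R M"
proof -
  interpret M: module R M by fact
  show ?thesis
    using submodule_zero[OF N S] module_hom_zero[OF M N f]
    by (intro M.submoduleI_linear)
      (auto simp: module_homD[OF f] submodule_add[OF N S] submodule_smult[OF S])
qed

lemma gen_submodule_submodule:
  assumes M: "module R M" and S: "S \<subseteq> carrier M"
  shows "submodule (gen_submodule R M S) R M"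
proof -
  interpret M: module R M by fact
  show ?thesis
  proof (rule M.submoduleI_linear)
    show "gen_submodule R M S \<subseteq> carrier M"
      using M.carrier_is_submodule S by (auto simp: gen_submodule_def)
  qed (auto simp: gen_submodule_def submodule_zero[OF M] submodule_add[OF M] submodule_smult)
qed

lemma gen_submodule_incl: "S \<subseteq> gen_submodule R M S"
  by (auto simp: gen_submodule_def)

lemma gen_submodule_least: "submodule N R M \<Longrightarrow> S \<subseteq> N \<Longrightarrow> gen_submodule R M S \<subseteq> N"
  by (auto simp: gen_submodule_def)

lemma regular_module_module:
  assumes "cring R"
  shows "module R (regular_module R)"
proof -
  interpret cring R by fact
  show ?thesis
    unfolding regular_module_def
    by (intro moduleI abelian_groupI)
      (auto simp: assms m_assoc l_distr r_distr a_ac intro: l_neg)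
qed

subsection \<open>Products\<close>

lemma prod_module_module:
  assumes R: "cring R" and M: "\<And>i. i \<in> I \<Longrightarrow> module R (M i)"
  shows "module R (prod_module I M)"
proof -
  have ag: "abelian_group (M i)" if "i \<in> I" for i
    using M[OF that] by (simp add: module_def)
  then have am: "abelian_monoid (M i)" if "i \<in> I" for i
    using that by (simp add: abelian_group_def)
  have neg: "\<exists>y\<in>carrier (prod_module I M). y \<oplus>\<^bsub>prod_module I M\<^esub> x = \<zero>\<^bsub>prod_module I M\<^esub>"
    if x: "x \<in> carrier (prod_module I M)" for x
    using x ag by (intro bexI[of _ "\<lambda>i\<in>I. \<ominus>\<^bsub>M i\<^esub> x i"])
      (auto simp: prod_module_def PiE_iff
        intro!: restrict_ext abelian_group.l_neg abelian_group.a_inv_closed)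
  have zero: "\<zero>\<^bsub>prod_module I M\<^esub> \<oplus>\<^bsub>prod_module I M\<^esub> x = x"
    and one: "\<one>\<^bsub>R\<^esub> \<odot>\<^bsub>prod_module I M\<^esub> x = x" if x: "x \<in> carrier (prod_module I M)" for x
    using x am M by (auto simp: prod_module_def PiE_iff fun_eq_iff extensional_def
        intro!: abelian_monoid.l_zero module.smult_one)
  show ?thesis
    by (intro moduleI abelian_groupI neg zero one)
      (use am M in \<open>auto simp: R prod_module_def PiE_iff
      module.smult_l_distr module.smult_assoc1 intro!: restrict_ext abelian_monoid.a_closed
      module.smult_closed module.smult_r_distr
      abelian_monoid.a_assoc abelian_monoid.zero_closed abelian_monoid.a_comm\<close>)
qed

lemma hom_module_module:
  assumes "module R M" "module R N"
  shows "module R (hom_module R M N)"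
proof -
  interpret M: module R M by fact
  interpret N: module R N by fact
  let ?P = "prod_module (carrier M) (\<lambda>_. N)"
  interpret P: module R ?P
    by (intro prod_module_module) (auto intro: assms M.R.is_cring)
  have "submodule (module_hom R M N \<inter> extensional (carrier M)) R ?P"
    by (rule P.submoduleI_linear)
      (auto simp: prod_module_def module_hom_def PiE_iff Pi_iff extensional_def N.a_ac
        N.smult_r_distr N.smult_assoc1[symmetric] M.R.m_comm)
  then show ?thesis
    unfolding hom_module_def
    by (rule submodule_carrier_module[OF P.module_axioms])
qed

subsection \<open>Quotients\<close>

text \<open>The scalar action on a quotient is given by a union over the members of a coset. All terms of the
  union are the same coset, because two members differ by an element of the submodule.\<close>

lemma quot_module_ops:
  assumes "module R M" "submodule N R M"
  shows quot_module_carrier: "carrier (quot_module M N) = (\<lambda>x. N +>\<^bsub>M\<^esub> x) ` carrier M"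
    and quot_module_zero: "\<zero>\<^bsub>quot_module M N\<^esub> = N +>\<^bsub>M\<^esub> \<zero>\<^bsub>M\<^esub>"
    and coset_mem_iff: "x \<in> carrier M \<Longrightarrow> y \<in> N +>\<^bsub>M\<^esub> x \<longleftrightarrow> y \<in> carrier M \<and> y \<ominus>\<^bsub>M\<^esub> x \<in> N"
    and coset_eq_iff: "x \<in> carrier M \<Longrightarrow> y \<in> carrier M \<Longrightarrow>
        N +>\<^bsub>M\<^esub> x = N +>\<^bsub>M\<^esub> y \<longleftrightarrow> x \<ominus>\<^bsub>M\<^esub> y \<in> N"
    and quot_module_add: "x \<in> carrier M \<Longrightarrow> y \<in> carrier M \<Longrightarrow>
        (N +>\<^bsub>M\<^esub> x) \<oplus>\<^bsub>quot_module M N\<^esub> (N +>\<^bsub>M\<^esub> y) = N +>\<^bsub>M\<^esub> (x \<oplus>\<^bsub>M\<^esub> y)"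
    and quot_module_smult: "x \<in> carrier M \<Longrightarrow> r \<in> carrier R \<Longrightarrow>
        r \<odot>\<^bsub>quot_module M N\<^esub> (N +>\<^bsub>M\<^esub> x) = N +>\<^bsub>M\<^esub> (r \<odot>\<^bsub>M\<^esub> x)"
proof -
  interpret M: module R M by fact
  interpret N: abelian_subgroup N M
    using submodule.axioms(1)[OF assms(2)]
    by (intro abelian_subgroupI3 additive_subgroup.intro M.abelian_group_axioms)
  show "carrier (quot_module M N) = (\<lambda>x. N +>\<^bsub>M\<^esub> x) ` carrier M"
    by (auto simp: quot_module_def a_r_coset_def A_RCOSETS_def RCOSETS_def)
  show "\<zero>\<^bsub>quot_module M N\<^esub> = N +>\<^bsub>M\<^esub> \<zero>\<^bsub>M\<^esub>"
    using N.a_subset by (simp add: quot_module_def M.a_coset_add_zero)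
  show mem: "y \<in> N +>\<^bsub>M\<^esub> x \<longleftrightarrow> y \<in> carrier M \<and> y \<ominus>\<^bsub>M\<^esub> x \<in> N" if "x \<in> carrier M" for x y
    using that N.a_rcos_module[of x y] N.a_elemrcos_carrier[of x y]
    by (auto simp: M.minus_eq)
  show eq: "N +>\<^bsub>M\<^esub> x = N +>\<^bsub>M\<^esub> y \<longleftrightarrow> x \<ominus>\<^bsub>M\<^esub> y \<in> N"
    if "x \<in> carrier M" "y \<in> carrier M" for x y
    using that mem[of y x] N.a_rcos_self[of x] N.a_repr_independence'[of x y] by metis
  show "(N +>\<^bsub>M\<^esub> x) \<oplus>\<^bsub>quot_module M N\<^esub> (N +>\<^bsub>M\<^esub> y) = N +>\<^bsub>M\<^esub> (x \<oplus>\<^bsub>M\<^esub> y)"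
    if "x \<in> carrier M" "y \<in> carrier M" for x y
    using that by (simp add: quot_module_def N.a_rcos_sum)
  show "r \<odot>\<^bsub>quot_module M N\<^esub> (N +>\<^bsub>M\<^esub> x) = N +>\<^bsub>M\<^esub> (r \<odot>\<^bsub>M\<^esub> x)"
    if x: "x \<in> carrier M" and r: "r \<in> carrier R" for x r
  proof -
    have "N +>\<^bsub>M\<^esub> (r \<odot>\<^bsub>M\<^esub> y) = N +>\<^bsub>M\<^esub> (r \<odot>\<^bsub>M\<^esub> x)" if "y \<in> N +>\<^bsub>M\<^esub> x" for y
    proof -
      from that mem[OF x] have y: "y \<in> carrier M" "y \<ominus>\<^bsub>M\<^esub> x \<in> N" by auto
      have "r \<odot>\<^bsub>M\<^esub> y \<ominus>\<^bsub>M\<^esub> r \<odot>\<^bsub>M\<^esub> x = r \<odot>\<^bsub>M\<^esub> (y \<ominus>\<^bsub>M\<^esub> x)"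
        using x y r by (simp add: M.minus_eq M.smult_r_distr M.smult_r_minus)
      also have "\<dots> \<in> N" by (rule submodule_smult[OF assms(2) r y(2)])
      finally show ?thesis using eq[OF M.smult_closed[OF r y(1)] M.smult_closed[OF r x]] by blast
    qed
    with N.a_rcos_self[OF x]
    have "(\<Union>y\<in>N +>\<^bsub>M\<^esub> x. N +>\<^bsub>M\<^esub> (r \<odot>\<^bsub>M\<^esub> y)) = N +>\<^bsub>M\<^esub> (r \<odot>\<^bsub>M\<^esub> x)"
      by blast
    then show ?thesis by (simp add: quot_module_def)
  qed
qed

lemma quot_module_module:
  assumes "module R M" "submodule N R M"
  shows "module R (quot_module M N)"
proof -
  interpret M: module R M by fact
  note ops = quot_module_carrier[OF assms] quot_module_zero[OF assms] quot_module_add[OF assms]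
    quot_module_smult[OF assms]
  show ?thesis
  proof (intro moduleI abelian_groupI, simp_all add: ops)
    fix x assume "x \<in> (+>\<^bsub>M\<^esub>) N ` carrier M"
    then show "\<exists>y\<in>carrier M. (N +>\<^bsub>M\<^esub> y) \<oplus>\<^bsub>quot_module M N\<^esub> x = N +>\<^bsub>M\<^esub> \<zero>\<^bsub>M\<^esub>"
      by (auto simp: ops M.l_neg intro!: bexI[of _ "\<ominus>\<^bsub>M\<^esub> _"])
  qed (auto simp: ops M.R.is_cring M.a_ac M.smult_l_distr M.smult_r_distr M.smult_assoc1)
qed

lemma quot_module_proj_hom:
  assumes "module R M" "submodule N R M"
  shows "(\<lambda>x. N +>\<^bsub>M\<^esub> x) \<in> module_hom R M (quot_module M N)"
  using quot_module_carrier[OF assms] quot_module_add[OF assms] quot_module_smult[OF assms]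
  by (intro module_homI) auto

text \<open>The first isomorphism theorem, with the kernel described by an arbitrary set, such as the image of
  another map.\<close>

lemma quot_module_kernel_isomorphic:
  assumes M: "module R M" and Q: "module R Q" and f: "f \<in> module_hom R M Q"
    and surj: "f ` carrier M = carrier Q"
    and ker: "\<And>x. x \<in> carrier M \<Longrightarrow> f x = \<zero>\<^bsub>Q\<^esub> \<longleftrightarrow> x \<in> N"
    and sub: "N \<subseteq> carrier M"
  shows "module_isomorphic R (quot_module M N) Q"
proof -
  interpret M: module R M by fact
  interpret Q: module R Q by fact
  have N: "N = {x \<in> carrier M. f x = \<zero>\<^bsub>Q\<^esub>}" using ker sub by auto
  have sN: "submodule N R M" unfolding N by (rule submodule_kernel[OF M Q f])
  note ops = quot_module_ops[OF M sN]
  note f' = module_homD[OF f]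
  define g where "g A = f (SOME x. x \<in> A \<and> x \<in> carrier M)" for A
  have eq: "N +>\<^bsub>M\<^esub> x = N +>\<^bsub>M\<^esub> y \<longleftrightarrow> f x = f y" if "x \<in> carrier M" "y \<in> carrier M" for x y
    unfolding ops(4)[OF that] ker[OF M.minus_closed[OF that], symmetric]
      module_hom_minus[OF M Q f that]
    using that f'(1) by (simp add: Q.minus_eq_zero_iff)
  have g: "g (N +>\<^bsub>M\<^esub> x) = f x" if x: "x \<in> carrier M" for x
  proof -
    have "x \<in> N +>\<^bsub>M\<^esub> x"
      using x ops(3)[OF x] submodule_zero[OF M sN] by (simp add: M.r_neg M.minus_eq)
    with x have "(SOME y. y \<in> N +>\<^bsub>M\<^esub> x \<and> y \<in> carrier M) \<in> N +>\<^bsub>M\<^esub> x \<and>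
        (SOME y. y \<in> N +>\<^bsub>M\<^esub> x \<and> y \<in> carrier M) \<in> carrier M" (is "?y \<in> _ \<and> _")
      by (intro someI[of "\<lambda>y. y \<in> N +>\<^bsub>M\<^esub> x \<and> y \<in> carrier M"]) auto
    then have "?y \<in> carrier M" "?y \<ominus>\<^bsub>M\<^esub> x \<in> N" using ops(3)[OF x] by auto
    then show ?thesis using x eq[of ?y x] ops(4)[of ?y x] by (simp add: g_def)
  qed
  have "g \<in> module_hom R (quot_module M N) Q"
    by (rule module_homI) (auto simp: ops g f')
  moreover have "bij_betw g (carrier (quot_module M N)) (carrier Q)"
    unfolding bij_betw_def inj_on_def surj[symmetric] ops(1)
    by (auto simp: g eq image_image)
  ultimately show ?thesis
    by (auto simp: module_isomorphic_def module_iso_def)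
qed

lemma module_isomorphic_sym:
  assumes M: "module R M" and N: "module R N" and iso: "module_isomorphic R M N"
  shows "module_isomorphic R N M"
proof -
  interpret M: module R M by fact
  from iso obtain f where f: "f \<in> module_hom R M N" and bij: "bij_betw f (carrier M) (carrier N)"
    by (auto simp: module_isomorphic_def module_iso_def)
  let ?g = "inv_into (carrier M) f"
  have g: "?g y \<in> carrier M" "f (?g y) = y" if "y \<in> carrier N" for y
    using bij that by (auto simp: bij_betw_def inv_into_into f_inv_into_f)
  have gf: "?g (f x) = x" if "x \<in> carrier M" for x
    using bij that by (simp add: bij_betw_def)
  have "?g \<in> module_hom R N M"
  proof (rule module_homI)
    fix y z r assume y: "y \<in> carrier N"
    show "?g y \<in> carrier M" by (rule g(1)[OF y])
    show "?g (y \<oplus>\<^bsub>N\<^esub> z) = ?g y \<oplus>\<^bsub>M\<^esub> ?g z" if z: "z \<in> carrier N"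
      using gf[OF M.a_closed[OF g(1)[OF y] g(1)[OF z]]] module_hom_add[OF f g(1)[OF y] g(1)[OF z]]
      by (simp add: g(2) y z)
    show "?g (r \<odot>\<^bsub>N\<^esub> y) = r \<odot>\<^bsub>M\<^esub> ?g y" if r: "r \<in> carrier R"
      using gf[OF M.smult_closed[OF r g(1)[OF y]]] module_hom_smult[OF f r g(1)[OF y]]
      by (simp add: g(2) y)
  qed
  then show ?thesis
    using bij_betw_inv_into[OF bij] by (auto simp: module_isomorphic_def module_iso_def)
qed

subsection \<open>Free modules\<close>

lemma free_module_module:
  assumes "cring R"
  shows "module R (free_module R S)"
proof -
  interpret cring R by fact
  have fin: "finite {s. c s \<oplus>\<^bsub>R\<^esub> d s \<noteq> \<zero>\<^bsub>R\<^esub>}"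
    if "finite {s. c s \<noteq> \<zero>\<^bsub>R\<^esub>}" "finite {s. d s \<noteq> \<zero>\<^bsub>R\<^esub>}" for c d
    by (rule finite_subset[OF _ finite_UnI[OF that]]) auto
  have fin': "finite {s. r \<otimes>\<^bsub>R\<^esub> d s \<noteq> \<zero>\<^bsub>R\<^esub>}"
    if "finite {s. d s \<noteq> \<zero>\<^bsub>R\<^esub>}" "r \<in> carrier R" for d r
    by (rule finite_subset[OF _ that(1)]) (auto simp: that)
  show ?thesis
    unfolding free_module_def
  proof (intro moduleI abelian_groupI, simp_all add: assms)
    fix x
    assume x: "(\<forall>s. x s \<in> carrier R) \<and> (\<forall>s. s \<notin> S \<longrightarrow> x s = \<zero>\<^bsub>R\<^esub>) \<and> finite {s. x s \<noteq> \<zero>\<^bsub>R\<^esub>}"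
    then have "{s. \<ominus>\<^bsub>R\<^esub> x s \<noteq> \<zero>\<^bsub>R\<^esub>} = {s. x s \<noteq> \<zero>\<^bsub>R\<^esub>}" by auto
    with x show "\<exists>y. (\<forall>s. y s \<in> carrier R) \<and> (\<forall>s. s \<notin> S \<longrightarrow> y s = \<zero>\<^bsub>R\<^esub>) \<and>
      finite {s. y s \<noteq> \<zero>\<^bsub>R\<^esub>} \<and> (\<lambda>s. y s \<oplus>\<^bsub>R\<^esub> x s) = (\<lambda>_. \<zero>\<^bsub>R\<^esub>)"
      by (intro exI[of _ "\<lambda>s. \<ominus>\<^bsub>R\<^esub> x s"]) (auto simp: l_neg)
  qed (auto simp: fin fin' a_ac l_distr r_distr m_assoc fun_eq_iff)
qed

context cring begin

lemma basis_elem_closed: "s \<in> S \<Longrightarrow> basis_elem R s \<in> carrier (free_module R S)"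
  by (auto simp: basis_elem_def free_module_def intro: finite_subset[of _ "{s}"])

lemma basis_elem_support: "basis_elem R s t \<noteq> \<zero> \<Longrightarrow> t = s"
  by (auto simp: basis_elem_def split: if_splits)

lemma free_module_add: "(c \<oplus>\<^bsub>free_module R S\<^esub> d) s = c s \<oplus> d s"
  and free_module_smult: "(r \<odot>\<^bsub>free_module R S\<^esub> c) s = r \<otimes> c s"
  by (auto simp: free_module_def)

lemma free_moduleD:
  assumes "c \<in> carrier (free_module R S)"
  shows free_module_coeff: "c s \<in> carrier R"
    and free_module_finite: "finite {s. c s \<noteq> \<zero>}"
    and free_module_support: "c s \<noteq> \<zero> \<Longrightarrow> s \<in> S"
  using assms by (auto simp: free_module_def)

lemma free_module_eval_hom: "(\<lambda>c. c s) \<in> module_hom R (free_module R S) (regular_module R)"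
  by (rule module_homI) (auto simp: free_module_def regular_module_def)

lemma free_module_induct [consumes 1, case_names zero step]:
  assumes c: "c \<in> carrier (free_module R S)"
    and zero: "P \<zero>\<^bsub>free_module R S\<^esub>"
    and step: "\<And>c r s. c \<in> carrier (free_module R S) \<Longrightarrow> P c \<Longrightarrow> r \<in> carrier R \<Longrightarrow> s \<in> S \<Longrightarrow>
      P (c \<oplus>\<^bsub>free_module R S\<^esub> r \<odot>\<^bsub>free_module R S\<^esub> basis_elem R s)"
  shows "P c"
proof -
  have "P c" if "finite A" "c \<in> carrier (free_module R S)" "{s. c s \<noteq> \<zero>} \<subseteq> A" for A c
    using that
  proof (induction A arbitrary: c rule: finite_induct)
    case empty
    then have "c = \<zero>\<^bsub>free_module R S\<^esub>" by (auto simp: free_module_def)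
    then show ?case using zero by simp
  next
    case (insert a A)
    show ?case
    proof (cases "c a = \<zero>")
      case True
      then show ?thesis using insert by auto
    next
      case False
      let ?c = "c(a := \<zero>)"
      have "a \<in> S" "c a \<in> carrier R" "?c \<in> carrier (free_module R S)" "{s. ?c s \<noteq> \<zero>} \<subseteq> A"
        using insert.prems False by (auto simp: free_module_def split: if_splits
            intro: finite_subset[of _ "{s. c s \<noteq> \<zero>}"])
      moreover have "c = ?c \<oplus>\<^bsub>free_module R S\<^esub> c a \<odot>\<^bsub>free_module R S\<^esub> basis_elem R a"
        using insert.prems by (auto simp: free_module_def basis_elem_def fun_eq_iff)
      ultimately show ?thesis using step[of ?c "c a" a] insert.IH by metis
    qed
  qed
  then show ?thesis using c by (auto simp: free_module_def)
qed

lemma free_module_span: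
  assumes "submodule N R (free_module R S)" "\<And>s. s \<in> S \<Longrightarrow> basis_elem R s \<in> N"
    and c: "c \<in> carrier (free_module R S)"
  shows "c \<in> N"
  using c
proof (induction rule: free_module_induct)
  case zero
  show ?case by (rule submodule_zero[OF free_module_module[OF is_cring] assms(1)])
next
  case (step c r s)
  then show ?case
    by (intro submodule_add[OF free_module_module[OF is_cring] assms(1)]
        submodule_smult[OF assms(1)] assms(2))
qed

lemma free_module_hom_eq:
  assumes "module R N" "f \<in> module_hom R (free_module R S) N" "g \<in> module_hom R (free_module R S) N"
    and "\<And>s. s \<in> S \<Longrightarrow> f (basis_elem R s) = g (basis_elem R s)"
    and c: "c \<in> carrier (free_module R S)"
  shows "f c = g c"
proof -
  interpret E: module R "free_module R S" by (rule free_module_module[OF is_cring])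
  show ?thesis
    using c
  proof (induction rule: free_module_induct)
    case zero
    then show ?case by (simp add: module_hom_zero[OF E.module_axioms assms(1)] assms(2,3))
  next
    case (step c r s)
    then show ?case
      by (simp add: module_homD[OF assms(2)] module_homD[OF assms(3)] basis_elem_closed assms(4))
  qed
qed

end

definition lin_ext ::
  "('r, 'k) ring_scheme \<Rightarrow> ('r, 'n, 'd) module_scheme \<Rightarrow> ('s \<Rightarrow> 'n) \<Rightarrow> ('s \<Rightarrow> 'r) \<Rightarrow> 'n" where
  "lin_ext R N \<phi> c = (\<Oplus>\<^bsub>N\<^esub> s \<in> {s. c s \<noteq> \<zero>\<^bsub>R\<^esub>}. c s \<odot>\<^bsub>N\<^esub> \<phi> s)"

context module begin

lemma lin_ext_superset:
  assumes "c \<in> carrier (free_module R S)" "\<And>s. s \<in> S \<Longrightarrow> \<phi> s \<in> carrier M"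
    and "finite A" "{s. c s \<noteq> \<zero>} \<subseteq> A" "A \<subseteq> S"
  shows "lin_ext R M \<phi> c = (\<Oplus>\<^bsub>M\<^esub> s \<in> A. c s \<odot>\<^bsub>M\<^esub> \<phi> s)"
  unfolding lin_ext_def
  by (rule M.add.finprod_mono_neutral_cong_left)
    (use assms in \<open>auto simp: free_module_def intro!: smult_closed\<close>)

lemma lin_ext_hom:
  assumes phi: "\<And>s. s \<in> S \<Longrightarrow> \<phi> s \<in> carrier M"
  shows "lin_ext R M \<phi> \<in> module_hom R (free_module R S) M"
proof (rule module_homI)
  let ?E = "free_module R S"
  interpret E: module R ?E by (rule free_module_module[OF R.is_cring])
  have closed: "c s \<odot>\<^bsub>M\<^esub> \<phi> s \<in> carrier M" if "c \<in> carrier ?E" "s \<in> S" for c s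
    using that phi by (auto simp: free_module_def)
  have carr: "c s \<in> carrier R" and fin: "finite {s. c s \<noteq> \<zero>}" and sub: "{s. c s \<noteq> \<zero>} \<subseteq> S"
    if "c \<in> carrier ?E" for c s
    using that by (auto simp: free_module_def)
  fix c assume c: "c \<in> carrier ?E"
  show "lin_ext R M \<phi> c \<in> carrier M"
    unfolding lin_ext_def using closed[OF c] sub[OF c] by (intro M.add.finprod_closed) blast
  {
    fix d assume d: "d \<in> carrier ?E"
    let ?A = "{s. c s \<noteq> \<zero>} \<union> {s. d s \<noteq> \<zero>}"
    have A: "finite ?A" "?A \<subseteq> S" using fin sub c d by auto
    note closed' = closed[OF c subsetD[OF A(2)]] closed[OF d subsetD[OF A(2)]]
    have "lin_ext R M \<phi> (c \<oplus>\<^bsub>?E\<^esub> d) = (\<Oplus>\<^bsub>M\<^esub> s \<in> ?A. (c \<oplus>\<^bsub>?E\<^esub> d) s \<odot>\<^bsub>M\<^esub> \<phi> s)"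
      by (rule lin_ext_superset[OF E.a_closed[OF c d] phi A(1) _ A(2)])
        (auto simp: R.free_module_add)
    also have "\<dots> = (\<Oplus>\<^bsub>M\<^esub> s \<in> ?A. c s \<odot>\<^bsub>M\<^esub> \<phi> s \<oplus>\<^bsub>M\<^esub> d s \<odot>\<^bsub>M\<^esub> \<phi> s)"
    proof (rule M.add.finprod_cong'[OF refl])
      fix s assume "s \<in> ?A"
      then have "s \<in> S" using A(2) by blast
      then show "(c \<oplus>\<^bsub>?E\<^esub> d) s \<odot>\<^bsub>M\<^esub> \<phi> s = c s \<odot>\<^bsub>M\<^esub> \<phi> s \<oplus>\<^bsub>M\<^esub> d s \<odot>\<^bsub>M\<^esub> \<phi> s"
        using carr[OF c] carr[OF d] phi by (simp add: R.free_module_add smult_l_distr)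
    qed (intro Pi_I M.a_closed closed')
    also have "\<dots> = (\<Oplus>\<^bsub>M\<^esub> s \<in> ?A. c s \<odot>\<^bsub>M\<^esub> \<phi> s) \<oplus>\<^bsub>M\<^esub> (\<Oplus>\<^bsub>M\<^esub> s \<in> ?A. d s \<odot>\<^bsub>M\<^esub> \<phi> s)"
      by (intro M.add.finprod_multf Pi_I closed')
    also have "\<dots> = lin_ext R M \<phi> c \<oplus>\<^bsub>M\<^esub> lin_ext R M \<phi> d"
      using lin_ext_superset[OF c phi A(1) _ A(2)] lin_ext_superset[OF d phi A(1) _ A(2)] by simp
    finally show "lin_ext R M \<phi> (c \<oplus>\<^bsub>?E\<^esub> d) = lin_ext R M \<phi> c \<oplus>\<^bsub>M\<^esub> lin_ext R M \<phi> d" .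
  }
  {
    fix r assume r: "r \<in> carrier R"
    let ?A = "{s. c s \<noteq> \<zero>}"
    note closed' = closed[OF c subsetD[OF sub[OF c]]]
    have "lin_ext R M \<phi> (r \<odot>\<^bsub>?E\<^esub> c) = (\<Oplus>\<^bsub>M\<^esub> s \<in> ?A. (r \<odot>\<^bsub>?E\<^esub> c) s \<odot>\<^bsub>M\<^esub> \<phi> s)"
      by (rule lin_ext_superset[OF E.smult_closed[OF r c] phi fin[OF c] _ sub[OF c]])
        (use r in \<open>auto simp: R.free_module_smult\<close>)
    also have "\<dots> = (\<Oplus>\<^bsub>M\<^esub> s \<in> ?A. r \<odot>\<^bsub>M\<^esub> (c s \<odot>\<^bsub>M\<^esub> \<phi> s))"
    proof (rule M.add.finprod_cong'[OF refl])
      fix s assume "s \<in> ?A"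
      then have "s \<in> S" using sub[OF c] by blast
      then show "(r \<odot>\<^bsub>?E\<^esub> c) s \<odot>\<^bsub>M\<^esub> \<phi> s = r \<odot>\<^bsub>M\<^esub> (c s \<odot>\<^bsub>M\<^esub> \<phi> s)"
        using carr[OF c] phi r by (simp add: R.free_module_smult smult_assoc1)
    qed (intro Pi_I smult_closed r closed')
    also have "\<dots> = r \<odot>\<^bsub>M\<^esub> lin_ext R M \<phi> c"
      unfolding lin_ext_def
      by (intro finsum_smult_ldistr[symmetric] fin[OF c] r Pi_I closed')
    finally show "lin_ext R M \<phi> (r \<odot>\<^bsub>?E\<^esub> c) = r \<odot>\<^bsub>M\<^esub> lin_ext R M \<phi> c" .
  }
qed

lemma lin_ext_basis:
  assumes "\<phi> s \<in> carrier M"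
  shows "lin_ext R M \<phi> (basis_elem R s) = \<phi> s"
proof -
  have "lin_ext R M \<phi> (basis_elem R s) = (\<Oplus>\<^bsub>M\<^esub> t \<in> {s}. basis_elem R s t \<odot>\<^bsub>M\<^esub> \<phi> t)"
    using assms by (intro lin_ext_superset[of _ "{s}"] R.basis_elem_closed)
      (auto dest: R.basis_elem_support)
  also have "\<dots> = basis_elem R s s \<odot>\<^bsub>M\<^esub> \<phi> s"
    using assms by (simp add: basis_elem_def)
  finally show ?thesis using assms by (simp add: basis_elem_def)
qed

end

lemma finsum_regular_module: "finsum (regular_module R) f A = finsum R f A"
  by (simp add: finsum_def finprod_def regular_module_def)

text \<open>The action of a morphism on a free functor and the composition of formal combinations of bisets are
  both given by explicit sums over the fibres of a map of bases. This lemma recognises such sums as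
  linear maps.\<close>

lemma (in cring) lin_ext_pushforward_eval:
  assumes c: "c \<in> carrier (free_module R S)" and p: "\<And>s. s \<in> S \<Longrightarrow> p s \<in> S'"
  shows "lin_ext R (free_module R S') (\<lambda>s. basis_elem R (p s)) c z = (\<Oplus>s\<in>{s. c s \<noteq> \<zero> \<and> p s = z}. c s)"
proof -
  let ?E = "free_module R S'" and ?S = "{s. c s \<noteq> \<zero>}"
  interpret E: module R ?E by (rule free_module_module[OF is_cring])
  have closed: "c s \<odot>\<^bsub>?E\<^esub> basis_elem R (p s) \<in> carrier ?E" if "s \<in> ?S" for s
    using that by (intro E.smult_closed free_module_coeff[OF c] basis_elem_closed p free_module_support[OF c]) auto
  have "lin_ext R ?E (\<lambda>s. basis_elem R (p s)) c z = (\<Oplus>s\<in>?S. (c s \<odot>\<^bsub>?E\<^esub> basis_elem R (p s)) z)"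
    unfolding lin_ext_def
    using module_hom_finsum[OF E.module_axioms regular_module_module[OF is_cring] free_module_eval_hom
        free_module_finite[OF c], of "\<lambda>s. c s \<odot>\<^bsub>?E\<^esub> basis_elem R (p s)"] closed
    by (simp add: finsum_regular_module Pi_iff)
  also have "\<dots> = (\<Oplus>s\<in>{s. c s \<noteq> \<zero> \<and> p s = z}. c s)"
  proof (rule add.finprod_mono_neutral_cong_right)
    show "(\<lambda>s. (c s \<odot>\<^bsub>?E\<^esub> basis_elem R (p s)) z) \<in> ?S \<rightarrow> carrier R"
      using free_module_coeff[OF closed] by blast
  qed (use free_module_coeff[OF c] free_module_finite[OF c] in \<open>auto simp: free_module_smult basis_elem_def\<close>)
  finally show ?thesis .
qed

section \<open>Modules over a small category\<close>

lemma cat_moduleD: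
  assumes "cat_module R C F"
  shows cat_module_ob: "x \<in> Obj C \<Longrightarrow> module R (ob F x)"
    and cat_module_ar: "x \<in> Obj C \<Longrightarrow> y \<in> Obj C \<Longrightarrow> a \<in> Hom C x y \<Longrightarrow>
      ar F x y a \<in> module_hom R (ob F y) (ob F x)"
    and cat_module_ident: "x \<in> Obj C \<Longrightarrow> m \<in> carrier (ob F x) \<Longrightarrow> ar F x x (Ident C x) m = m"
    and cat_module_comp: "x \<in> Obj C \<Longrightarrow> y \<in> Obj C \<Longrightarrow> z \<in> Obj C \<Longrightarrow> a \<in> Hom C x y \<Longrightarrow>
      b \<in> Hom C y z \<Longrightarrow> m \<in> carrier (ob F z) \<Longrightarrow>
      ar F x z (Comp C b a) m = ar F x y a (ar F y z b m)"
  using assms by (auto simp: cat_module_def)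

lemmas cat_module_ar_closed = module_hom_closed[OF cat_module_ar]

text \<open>Natural transformations whose values outside the carriers are unconstrained, so that they can be composed
  freely; the elements of \<^const>\<open>nat_module\<close> are those which are extensional.\<close>

definition transformation ::
  "('r, 'k) ring_scheme \<Rightarrow> ('o, 'a) cat \<Rightarrow> ('o, 'a, 'r, 'm) fun_data \<Rightarrow> ('o, 'a, 'r, 'n) fun_data
    \<Rightarrow> ('o \<Rightarrow> 'm \<Rightarrow> 'n) \<Rightarrow> bool" where
  "transformation R C M N d \<longleftrightarrow>
     (\<forall>x\<in>Obj C. d x \<in> module_hom R (ob M x) (ob N x)) \<and>
     (\<forall>x\<in>Obj C. \<forall>y\<in>Obj C. \<forall>a\<in>Hom C x y. \<forall>m\<in>carrier (ob M y).
        d x (ar M x y a m) = ar N x y a (d y m))"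

lemma transformationD:
  assumes "transformation R C M N d"
  shows transformation_hom: "x \<in> Obj C \<Longrightarrow> d x \<in> module_hom R (ob M x) (ob N x)"
    and transformation_natural: "x \<in> Obj C \<Longrightarrow> y \<in> Obj C \<Longrightarrow> a \<in> Hom C x y \<Longrightarrow>
      m \<in> carrier (ob M y) \<Longrightarrow> d x (ar M x y a m) = ar N x y a (d y m)"
  using assms by (auto simp: transformation_def)

lemmas transformation_closed = module_hom_closed[OF transformation_hom]

lemma nat_module_carrier:
  "\<eta> \<in> carrier (nat_module R C M N) \<longleftrightarrow> transformation R C M N \<eta> \<and>
     \<eta> \<in> extensional (Obj C) \<and> (\<forall>x\<in>Obj C. \<eta> x \<in> extensional (carrier (ob M x)))"
  by (auto simp: nat_module_def hom_module_def transformation_def PiE_iff)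

lemma nat_module_transformation:
  "\<eta> \<in> carrier (nat_module R C M N) \<Longrightarrow> transformation R C M N \<eta>"
  by (simp add: nat_module_carrier)

lemma nat_module_ops:
  assumes "x \<in> Obj C" "m \<in> carrier (ob M x)"
  shows nat_module_zero: "\<zero>\<^bsub>nat_module R C M N\<^esub> x m = \<zero>\<^bsub>ob N x\<^esub>"
    and nat_module_add: "(\<eta> \<oplus>\<^bsub>nat_module R C M N\<^esub> \<theta>) x m = \<eta> x m \<oplus>\<^bsub>ob N x\<^esub> \<theta> x m"
    and nat_module_smult: "(r \<odot>\<^bsub>nat_module R C M N\<^esub> \<eta>) x m = r \<odot>\<^bsub>ob N x\<^esub> \<eta> x m"
  using assms by (simp_all add: nat_module_def hom_module_def prod_module_def)

lemma nat_module_eqI: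
  assumes "\<eta> \<in> carrier (nat_module R C M N)" "\<theta> \<in> carrier (nat_module R C M N)"
    and "\<And>x m. x \<in> Obj C \<Longrightarrow> m \<in> carrier (ob M x) \<Longrightarrow> \<eta> x m = \<theta> x m"
  shows "\<eta> = \<theta>"
  using assms unfolding nat_module_carrier
  by (intro extensionalityI[of _ "Obj C"] extensionalityI[of _ "carrier (ob M _)"]) auto

lemma restrict_transformation:
  assumes "transformation R C M N d" "cat_module R C M"
  shows "(\<lambda>x\<in>Obj C. \<lambda>m\<in>carrier (ob M x). d x m) \<in> carrier (nat_module R C M N)"
  unfolding nat_module_carrier
proof (intro conjI ballI)
  show "transformation R C M N (\<lambda>x\<in>Obj C. \<lambda>m\<in>carrier (ob M x). d x m)"
    unfolding transformation_def
  proof (intro conjI ballI)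
    fix x assume x: "x \<in> Obj C"
    show "(\<lambda>x\<in>Obj C. \<lambda>m\<in>carrier (ob M x). d x m) x \<in> module_hom R (ob M x) (ob N x)"
      using x by (intro module_hom_cong[OF transformation_hom[OF assms(1)]]
          cat_module_ob[OF assms(2)]) auto
  qed (auto simp: transformation_natural[OF assms(1)] cat_module_ar_closed[OF assms(2)])
qed auto

lemma transformation_compose:
  assumes "transformation R C M N d" "transformation R C N P e"
  shows "transformation R C M P (\<lambda>x m. e x (d x m))"
  unfolding transformation_def
proof (intro conjI ballI)
  show "(\<lambda>m. e x (d x m)) \<in> module_hom R (ob M x) (ob P x)" if "x \<in> Obj C" for x
    by (rule module_hom_compose[OF transformation_hom[OF assms(1) that] transformation_hom[OF assms(2) that]])
qed (simp add: transformation_natural[OF assms(1)] transformation_natural[OF assms(2)]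
    transformation_closed[OF assms(1)])

lemma nat_module_module:
  assumes R: "cring R" and M: "cat_module R C M" and N: "cat_module R C N"
  shows "module R (nat_module R C M N)"
proof -
  let ?P = "prod_module (Obj C) (\<lambda>x. hom_module R (ob M x) (ob N x))"
  have hom: "module R (hom_module R (ob M x) (ob N x))" if "x \<in> Obj C" for x
    using that by (intro hom_module_module cat_module_ob[OF M] cat_module_ob[OF N])
  interpret P: module R ?P by (intro prod_module_module R hom)
  let ?S = "{\<eta> \<in> \<Pi>\<^sub>E x\<in>Obj C. carrier (hom_module R (ob M x) (ob N x)).
    \<forall>x\<in>Obj C. \<forall>y\<in>Obj C. \<forall>a\<in>Hom C x y. \<forall>m\<in>carrier (ob M y).
      \<eta> x (ar M x y a m) = ar N x y a (\<eta> y m)}"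
  note Mar = cat_module_ar_closed[OF M]
  have ev: "\<eta> x m \<in> carrier (ob N x)"
    if "\<eta> \<in> ?S" "x \<in> Obj C" "m \<in> carrier (ob M x)" for \<eta> x m
    using that by (auto simp: hom_module_def PiE_iff module_hom_def)
  have "submodule ?S R ?P"
  proof (rule P.submoduleI_linear)
    show "?S \<subseteq> carrier ?P" by (auto simp: prod_module_def)
    have zero: "\<zero>\<^bsub>?P\<^esub> x m = \<zero>\<^bsub>ob N x\<^esub>" if "x \<in> Obj C" "m \<in> carrier (ob M x)" for x m
      using that by (simp add: hom_module_def prod_module_def)
    have "\<zero>\<^bsub>?P\<^esub> \<in> (\<Pi>\<^sub>E x\<in>Obj C. carrier (hom_module R (ob M x) (ob N x)))"
      using P.zero_closed by (simp add: prod_module_def)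
    then show "\<zero>\<^bsub>?P\<^esub> \<in> ?S"
      by (auto simp: zero Mar module_hom_zero[OF cat_module_ob[OF N] cat_module_ob[OF N] cat_module_ar[OF N]])
    show "\<eta> \<oplus>\<^bsub>?P\<^esub> \<theta> \<in> ?S" if \<eta>: "\<eta> \<in> ?S" and \<theta>: "\<theta> \<in> ?S" for \<eta> \<theta>
    proof -
      have add: "(\<eta> \<oplus>\<^bsub>?P\<^esub> \<theta>) x m = \<eta> x m \<oplus>\<^bsub>ob N x\<^esub> \<theta> x m"
        if "x \<in> Obj C" "m \<in> carrier (ob M x)" for x m
        using that by (simp add: hom_module_def prod_module_def)
      have "\<eta> \<oplus>\<^bsub>?P\<^esub> \<theta> \<in> (\<Pi>\<^sub>E x\<in>Obj C. carrier (hom_module R (ob M x) (ob N x)))"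
        using P.a_closed[of \<eta> \<theta>] \<eta> \<theta> by (simp add: prod_module_def)
      then show ?thesis
        using \<eta> \<theta> by (auto simp: add Mar module_hom_add[OF cat_module_ar[OF N]] ev[OF \<eta>] ev[OF \<theta>])
    qed
    show "r \<odot>\<^bsub>?P\<^esub> \<eta> \<in> ?S" if r: "r \<in> carrier R" and \<eta>: "\<eta> \<in> ?S" for r \<eta>
    proof -
      have smult: "(r \<odot>\<^bsub>?P\<^esub> \<eta>) x m = r \<odot>\<^bsub>ob N x\<^esub> \<eta> x m"
        if "x \<in> Obj C" "m \<in> carrier (ob M x)" for x m
        using that by (simp add: hom_module_def prod_module_def)
      have "r \<odot>\<^bsub>?P\<^esub> \<eta> \<in> (\<Pi>\<^sub>E x\<in>Obj C. carrier (hom_module R (ob M x) (ob N x)))"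
        using P.smult_closed[of r \<eta>] \<eta> r by (simp add: prod_module_def)
      then show ?thesis
        using \<eta> r by (auto simp: smult Mar module_hom_smult[OF cat_module_ar[OF N]] ev[OF \<eta>])
    qed
  qed
  then show ?thesis
    unfolding nat_module_def by (rule submodule_carrier_module[OF P.module_axioms])
qed

lemma lim_module_carrier:
  "v \<in> carrier (lim_module C F) \<longleftrightarrow> v \<in> (\<Pi>\<^sub>E x\<in>Obj C. carrier (ob F x)) \<and>
     (\<forall>x\<in>Obj C. \<forall>y\<in>Obj C. \<forall>a\<in>Hom C x y. ar F x y a (v y) = v x)"
  by (simp add: lim_module_def)

lemma lim_module_module:
  assumes R: "cring R" and F: "cat_module R C F"
  shows "module R (lim_module C F)"
proof -
  let ?P = "prod_module (Obj C) (ob F)"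
  interpret P: module R ?P by (intro prod_module_module R cat_module_ob[OF F])
  have "submodule {v \<in> \<Pi>\<^sub>E x\<in>Obj C. carrier (ob F x).
      \<forall>x\<in>Obj C. \<forall>y\<in>Obj C. \<forall>a\<in>Hom C x y. ar F x y a (v y) = v x} R ?P" (is "submodule ?S R _")
  proof (rule P.submoduleI_linear)
    show "?S \<subseteq> carrier ?P" by (auto simp: prod_module_def)
    show "\<zero>\<^bsub>?P\<^esub> \<in> ?S"
      using P.zero_closed
      by (auto simp: prod_module_def
          module_hom_zero[OF cat_module_ob[OF F] cat_module_ob[OF F] cat_module_ar[OF F]])
    show "v \<oplus>\<^bsub>?P\<^esub> w \<in> ?S" if "v \<in> ?S" "w \<in> ?S" for v w
      using that P.a_closed[of v w]
      by (auto simp: prod_module_def module_hom_add[OF cat_module_ar[OF F]] PiE_iff)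
    show "r \<odot>\<^bsub>?P\<^esub> v \<in> ?S" if "r \<in> carrier R" "v \<in> ?S" for r v
      using that P.smult_closed[of r v]
      by (auto simp: prod_module_def module_hom_smult[OF cat_module_ar[OF F]] PiE_iff)
  qed
  then show ?thesis
    unfolding lim_module_def by (rule submodule_carrier_module[OF P.module_axioms])
qed

subsection \<open>Subfunctors and quotient functors\<close>

lemma sub_functor_cat_module:
  assumes F: "cat_module R C F"
    and S: "\<And>x. x \<in> Obj C \<Longrightarrow> submodule (S x) R (ob F x)"
    and ar: "\<And>x y a m. x \<in> Obj C \<Longrightarrow> y \<in> Obj C \<Longrightarrow> a \<in> Hom C x y \<Longrightarrow> m \<in> S y \<Longrightarrow> ar F x y a m \<in> S x"
  shows "cat_module R C (sub_functor F S)"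
  unfolding cat_module_def sub_functor_def
proof (intro conjI ballI; simp)
  have sub: "m \<in> carrier (ob F x)" if "x \<in> Obj C" "m \<in> S x" for x m
    using submodule_subset[OF cat_module_ob[OF F] S] that by blast
  fix x assume x: "x \<in> Obj C"
  show "module R ((ob F x)\<lparr>carrier := S x\<rparr>)"
    by (rule submodule_carrier_module[OF cat_module_ob[OF F x] S[OF x]])
  {
    fix m assume "m \<in> S x"
    then show "ar F x x (Ident C x) m = m" using sub[OF x] cat_module_ident[OF F x] by blast
  }
  fix y a assume y: "y \<in> Obj C" and a: "a \<in> Hom C x y"
  show "ar F x y a \<in> module_hom R ((ob F y)\<lparr>carrier := S y\<rparr>) ((ob F x)\<lparr>carrier := S x\<rparr>)"
    using sub[OF y] ar[OF x y a] by (intro module_homI) (simp_all add: module_homD[OF cat_module_ar[OF F x y a]])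
  fix z b m assume "z \<in> Obj C" "b \<in> Hom C y z" "m \<in> S z"
  then show "ar F x z (Comp C b a) m = ar F x y a (ar F y z b m)"
    using x y a by (intro cat_module_comp[OF F] sub)
qed

lemma quot_functor_ob: "ob (quot_functor F S) x = quot_module (ob F x) (S x)"
  by (simp add: quot_functor_def)

lemma quot_functor_ar:
  assumes F: "cat_module R C F"
    and S: "\<And>x. x \<in> Obj C \<Longrightarrow> submodule (S x) R (ob F x)"
    and ar: "\<And>x y a m. x \<in> Obj C \<Longrightarrow> y \<in> Obj C \<Longrightarrow> a \<in> Hom C x y \<Longrightarrow> m \<in> S y \<Longrightarrow> ar F x y a m \<in> S x"
    and x: "x \<in> Obj C" and y: "y \<in> Obj C" and a: "a \<in> Hom C x y" and m: "m \<in> carrier (ob F y)"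
  shows "ar (quot_functor F S) x y a (S y +>\<^bsub>ob F y\<^esub> m) = S x +>\<^bsub>ob F x\<^esub> ar F x y a m"
proof -
  interpret Y: module R "ob F y" by (rule cat_module_ob[OF F y])
  note qx = quot_module_ops[OF cat_module_ob[OF F x] S[OF x]]
  note qy = quot_module_ops[OF cat_module_ob[OF F y] S[OF y]]
  note hom = cat_module_ar[OF F x y a]
  have "S x +>\<^bsub>ob F x\<^esub> ar F x y a n = S x +>\<^bsub>ob F x\<^esub> ar F x y a m"
    if "n \<in> S y +>\<^bsub>ob F y\<^esub> m" for n
  proof -
    have n: "n \<in> carrier (ob F y)" "n \<ominus>\<^bsub>ob F y\<^esub> m \<in> S y" using that qy(3)[OF m] by auto
    then have "ar F x y a n \<ominus>\<^bsub>ob F x\<^esub> ar F x y a m \<in> S x"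
      using ar[OF x y a n(2)] module_hom_minus[OF cat_module_ob[OF F y] cat_module_ob[OF F x] hom n(1) m]
      by simp
    then show ?thesis
      using qx(4)[OF module_hom_closed[OF hom n(1)] module_hom_closed[OF hom m]] by blast
  qed
  moreover have "m \<in> S y +>\<^bsub>ob F y\<^esub> m"
    using m qy(3)[OF m] submodule_zero[OF cat_module_ob[OF F y] S[OF y]] by (simp add: Y.r_neg Y.minus_eq)
  ultimately have "(\<Union>n\<in>S y +>\<^bsub>ob F y\<^esub> m. S x +>\<^bsub>ob F x\<^esub> ar F x y a n) = S x +>\<^bsub>ob F x\<^esub> ar F x y a m"
    by blast
  then show ?thesis by (simp add: quot_functor_def)
qed

lemma quot_functor_cat_module:
  assumes F: "cat_module R C F"
    and S: "\<And>x. x \<in> Obj C \<Longrightarrow> submodule (S x) R (ob F x)"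
    and ar: "\<And>x y a m. x \<in> Obj C \<Longrightarrow> y \<in> Obj C \<Longrightarrow> a \<in> Hom C x y \<Longrightarrow> m \<in> S y \<Longrightarrow> ar F x y a m \<in> S x"
    and comp: "\<And>x y z a b. x \<in> Obj C \<Longrightarrow> y \<in> Obj C \<Longrightarrow> z \<in> Obj C \<Longrightarrow> a \<in> Hom C x y \<Longrightarrow>
      b \<in> Hom C y z \<Longrightarrow> Comp C b a \<in> Hom C x z"
    and ident: "\<And>x. x \<in> Obj C \<Longrightarrow> Ident C x \<in> Hom C x x"
  shows "cat_module R C (quot_functor F S)"
  unfolding cat_module_def quot_functor_ob
proof (intro conjI ballI)
  note q = quot_module_ops[OF cat_module_ob[OF F] S]
  note qar = quot_functor_ar[OF F S ar]
  fix x assume x: "x \<in> Obj C"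
  show "module R (quot_module (ob F x) (S x))"
    by (rule quot_module_module[OF cat_module_ob[OF F x] S[OF x]])
  {
    fix A assume "A \<in> carrier (quot_module (ob F x) (S x))"
    then show "ar (quot_functor F S) x x (Ident C x) A = A"
      using x ident[OF x] by (auto simp: q(1) qar cat_module_ident[OF F])
  }
  fix y a assume y: "y \<in> Obj C" and a: "a \<in> Hom C x y"
  note hom = module_homD[OF cat_module_ar[OF F x y a]]
  interpret Y: module R "ob F y" by (rule cat_module_ob[OF F y])
  show "ar (quot_functor F S) x y a \<in> module_hom R (quot_module (ob F y) (S y)) (quot_module (ob F x) (S x))"
    using x y a by (intro module_homI) (auto simp: q(1,5,6) qar hom)
  fix z b A assume zb: "z \<in> Obj C" "b \<in> Hom C y z" "A \<in> carrier (quot_module (ob F z) (S z))"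
  then show "ar (quot_functor F S) x z (Comp C b a) A
      = ar (quot_functor F S) x y a (ar (quot_functor F S) y z b A)"
    using x y a comp[OF x y zb(1) a zb(2)]
    by (auto simp: q(1) qar cat_module_comp[OF F x y] cat_module_ar_closed[OF F])
qed

lemma const_functor_cat_module: "cring R \<Longrightarrow> cat_module R C (const_functor R)"
  by (auto simp: cat_module_def const_functor_def regular_module_module intro!: module_homI)

section \<open>Free functors and first extension groups\<close>

locale category_over_ring = cring R for C :: "('o, 'a) cat" and R :: "('r, 'k) ring_scheme" (structure) +
  assumes comp_closed: "x \<in> Obj C \<Longrightarrow> y \<in> Obj C \<Longrightarrow> z \<in> Obj C \<Longrightarrow> a \<in> Hom C x y \<Longrightarrow>
      b \<in> Hom C y z \<Longrightarrow> Comp C b a \<in> Hom C x z"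
    and ident_closed: "x \<in> Obj C \<Longrightarrow> Ident C x \<in> Hom C x x"
    and comp_assoc: "w \<in> Obj C \<Longrightarrow> x \<in> Obj C \<Longrightarrow> y \<in> Obj C \<Longrightarrow> z \<in> Obj C \<Longrightarrow>
      a \<in> Hom C w x \<Longrightarrow> b \<in> Hom C x y \<Longrightarrow> c \<in> Hom C y z \<Longrightarrow>
      Comp C c (Comp C b a) = Comp C (Comp C c b) a"
    and comp_ident: "x \<in> Obj C \<Longrightarrow> y \<in> Obj C \<Longrightarrow> a \<in> Hom C x y \<Longrightarrow> Comp C a (Ident C x) = a"
    and ident_comp: "x \<in> Obj C \<Longrightarrow> y \<in> Obj C \<Longrightarrow> a \<in> Hom C x y \<Longrightarrow> Comp C (Ident C y) a = a"

definition free_basis ::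
  "('o, 'a) cat \<Rightarrow> ('o, 'a, 'r, 'm) fun_data \<Rightarrow> 'o \<Rightarrow> ('o \<times> 'm \<times> 'a) set" where
  "free_basis C M Y = {(X, t, a). X \<in> Obj C \<and> t \<in> carrier (ob M X) \<and> a \<in> Hom C Y X}"

lemma free_functor_ob: "ob (free_functor R C M) Y = free_module R (free_basis C M Y)"
  by (simp add: free_functor_def free_basis_def)

lemma free_counit_eq_lin_ext:
  "free_counit R M Y = lin_ext R (ob M Y) (\<lambda>(X, t, a). ar M Y X a t)"
  by (simp add: fun_eq_iff free_counit_def lin_ext_def)

context category_over_ring begin

text \<open>A coefficient of the image of \<open>c\<close> is a sum over the basis elements \<open>(X, t, a)\<close> with a given
  composite of \<open>a\<close> and \<open>b\<close>, that is, over a fibre of the action of \<open>b\<close> on the basis.\<close>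

lemma free_functor_ar_eq_lin_ext:
  fixes M :: "('o, 'a, 'r, 'm) fun_data"
  assumes Y: "Y' \<in> Obj C" "Y \<in> Obj C" and b: "b \<in> Hom C Y' Y"
    and c: "c \<in> carrier (ob (free_functor R C M) Y)"
  shows "ar (free_functor R C M) Y' Y b c =
    lin_ext R (ob (free_functor R C M) Y') (\<lambda>(X, t, a). basis_elem R (X, t, Comp C a b)) c"
    (is "_ = lin_ext R ?E ?\<phi> c")
proof (rule ext)
  fix s :: "'o \<times> 'm \<times> 'a"
  obtain X t a' where s: "s = (X, t, a')" by (cases s) auto
  let ?push = "\<lambda>(X, t, a). (X, t, Comp C a b)"
  let ?A = "{a \<in> Hom C Y X. Comp C a b = a' \<and> c (X, t, a) \<noteq> \<zero>}"
  note c' = c[unfolded free_functor_ob]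
  have "?\<phi> = (\<lambda>i. basis_elem R (?push i))" by (simp add: fun_eq_iff)
  then have "lin_ext R ?E ?\<phi> c s = (\<Oplus>i\<in>{i. c i \<noteq> \<zero> \<and> ?push i = s}. c i)"
    unfolding free_functor_ob using comp_closed[OF Y _ b]
    by (simp only:, intro lin_ext_pushforward_eval[OF c']) (auto simp: free_basis_def)
  also have "{i. c i \<noteq> \<zero> \<and> ?push i = s} = (\<lambda>a. (X, t, a)) ` ?A"
    using free_module_support[OF c'] by (fastforce simp: s free_basis_def)
  also have "(\<Oplus>i\<in>\<dots>. c i) = (\<Oplus>a\<in>?A. c (X, t, a))"
    using free_module_coeff[OF c'] by (intro add.finprod_reindex) (auto simp: inj_on_def)
  finally show "ar (free_functor R C M) Y' Y b c s = lin_ext R ?E ?\<phi> c s"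
    by (simp add: free_functor_def s)
qed

lemma free_functor_ar_hom:
  assumes "Y' \<in> Obj C" "Y \<in> Obj C" "b \<in> Hom C Y' Y"
  shows "ar (free_functor R C M) Y' Y b \<in>
    module_hom R (ob (free_functor R C M) Y) (ob (free_functor R C M) Y')"
proof -
  interpret E: module R "ob (free_functor R C M) Y'"
    unfolding free_functor_ob by (rule free_module_module[OF is_cring])
  have "lin_ext R (ob (free_functor R C M) Y') (\<lambda>(X, t, a). basis_elem R (X, t, Comp C a b))
    \<in> module_hom R (ob (free_functor R C M) Y) (ob (free_functor R C M) Y')"
    using comp_closed[OF assms(1,2) _ assms(3)]
    by (subst free_functor_ob[of _ _ _ Y], intro E.lin_ext_hom)
      (auto simp: free_functor_ob free_basis_def intro!: basis_elem_closed)
  then show ?thesis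
    by (rule module_hom_cong)
      (simp_all add: free_functor_ar_eq_lin_ext[OF assms] free_functor_ob free_module_module[OF is_cring])
qed

lemma free_functor_ar_basis:
  assumes "Y' \<in> Obj C" "Y \<in> Obj C" "b \<in> Hom C Y' Y" "X \<in> Obj C" "t \<in> carrier (ob M X)" "a \<in> Hom C Y X"
  shows "ar (free_functor R C M) Y' Y b (basis_elem R (X, t, a)) = basis_elem R (X, t, Comp C a b)"
proof -
  interpret E: module R "ob (free_functor R C M) Y'"
    unfolding free_functor_ob by (rule free_module_module[OF is_cring])
  have "basis_elem R (X, t, a) \<in> carrier (ob (free_functor R C M) Y)"
    using assms by (auto simp: free_functor_ob free_basis_def intro: basis_elem_closed)
  moreover have "basis_elem R (X, t, Comp C a b) \<in> carrier (ob (free_functor R C M) Y')"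
    using assms comp_closed[OF assms(1,2) _ assms(3)]
    by (auto simp: free_functor_ob free_basis_def intro: basis_elem_closed)
  ultimately show ?thesis
    by (subst free_functor_ar_eq_lin_ext[OF assms(1-3)]) (simp_all add: E.lin_ext_basis)
qed

lemma free_functor_basis_closed:
  assumes "Y \<in> Obj C" "X \<in> Obj C" "t \<in> carrier (ob M X)" "a \<in> Hom C Y X"
  shows "basis_elem R (X, t, a) \<in> carrier (ob (free_functor R C M) Y)"
  using assms by (auto simp: free_functor_ob free_basis_def intro: basis_elem_closed)

lemma free_functor_hom_eq:
  assumes "module R N" "f \<in> module_hom R (ob (free_functor R C M) Y) N"
    and "g \<in> module_hom R (ob (free_functor R C M) Y) N"
    and "\<And>X t a. X \<in> Obj C \<Longrightarrow> t \<in> carrier (ob M X) \<Longrightarrow> a \<in> Hom C Y X \<Longrightarrow>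
      f (basis_elem R (X, t, a)) = g (basis_elem R (X, t, a))"
    and "c \<in> carrier (ob (free_functor R C M) Y)"
  shows "f c = g c"
proof (rule free_module_hom_eq[OF assms(1) assms(2,3)[unfolded free_functor_ob] _
      assms(5)[unfolded free_functor_ob]])
  fix s assume "s \<in> free_basis C M Y"
  then show "f (basis_elem R s) = g (basis_elem R s)"
    by (cases s) (simp add: free_basis_def assms(4))
qed

lemma free_functor_cat_module: "cat_module R C (free_functor R C M)" (is "cat_module R C ?P")
  unfolding cat_module_def
proof (intro conjI ballI)
  have mod: "module R (ob ?P x)" for x
    unfolding free_functor_ob by (rule free_module_module[OF is_cring])
  fix x assume x: "x \<in> Obj C"
  show "module R (ob ?P x)" by (rule mod)
  {
    fix c assume c: "c \<in> carrier (ob ?P x)"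
    have "(\<lambda>c. c) \<in> module_hom R (ob ?P x) (ob ?P x)" by (simp add: module_homI)
    with c show "ar ?P x x (Ident C x) c = c"
      by (rule free_functor_hom_eq[OF mod free_functor_ar_hom[OF x x ident_closed[OF x]], rotated -1])
        (simp add: free_functor_ar_basis[OF x x ident_closed[OF x]] comp_ident[OF x])
  }
  fix y a assume y: "y \<in> Obj C" and a: "a \<in> Hom C x y"
  show "ar ?P x y a \<in> module_hom R (ob ?P y) (ob ?P x)"
    by (rule free_functor_ar_hom[OF x y a])
  fix z b c assume z: "z \<in> Obj C" and b: "b \<in> Hom C y z" and c: "c \<in> carrier (ob ?P z)"
  show "ar ?P x z (Comp C b a) c = ar ?P x y a (ar ?P y z b c)"
    using c
    by (rule free_functor_hom_eq[OF mod free_functor_ar_hom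
          module_hom_compose[OF free_functor_ar_hom free_functor_ar_hom], rotated -1])
      (use x y z a b comp_closed in \<open>auto simp: free_functor_ar_basis comp_assoc\<close>)
qed

lemma free_counit_hom:
  assumes M: "cat_module R C M" and Y: "Y \<in> Obj C"
  shows "free_counit R M Y \<in> module_hom R (ob (free_functor R C M) Y) (ob M Y)"
proof -
  interpret M: module R "ob M Y" by (rule cat_module_ob[OF M Y])
  show ?thesis
    unfolding free_counit_eq_lin_ext free_functor_ob
    using Y by (intro M.lin_ext_hom) (auto simp: free_basis_def cat_module_ar_closed[OF M])
qed

lemma free_counit_basis:
  assumes M: "cat_module R C M" and "Y \<in> Obj C" "X \<in> Obj C" "t \<in> carrier (ob M X)" "a \<in> Hom C Y X"
  shows "free_counit R M Y (basis_elem R (X, t, a)) = ar M Y X a t"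
proof -
  interpret M: module R "ob M Y" by (rule cat_module_ob[OF M \<open>Y \<in> Obj C\<close>])
  show ?thesis
    unfolding free_counit_eq_lin_ext
    using cat_module_ar_closed[OF M \<open>Y \<in> Obj C\<close> \<open>X \<in> Obj C\<close>] assms by (subst M.lin_ext_basis) auto
qed

lemma free_counit_transformation:
  assumes M: "cat_module R C M"
  shows "transformation R C (free_functor R C M) M (free_counit R M)"
  unfolding transformation_def
proof (intro conjI ballI)
  fix x assume x: "x \<in> Obj C"
  show "free_counit R M x \<in> module_hom R (ob (free_functor R C M) x) (ob M x)"
    by (rule free_counit_hom[OF M x])
  fix y a c assume y: "y \<in> Obj C" and a: "a \<in> Hom C x y" and c: "c \<in> carrier (ob (free_functor R C M) y)"
  show "free_counit R M x (ar (free_functor R C M) x y a c) = ar M x y a (free_counit R M y c)"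
    using c
    by (rule free_functor_hom_eq[OF cat_module_ob[OF M x]
          module_hom_compose[OF free_functor_ar_hom free_counit_hom[OF M]]
          module_hom_compose[OF free_counit_hom[OF M] cat_module_ar[OF M]], rotated -1])
      (use x y a comp_closed in \<open>auto simp: free_functor_ar_basis free_counit_basis[OF M] cat_module_comp[OF M]\<close>)
qed

lemma free_counit_surj:
  assumes M: "cat_module R C M" and Y: "Y \<in> Obj C" and m: "m \<in> carrier (ob M Y)"
  shows "\<exists>c\<in>carrier (ob (free_functor R C M) Y). free_counit R M Y c = m"
  using free_counit_basis[OF M Y Y m ident_closed[OF Y]] cat_module_ident[OF M Y m]
    free_functor_basis_closed[OF Y Y m ident_closed[OF Y]] by auto

lemma free_kernel_carrier:
  "k \<in> carrier (ob (free_kernel R C M) Y) \<longleftrightarrow>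
    k \<in> carrier (ob (free_functor R C M) Y) \<and> free_counit R M Y k = \<zero>\<^bsub>ob M Y\<^esub>"
  by (simp add: free_kernel_def sub_functor_def)

lemma free_kernel_ops:
  "\<zero>\<^bsub>ob (free_kernel R C M) Y\<^esub> = \<zero>\<^bsub>ob (free_functor R C M) Y\<^esub>"
  "add (ob (free_kernel R C M) Y) = add (ob (free_functor R C M) Y)"
  "smult (ob (free_kernel R C M) Y) = smult (ob (free_functor R C M) Y)"
  "ar (free_kernel R C M) = ar (free_functor R C M)"
  by (simp_all add: free_kernel_def sub_functor_def)

lemma free_kernel_cat_module:
  assumes M: "cat_module R C M"
  shows "cat_module R C (free_kernel R C M)"
  unfolding free_kernel_def
proof (rule sub_functor_cat_module[OF free_functor_cat_module])
  fix x assume x: "x \<in> Obj C"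
  show "submodule {c \<in> carrier (ob (free_functor R C M) x). free_counit R M x c = \<zero>\<^bsub>ob M x\<^esub>} R
      (ob (free_functor R C M) x)"
    by (rule submodule_kernel[OF cat_module_ob[OF free_functor_cat_module x] cat_module_ob[OF M x] free_counit_hom[OF M x]])
  fix y a m assume "y \<in> Obj C" "a \<in> Hom C x y"
    "m \<in> {c \<in> carrier (ob (free_functor R C M) y). free_counit R M y c = \<zero>\<^bsub>ob M y\<^esub>}"
  then show "ar (free_functor R C M) x y a m
      \<in> {c \<in> carrier (ob (free_functor R C M) x). free_counit R M x c = \<zero>\<^bsub>ob M x\<^esub>}"
    using x module_hom_zero[OF cat_module_ob[OF M] cat_module_ob[OF M] cat_module_ar[OF M]]
    by (auto simp: cat_module_ar_closed[OF free_functor_cat_module]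
        transformation_natural[OF free_counit_transformation[OF M]])
qed

lemma free_kernel_inclusion:
  "transformation R C (free_kernel R C M) (free_functor R C M) (\<lambda>x k. k)"
  by (auto simp: transformation_def free_kernel_ops free_kernel_carrier intro!: module_homI)

subsection \<open>Precomposition\<close>

lemma precomp_eq:
  "x \<in> Obj C \<Longrightarrow> p \<in> carrier (ob P x) \<Longrightarrow> precomp C P d \<eta> x p = \<eta> x (d x p)"
  by (simp add: precomp_def)

lemma precomp_hom:
  assumes P: "cat_module R C P" and Q: "cat_module R C Q" and N: "cat_module R C N"
    and d: "transformation R C P Q d"
  shows "precomp C P d \<in> module_hom R (nat_module R C Q N) (nat_module R C P N)"
proof -
  interpret QN: module R "nat_module R C Q N" by (rule nat_module_module[OF is_cring Q N])
  interpret PN: module R "nat_module R C P N" by (rule nat_module_module[OF is_cring P N])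
  have closed: "precomp C P d \<eta> \<in> carrier (nat_module R C P N)"
    if "\<eta> \<in> carrier (nat_module R C Q N)" for \<eta>
    unfolding precomp_def
    by (rule restrict_transformation[OF transformation_compose[OF d nat_module_transformation[OF that]] P])
  show ?thesis
  proof (rule module_homI)
    fix \<eta> \<theta> r
    assume \<eta>: "\<eta> \<in> carrier (nat_module R C Q N)"
    show "precomp C P d \<eta> \<in> carrier (nat_module R C P N)" by (rule closed[OF \<eta>])
    show "precomp C P d (\<eta> \<oplus>\<^bsub>nat_module R C Q N\<^esub> \<theta>) =
        precomp C P d \<eta> \<oplus>\<^bsub>nat_module R C P N\<^esub> precomp C P d \<theta>"
      if "\<theta> \<in> carrier (nat_module R C Q N)"
      using that \<eta> transformation_closed[OF d]
      by (intro nat_module_eqI closed QN.a_closed PN.a_closed)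
        (auto simp: precomp_eq nat_module_add closed)
    show "precomp C P d (r \<odot>\<^bsub>nat_module R C Q N\<^esub> \<eta>) =
        r \<odot>\<^bsub>nat_module R C P N\<^esub> precomp C P d \<eta>" if "r \<in> carrier R"
      using that \<eta> transformation_closed[OF d]
      by (intro nat_module_eqI closed QN.smult_closed PN.smult_closed)
        (auto simp: precomp_eq nat_module_smult closed)
  qed
qed

lemma precomp_inj:
  assumes "\<And>x q. x \<in> Obj C \<Longrightarrow> q \<in> carrier (ob Q x) \<Longrightarrow> \<exists>p\<in>carrier (ob P x). d x p = q"
    and "precomp C P d \<eta> = precomp C P d \<theta>" "x \<in> Obj C" "q \<in> carrier (ob Q x)"
  shows "\<eta> x q = \<theta> x q"
proof -
  obtain p where "p \<in> carrier (ob P x)" "d x p = q" using assms(1,3,4) by blast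
  moreover have "precomp C P d \<eta> x p = precomp C P d \<theta> x p" by (simp add: assms(2))
  ultimately show ?thesis using assms(3) by (simp add: precomp_eq)
qed

text \<open>An epimorphism of functors is a cokernel of its kernel: apply \<open>\<eta>\<close> to arbitrary preimages.\<close>

lemma transformation_factor:
  assumes P: "cat_module R C P" and Q: "cat_module R C Q" and N: "cat_module R C N"
    and d: "transformation R C P Q d"
    and surj: "\<And>x q. x \<in> Obj C \<Longrightarrow> q \<in> carrier (ob Q x) \<Longrightarrow> \<exists>p\<in>carrier (ob P x). d x p = q"
    and \<eta>: "\<eta> \<in> carrier (nat_module R C P N)"
    and ker: "\<And>x p. x \<in> Obj C \<Longrightarrow> p \<in> carrier (ob P x) \<Longrightarrow> d x p = \<zero>\<^bsub>ob Q x\<^esub> \<Longrightarrow>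
      \<eta> x p = \<zero>\<^bsub>ob N x\<^esub>"
  shows "\<exists>\<theta>\<in>carrier (nat_module R C Q N). precomp C P d \<theta> = \<eta>"
proof -
  define lift where "lift x q = (SOME p. p \<in> carrier (ob P x) \<and> d x p = q)" for x q
  have lift: "lift x q \<in> carrier (ob P x)" "d x (lift x q) = q"
    if "x \<in> Obj C" "q \<in> carrier (ob Q x)" for x q
    using someI_ex[of "\<lambda>p. p \<in> carrier (ob P x) \<and> d x p = q"] surj[OF that] unfolding lift_def by auto
  note \<eta>t = nat_module_transformation[OF \<eta>]
  have eq: "\<eta> x p = \<eta> x p'"
    if "x \<in> Obj C" "p \<in> carrier (ob P x)" "p' \<in> carrier (ob P x)" "d x p = d x p'" for x p p'
  proof -
    interpret Px: module R "ob P x" by (rule cat_module_ob[OF P \<open>x \<in> Obj C\<close>])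
    interpret Qx: module R "ob Q x" by (rule cat_module_ob[OF Q \<open>x \<in> Obj C\<close>])
    interpret Nx: module R "ob N x" by (rule cat_module_ob[OF N \<open>x \<in> Obj C\<close>])
    have "d x (p \<ominus>\<^bsub>ob P x\<^esub> p') = \<zero>\<^bsub>ob Q x\<^esub>"
      using that transformation_closed[OF d]
      by (simp add: module_hom_minus[OF Px.module_axioms Qx.module_axioms transformation_hom[OF d]]
          Qx.minus_eq_zero_iff)
    then have "\<eta> x (p \<ominus>\<^bsub>ob P x\<^esub> p') = \<zero>\<^bsub>ob N x\<^esub>" using that by (intro ker) auto
    then show ?thesis
      using that transformation_closed[OF \<eta>t]
      by (simp add: module_hom_minus[OF Px.module_axioms Nx.module_axioms transformation_hom[OF \<eta>t]]
          Nx.minus_eq_zero_iff)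
  qed
  have t: "transformation R C Q N (\<lambda>x q. \<eta> x (lift x q))"
    unfolding transformation_def
  proof (intro conjI ballI)
    fix x assume x: "x \<in> Obj C"
    interpret Px: module R "ob P x" by (rule cat_module_ob[OF P x])
    interpret Qx: module R "ob Q x" by (rule cat_module_ob[OF Q x])
    note dh = module_homD[OF transformation_hom[OF d x]]
    note \<eta>h = module_homD[OF transformation_hom[OF \<eta>t x]]
    show "(\<lambda>q. \<eta> x (lift x q)) \<in> module_hom R (ob Q x) (ob N x)"
    proof (rule module_homI)
      fix q q' r assume q: "q \<in> carrier (ob Q x)"
      show "\<eta> x (lift x q) \<in> carrier (ob N x)" by (rule \<eta>h(1)[OF lift(1)[OF x q]])
      show "\<eta> x (lift x (q \<oplus>\<^bsub>ob Q x\<^esub> q')) = \<eta> x (lift x q) \<oplus>\<^bsub>ob N x\<^esub> \<eta> x (lift x q')"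
        if q': "q' \<in> carrier (ob Q x)"
        unfolding \<eta>h(2)[OF lift(1)[OF x q] lift(1)[OF x q'], symmetric]
        using x q q' by (intro eq) (auto simp: lift dh)
      show "\<eta> x (lift x (r \<odot>\<^bsub>ob Q x\<^esub> q)) = r \<odot>\<^bsub>ob N x\<^esub> \<eta> x (lift x q)" if r: "r \<in> carrier R"
        unfolding \<eta>h(3)[OF r lift(1)[OF x q], symmetric]
        using x q r by (intro eq) (auto simp: lift dh)
    qed
    fix y a q assume y: "y \<in> Obj C" and a: "a \<in> Hom C x y" and q: "q \<in> carrier (ob Q y)"
    show "\<eta> x (lift x (ar Q x y a q)) = ar N x y a (\<eta> y (lift y q))"
      unfolding transformation_natural[OF \<eta>t x y a lift(1)[OF y q], symmetric]
      using x y a q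
      by (intro eq) (auto simp: lift cat_module_ar_closed[OF Q] cat_module_ar_closed[OF P]
          transformation_natural[OF d])
  qed
  let ?\<theta> = "\<lambda>x\<in>Obj C. \<lambda>q\<in>carrier (ob Q x). \<eta> x (lift x q)"
  have \<theta>: "?\<theta> \<in> carrier (nat_module R C Q N)" by (rule restrict_transformation[OF t Q])
  moreover have "precomp C P d ?\<theta> = \<eta>"
    using module_hom_closed[OF precomp_hom[OF P Q N d] \<theta>] \<eta>
    by (rule nat_module_eqI) (auto simp: precomp_eq transformation_closed[OF d] lift intro!: eq)
  ultimately show ?thesis by blast
qed

subsection \<open>The first extension group\<close>

text \<open>A homomorphism from the first syzygy \<open>K\<close> of \<open>M\<close> is composed with the free cover of \<open>K\<close>; this gives
  a cocycle of the standard resolution, whose class modulo the coboundaries is taken here.\<close>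

definition ext_class ::
  "('o, 'a, 'r, 'm) fun_data \<Rightarrow> ('o, 'a, 'r, 'n) fun_data \<Rightarrow> ('o \<Rightarrow> ('o \<times> 'm \<times> 'a \<Rightarrow> 'r) \<Rightarrow> 'n)
    \<Rightarrow> ('o \<Rightarrow> ('o \<times> ('o \<times> 'm \<times> 'a \<Rightarrow> 'r) \<times> 'a \<Rightarrow> 'r) \<Rightarrow> 'n) set" where
  "ext_class M N \<theta> =
    precomp C (free_functor R C (free_kernel R C M)) (free_counit R (free_kernel R C M)) `
        carrier (nat_module R C (free_functor R C M) N)
      +>\<^bsub>nat_module R C (free_functor R C (free_kernel R C M)) N\<^esub>
    precomp C (free_functor R C (free_kernel R C M)) (free_counit R (free_kernel R C M)) \<theta>"

text \<open>\<open>Ext\<^sup>1(M, N)\<close> is the cokernel of the restriction from \<open>Hom(P, N)\<close> to \<open>Hom(K, N)\<close>, where \<open>K\<close> is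
  the kernel of the free cover \<open>P \<rightarrow> M\<close>: a cocycle on the next free functor is one that vanishes
  on the kernel of the cover of \<open>K\<close>, hence one that factors through \<open>K\<close>.\<close>

lemma ext_class_presentation:
  assumes M: "cat_module R C M" and N: "cat_module R C N"
  shows ext_module: "module R (Ext1 R C M N)"
    and ext_class_hom: "ext_class M N \<in> module_hom R (nat_module R C (free_kernel R C M) N) (Ext1 R C M N)"
    and ext_class_surj: "ext_class M N ` carrier (nat_module R C (free_kernel R C M) N) = carrier (Ext1 R C M N)"
    and ext_class_zero_iff: "\<theta> \<in> carrier (nat_module R C (free_kernel R C M) N) \<Longrightarrow>
      ext_class M N \<theta> = \<zero>\<^bsub>Ext1 R C M N\<^esub> \<longleftrightarrow>
      (\<exists>\<xi>\<in>carrier (nat_module R C (free_functor R C M) N).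
        \<forall>x\<in>Obj C. \<forall>k\<in>carrier (ob (free_kernel R C M) x). \<theta> x k = \<xi> x k)"
proof -
  define P0 where "P0 = free_functor R C M"
  define K1 where "K1 = free_kernel R C M"
  define P1 where "P1 = free_functor R C K1"
  define K2 where "K2 = free_kernel R C K1"
  define P2 where "P2 = free_functor R C K2"
  define A where "A = nat_module R C P1 N"
  define Z where "Z = {\<eta> \<in> carrier A. precomp C P2 (free_counit R K2) \<eta> = \<zero>\<^bsub>nat_module R C P2 N\<^esub>}"
  let ?c1 = "precomp C P1 (free_counit R K1)"
  let ?c2 = "precomp C P2 (free_counit R K2)"
  define B where "B = ?c1 ` carrier (nat_module R C P0 N)"
  have K1: "cat_module R C K1" unfolding K1_def by (rule free_kernel_cat_module[OF M])
  have K2: "cat_module R C K2" unfolding K2_def by (rule free_kernel_cat_module[OF K1])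
  have P: "cat_module R C P0" "cat_module R C P1" "cat_module R C P2"
    unfolding P0_def P1_def P2_def by (rule free_functor_cat_module)+
  have t1: "transformation R C P1 K1 (free_counit R K1)"
    unfolding P1_def by (rule free_counit_transformation[OF K1])
  have t2: "transformation R C P2 K2 (free_counit R K2)"
    unfolding P2_def by (rule free_counit_transformation[OF K2])
  have t1': "transformation R C P1 P0 (free_counit R K1)"
    using transformation_compose[OF t1 free_kernel_inclusion[of M, folded K1_def P0_def]] .
  have t2': "transformation R C P2 P1 (free_counit R K2)"
    using transformation_compose[OF t2 free_kernel_inclusion[of K1, folded K2_def P1_def]] .
  have surj1: "\<exists>p\<in>carrier (ob P1 x). free_counit R K1 x p = k" if "x \<in> Obj C" "k \<in> carrier (ob K1 x)" for x k
    unfolding P1_def by (rule free_counit_surj[OF K1 that])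
  have surj2: "\<exists>p\<in>carrier (ob P2 x). free_counit R K2 x p = k" if "x \<in> Obj C" "k \<in> carrier (ob K2 x)" for x k
    unfolding P2_def by (rule free_counit_surj[OF K2 that])
  have hom1: "?c1 \<in> module_hom R (nat_module R C K1 N) A"
    unfolding A_def by (rule precomp_hom[OF P(2) K1 N t1])
  have hom1': "?c1 \<in> module_hom R (nat_module R C P0 N) A"
    unfolding A_def by (rule precomp_hom[OF P(2,1) N t1'])
  have hom2: "?c2 \<in> module_hom R A (nat_module R C P2 N)"
    unfolding A_def by (rule precomp_hom[OF P(3,2) N t2'])
  note mods = nat_module_module[OF is_cring P(1) N] nat_module_module[OF is_cring P(2) N, folded A_def]
    nat_module_module[OF is_cring P(3) N] nat_module_module[OF is_cring K1 N]
  interpret A: module R A by (rule mods(2))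
  have Z_iff: "\<eta> \<in> Z \<longleftrightarrow> (\<forall>x\<in>Obj C. \<forall>p\<in>carrier (ob P1 x). free_counit R K1 x p = \<zero>\<^bsub>ob K1 x\<^esub> \<longrightarrow> \<eta> x p = \<zero>\<^bsub>ob N x\<^esub>)"
    if \<eta>: "\<eta> \<in> carrier A" for \<eta>
  proof -
    have "\<eta> \<in> Z \<longleftrightarrow> (\<forall>x\<in>Obj C. \<forall>p\<in>carrier (ob P2 x). \<eta> x (free_counit R K2 x p) = \<zero>\<^bsub>ob N x\<^esub>)"
    proof
      assume "\<eta> \<in> Z"
      then have "?c2 \<eta> = \<zero>\<^bsub>nat_module R C P2 N\<^esub>" by (simp add: Z_def)
      then show "\<forall>x\<in>Obj C. \<forall>p\<in>carrier (ob P2 x). \<eta> x (free_counit R K2 x p) = \<zero>\<^bsub>ob N x\<^esub>"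
        by (metis precomp_eq nat_module_zero)
    next
      assume "\<forall>x\<in>Obj C. \<forall>p\<in>carrier (ob P2 x). \<eta> x (free_counit R K2 x p) = \<zero>\<^bsub>ob N x\<^esub>"
      then have "?c2 \<eta> = \<zero>\<^bsub>nat_module R C P2 N\<^esub>"
        by (intro nat_module_eqI[OF module_hom_closed[OF hom2 \<eta>]
              abelian_monoid.zero_closed[OF abelian_group.axioms(1)[OF module.axioms(2)[OF mods(3)]]]])
          (simp add: precomp_eq nat_module_zero)
      then show "\<eta> \<in> Z" using \<eta> by (simp add: Z_def)
    qed
    also have "\<dots> \<longleftrightarrow> (\<forall>x\<in>Obj C. \<forall>k\<in>carrier (ob K2 x). \<eta> x k = \<zero>\<^bsub>ob N x\<^esub>)"
      using surj2 transformation_closed[OF t2] by metis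
    finally show ?thesis by (simp add: K2_def P1_def Ball_def free_kernel_carrier imp_conjL)
  qed
  have sZ: "submodule Z R A" unfolding Z_def by (rule submodule_kernel[OF mods(2,3) hom2])
  have c1_Z: "?c1 \<theta> \<in> Z" if "\<theta> \<in> carrier (nat_module R C K1 N)" for \<theta>
    unfolding Z_iff[OF module_hom_closed[OF hom1 that]]
    using module_hom_zero[OF cat_module_ob[OF K1] cat_module_ob[OF N]
        transformation_hom[OF nat_module_transformation[OF that]]]
    by (simp add: precomp_eq)
  have sBA: "submodule B R A" unfolding B_def by (rule submodule_image[OF mods(1,2) hom1'])
  have BZ: "B \<subseteq> Z"
  proof
    fix \<beta> assume "\<beta> \<in> B"
    then obtain \<xi> where \<xi>: "\<xi> \<in> carrier (nat_module R C P0 N)" "\<beta> = ?c1 \<xi>" by (auto simp: B_def)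
    show "\<beta> \<in> Z"
      unfolding \<xi>(2) Z_iff[OF module_hom_closed[OF hom1' \<xi>(1)]]
      using module_hom_zero[OF cat_module_ob[OF P(1)] cat_module_ob[OF N]
          transformation_hom[OF nat_module_transformation[OF \<xi>(1)]]]
      by (simp add: precomp_eq K1_def free_kernel_ops P0_def)
  qed
  let ?AZ = "A\<lparr>carrier := Z\<rparr>"
  have AZ: "module R ?AZ" by (rule submodule_carrier_module[OF mods(2) sZ])
  have sB: "submodule B R ?AZ"
    using submodule_carrier_module[OF mods(2) sBA] BZ
    by (intro module.module_incl_imp_submodule[OF AZ]) auto
  have ext: "Ext1 R C M N = quot_module ?AZ B"
    by (simp add: Ext1_def Let_def A_def Z_def B_def P0_def P1_def P2_def K1_def K2_def)
  have coset: "B +>\<^bsub>?AZ\<^esub> \<eta> = B +>\<^bsub>A\<^esub> \<eta>" for \<eta>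
    by (simp add: a_r_coset_def r_coset_def)
  have cls: "ext_class M N \<theta> = B +>\<^bsub>?AZ\<^esub> ?c1 \<theta>" for \<theta>
    unfolding coset by (simp add: ext_class_def B_def A_def P0_def P1_def K1_def)
  show "module R (Ext1 R C M N)" unfolding ext by (rule quot_module_module[OF AZ sB])
  have homZ: "?c1 \<in> module_hom R (nat_module R C K1 N) ?AZ"
    using c1_Z by (intro module_homI) (simp_all add: module_homD[OF hom1])
  show "ext_class M N \<in> module_hom R (nat_module R C (free_kernel R C M) N) (Ext1 R C M N)"
    using module_hom_compose[OF homZ quot_module_proj_hom[OF AZ sB]]
    unfolding ext K1_def[symmetric] cls[abs_def] .
  have "?c1 ` carrier (nat_module R C K1 N) = Z"
  proof
    show "Z \<subseteq> ?c1 ` carrier (nat_module R C K1 N)"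
    proof
      fix \<eta> assume \<eta>: "\<eta> \<in> Z"
      then have \<eta>A: "\<eta> \<in> carrier A" by (simp add: Z_def)
      show "\<eta> \<in> ?c1 ` carrier (nat_module R C K1 N)"
        using transformation_factor[OF P(2) K1 N t1 surj1 \<eta>A[unfolded A_def]] \<eta>[unfolded Z_iff[OF \<eta>A]]
        by blast
    qed
  qed (use c1_Z in auto)
  then show "ext_class M N ` carrier (nat_module R C (free_kernel R C M) N) = carrier (Ext1 R C M N)"
    unfolding ext quot_module_carrier[OF AZ sB] K1_def[symmetric]
    by (auto simp: cls)
  assume "\<theta> \<in> carrier (nat_module R C (free_kernel R C M) N)"
  then have \<theta>: "\<theta> \<in> carrier (nat_module R C K1 N)" by (simp add: K1_def)
  have zeroZ: "\<zero>\<^bsub>A\<^esub> \<in> Z" by (rule submodule_zero[OF mods(2) sZ])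
  interpret AZ: module R ?AZ by (rule AZ)
  have "ext_class M N \<theta> = \<zero>\<^bsub>Ext1 R C M N\<^esub> \<longleftrightarrow> ?c1 \<theta> \<ominus>\<^bsub>?AZ\<^esub> \<zero>\<^bsub>?AZ\<^esub> \<in> B"
    unfolding ext cls quot_module_zero[OF AZ sB]
    using c1_Z[OF \<theta>] zeroZ by (intro coset_eq_iff[OF AZ sB]) simp_all
  also have "?c1 \<theta> \<ominus>\<^bsub>?AZ\<^esub> \<zero>\<^bsub>?AZ\<^esub> = ?c1 \<theta>"
    using c1_Z[OF \<theta>] by (intro AZ.minus_zero_right) simp
  also have "?c1 \<theta> \<in> B \<longleftrightarrow> (\<exists>\<xi>\<in>carrier (nat_module R C P0 N). \<forall>x\<in>Obj C. \<forall>k\<in>carrier (ob K1 x). \<theta> x k = \<xi> x k)"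
  proof
    assume "?c1 \<theta> \<in> B"
    then obtain \<xi> where "\<xi> \<in> carrier (nat_module R C P0 N)" "?c1 \<theta> = ?c1 \<xi>" by (auto simp: B_def)
    with precomp_inj[where \<eta> = \<theta> and \<theta> = \<xi> and d = "free_counit R K1" and P = P1 and Q = K1, OF surj1]
    show "\<exists>\<xi>\<in>carrier (nat_module R C P0 N). \<forall>x\<in>Obj C. \<forall>k\<in>carrier (ob K1 x). \<theta> x k = \<xi> x k"
      by blast
  next
    assume "\<exists>\<xi>\<in>carrier (nat_module R C P0 N). \<forall>x\<in>Obj C. \<forall>k\<in>carrier (ob K1 x). \<theta> x k = \<xi> x k"
    then obtain \<xi> where \<xi>: "\<xi> \<in> carrier (nat_module R C P0 N)"
      and eq: "\<And>x k. x \<in> Obj C \<Longrightarrow> k \<in> carrier (ob K1 x) \<Longrightarrow> \<theta> x k = \<xi> x k" by blast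
    have "?c1 \<theta> = ?c1 \<xi>"
      using module_hom_closed[OF hom1 \<theta>] module_hom_closed[OF hom1' \<xi>] unfolding A_def
      by (rule nat_module_eqI) (simp add: precomp_eq eq transformation_closed[OF t1])
    then show "?c1 \<theta> \<in> B" using \<xi> by (auto simp: B_def)
  qed
  finally show "ext_class M N \<theta> = \<zero>\<^bsub>Ext1 R C M N\<^esub> \<longleftrightarrow>
      (\<exists>\<xi>\<in>carrier (nat_module R C (free_functor R C M) N).
        \<forall>x\<in>Obj C. \<forall>k\<in>carrier (ob (free_kernel R C M) x). \<theta> x k = \<xi> x k)"
    unfolding P0_def K1_def .
qed

end

section \<open>The quotient of a constant functor by a sieve\<close>

text \<open>The extensions of \<open>T\<close> depend on two features of the orbit category of sections: \<open>(G, 1)\<close> is a terminal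
  object \<open>e\<close>, and the sections \<open>(U, V)\<close> with \<open>V \<noteq> 1\<close> form a sieve \<open>D\<close> that does not contain it.\<close>

locale terminal_sieve = category_over_ring C R for C :: "('o, 'a) cat" and R :: "('r, 'k) ring_scheme" (structure) +
  fixes e :: 'o and D :: "'o set"
  assumes terminal: "e \<in> Obj C" "x \<in> Obj C \<Longrightarrow> \<exists>a. Hom C x e = {a}"
    and proper: "e \<notin> D"
    and sieve: "x \<in> Obj C \<Longrightarrow> y \<in> Obj C \<Longrightarrow> a \<in> Hom C x y \<Longrightarrow> y \<in> D \<Longrightarrow> x \<in> D"
begin

definition to_terminal :: "'o \<Rightarrow> 'a" where "to_terminal x = the_elem (Hom C x e)"

lemma Hom_terminal: "x \<in> Obj C \<Longrightarrow> Hom C x e = {to_terminal x}"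
  using terminal(2)[of x] unfolding to_terminal_def by (metis the_elem_eq)

lemma to_terminal_hom: "x \<in> Obj C \<Longrightarrow> to_terminal x \<in> Hom C x e"
  and to_terminal_unique: "x \<in> Obj C \<Longrightarrow> a \<in> Hom C x e \<Longrightarrow> a = to_terminal x"
  by (simp_all add: Hom_terminal)

lemma comp_to_terminal: "x \<in> Obj C \<Longrightarrow> y \<in> Obj C \<Longrightarrow> a \<in> Hom C x y \<Longrightarrow> Comp C (to_terminal y) a = to_terminal x"
  by (intro to_terminal_unique comp_closed[of x y e] to_terminal_hom terminal(1))

lemma to_terminal_ident: "to_terminal e = Ident C e"
  using to_terminal_unique[OF terminal(1) ident_closed[OF terminal(1)]] by simp

lemma to_terminal_natural:
  assumes "cat_module R C F" "x \<in> Obj C" "y \<in> Obj C" "a \<in> Hom C x y" "m \<in> carrier (ob F e)"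
  shows "ar F x y a (ar F y e (to_terminal y) m) = ar F x e (to_terminal x) m"
  using cat_module_comp[OF assms(1-3) terminal(1) assms(4) to_terminal_hom assms(5)] assms comp_to_terminal by simp

abbreviation J :: "'o \<Rightarrow> 'r set" where "J x \<equiv> (if x \<in> D then carrier R else {\<zero>})"

definition T :: "('o, 'a, 'r, 'r set) fun_data" where "T = quot_functor (const_functor R) J"

definition T_class :: "'o \<Rightarrow> 'r \<Rightarrow> 'r set" where "T_class x r = J x +>\<^bsub>regular_module R\<^esub> r"

lemma regular_module_simps:
  "carrier (regular_module R) = carrier R" "add (regular_module R) = add R"
  "smult (regular_module R) = mult R" "\<zero>\<^bsub>regular_module R\<^esub> = \<zero>" 
  by (simp_all add: regular_module_def)

lemma submodule_J: "submodule (J x) R (regular_module R)"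
proof -
  interpret N: module R "regular_module R" by (rule regular_module_module[OF is_cring])
  show ?thesis
    by (rule N.submoduleI_linear) (auto simp: regular_module_simps split: if_splits)
qed

lemma ob_T: "ob T x = quot_module (regular_module R) (J x)"
  by (simp add: T_def quot_functor_ob const_functor_def)

lemma T_carrier: "carrier (ob T x) = T_class x ` carrier R"
  unfolding ob_T T_class_def
  by (simp only: quot_module_carrier[OF regular_module_module[OF is_cring] submodule_J] regular_module_simps)

lemma T_class_zero_iff:
  assumes "r \<in> carrier R"
  shows "T_class x r = \<zero>\<^bsub>ob T x\<^esub> \<longleftrightarrow> r \<in> J x"
proof -
  interpret N: module R "regular_module R" by (rule regular_module_module[OF is_cring])
  have "r \<ominus>\<^bsub>regular_module R\<^esub> \<zero>\<^bsub>regular_module R\<^esub> = r"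
    using assms by (intro N.minus_zero_right) (simp add: regular_module_simps)
  then show ?thesis
    unfolding ob_T T_class_def quot_module_zero[OF N.module_axioms submodule_J]
    using coset_eq_iff[OF N.module_axioms submodule_J, of r "\<zero>\<^bsub>regular_module R\<^esub>" x] assms
    by (simp add: regular_module_simps)
qed

lemma T_cat_module: "cat_module R C T"
  unfolding T_def
  by (rule quot_functor_cat_module[OF const_functor_cat_module[OF is_cring] _ _ comp_closed ident_closed])
    (use submodule_J sieve in \<open>auto simp: const_functor_def split: if_splits\<close>)

lemma T_class_transformation: "transformation R C (const_functor R) T T_class"
  unfolding transformation_def
proof (intro conjI ballI)
  show "T_class x \<in> module_hom R (ob (const_functor R) x) (ob T x)" for x
    using quot_module_proj_hom[OF regular_module_module[OF is_cring] submodule_J, of x]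
    by (simp add: ob_T const_functor_def T_class_def[abs_def])
  fix x y a m
  assume x: "x \<in> Obj C" and y: "y \<in> Obj C" and a: "a \<in> Hom C x y"
    and m: "m \<in> carrier (ob (const_functor R :: ('o,'a,'r,'r) fun_data) y)"
  have "ar T x y a (J y +>\<^bsub>ob (const_functor R :: ('o,'a,'r,'r) fun_data) y\<^esub> m) =
      J x +>\<^bsub>ob (const_functor R :: ('o,'a,'r,'r) fun_data) x\<^esub> ar (const_functor R) x y a m"
    unfolding T_def
  proof (rule quot_functor_ar[OF const_functor_cat_module[OF is_cring] _ _ x y a m])
    fix x y a m assume "x \<in> Obj C" "y \<in> Obj C" "a \<in> Hom C x y" "m \<in> J y"
    then show "ar (const_functor R) x y a m \<in> J x"
      using sieve[of x y a] by (simp add: const_functor_def split: if_splits)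
  qed (simp add: const_functor_def submodule_J)
  then show "T_class x (ar (const_functor R) x y a m) = ar T x y a (T_class y m)"
    by (simp add: T_class_def const_functor_def)
qed

lemma T_class_natural:
  assumes "x \<in> Obj C" "y \<in> Obj C" "a \<in> Hom C x y" "r \<in> carrier R"
  shows "ar T x y a (T_class y r) = T_class x r"
  using transformation_natural[OF T_class_transformation assms(1-3), of r] assms(4)
  by (simp add: const_functor_def regular_module_simps)

lemma T_class_hom: "x \<in> Obj C \<Longrightarrow> T_class x \<in> module_hom R (regular_module R) (ob T x)"
  using transformation_hom[OF T_class_transformation, of x] by (simp add: const_functor_def)

lemma T_class_closed: "r \<in> carrier R \<Longrightarrow> T_class x r \<in> carrier (ob T x)"
  by (auto simp: T_carrier)

text \<open>The class of \<open>1\<close> at the terminal object generates \<open>T\<close>.\<close>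

lemma T_hom_determined:
  assumes \<eta>: "transformation R C T F \<eta>" and x: "x \<in> Obj C" and r: "r \<in> carrier R"
  shows "\<eta> x (T_class x r) = r \<odot>\<^bsub>ob F x\<^esub> ar F x e (to_terminal x) (\<eta> e (T_class e \<one>))"
proof -
  have "T_class x r = r \<odot>\<^bsub>ob T x\<^esub> T_class x \<one>"
    using module_hom_smult[OF T_class_hom[OF x] r, of \<one>] r by (simp add: regular_module_simps)
  also have "T_class x \<one> = ar T x e (to_terminal x) (T_class e \<one>)"
    by (rule T_class_natural[symmetric]) (use x to_terminal_hom terminal in auto)
  finally show ?thesis
    using x r T_class_closed[OF one_closed, of e]
    by (simp add: module_hom_smult[OF transformation_hom[OF \<eta> x]] terminal to_terminal_hom
        cat_module_ar_closed[OF T_cat_module] transformation_natural[OF \<eta>])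
qed

subsection \<open>Homomorphisms from the quotient\<close>

definition cone_kernel :: "('o, 'a, 'r, 'm) fun_data \<Rightarrow> 'm set" where
  "cone_kernel F = {m \<in> carrier (ob F e). \<forall>x\<in>Obj C \<inter> D. ar F x e (to_terminal x) m = \<zero>\<^bsub>ob F x\<^esub>}"

lemma submodule_cone_kernel:
  assumes F: "cat_module R C F"
  shows "submodule (cone_kernel F) R (ob F e)"
proof -
  interpret Fe: module R "ob F e" by (rule cat_module_ob[OF F terminal(1)])
  have hom: "ar F x e (to_terminal x) \<in> module_hom R (ob F e) (ob F x)" if "x \<in> Obj C" for x
    by (rule cat_module_ar[OF F that terminal(1) to_terminal_hom[OF that]])
  note mod = cat_module_ob[OF F]
  show ?thesis
    by (rule Fe.submoduleI_linear)
      (auto simp: cone_kernel_def module_homD[OF hom] module_hom_zero[OF Fe.module_axioms mod hom]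
        abelian_monoid.l_zero[OF abelian_group.axioms(1)[OF module.axioms(2)[OF mod]]]
        abelian_monoid.zero_closed[OF abelian_group.axioms(1)[OF module.axioms(2)[OF mod]]]
        module.smult_r_null[OF mod])
qed

text \<open>A homomorphism from \<open>T\<close> is determined by the image \<open>m\<close> of the generator. Conversely, \<open>m\<close> gives a
  homomorphism from the constant functor, and this factors through \<open>T\<close> if \<open>m\<close> dies on the sieve.\<close>

lemma hom_T_isomorphic:
  assumes F: "cat_module R C F"
  shows "module_isomorphic R ((ob F e)\<lparr>carrier := cone_kernel F\<rparr>) (nat_module R C T F)"
proof (rule module_isomorphic_sym)
  let ?K = "(ob F e)\<lparr>carrier := cone_kernel F\<rparr>"
  let ?N = "nat_module R C T F"
  let ?f = "\<lambda>\<eta>. \<eta> e (T_class e \<one>)"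
  interpret Fe: module R "ob F e" by (rule cat_module_ob[OF F terminal(1)])
  show N: "module R ?N" by (rule nat_module_module[OF is_cring T_cat_module F])
  show "module R ?K" by (rule submodule_carrier_module[OF Fe.module_axioms submodule_cone_kernel[OF F]])
  have gen: "T_class e \<one> \<in> carrier (ob T e)" by (simp add: T_class_closed)
  have closed: "?f \<eta> \<in> cone_kernel F" if \<eta>: "\<eta> \<in> carrier ?N" for \<eta>
    unfolding cone_kernel_def
  proof (intro CollectI conjI ballI)
    note t = nat_module_transformation[OF \<eta>]
    show "?f \<eta> \<in> carrier (ob F e)" by (rule transformation_closed[OF t terminal(1) gen])
    fix x assume "x \<in> Obj C \<inter> D"
    then have x: "x \<in> Obj C" "x \<in> D" by auto
    have "ar F x e (to_terminal x) (?f \<eta>) = \<eta> x (T_class x \<one>)"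
      using x transformation_natural[OF t x(1) terminal(1) to_terminal_hom[OF x(1)] gen]
        T_class_natural[OF x(1) terminal(1) to_terminal_hom[OF x(1)]] by simp
    also have "T_class x \<one> = \<zero>\<^bsub>ob T x\<^esub>" using x by (simp add: T_class_zero_iff)
    finally show "ar F x e (to_terminal x) (?f \<eta>) = \<zero>\<^bsub>ob F x\<^esub>"
      using module_hom_zero[OF cat_module_ob[OF T_cat_module x(1)] cat_module_ob[OF F x(1)] transformation_hom[OF t x(1)]]
      by simp
  qed
  have "?f \<in> module_hom R ?N ?K"
    using gen terminal(1) by (intro module_homI) (simp_all add: closed nat_module_add nat_module_smult)
  moreover have "bij_betw ?f (carrier ?N) (carrier ?K)"
    unfolding bij_betw_def
  proof (intro conjI inj_onI equalityI subsetI)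
    fix \<eta> \<theta> assume \<eta>: "\<eta> \<in> carrier ?N" and \<theta>: "\<theta> \<in> carrier ?N" and eq: "?f \<eta> = ?f \<theta>"
    show "\<eta> = \<theta>"
    proof (rule nat_module_eqI[OF \<eta> \<theta>])
      fix x m assume x: "x \<in> Obj C" and "m \<in> carrier (ob T x)"
      then obtain r where "r \<in> carrier R" "m = T_class x r" by (auto simp: T_carrier)
      then show "\<eta> x m = \<theta> x m"
        using x eq T_hom_determined[OF nat_module_transformation[OF \<eta>] x]
          T_hom_determined[OF nat_module_transformation[OF \<theta>] x] by simp
    qed
  next
    fix m assume "m \<in> carrier ?K"
    then have m: "m \<in> carrier (ob F e)" and kill: "\<And>x. x \<in> Obj C \<Longrightarrow> x \<in> D \<Longrightarrow> ar F x e (to_terminal x) m = \<zero>\<^bsub>ob F x\<^esub>"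
      by (auto simp: cone_kernel_def)
    let ?const = "const_functor R :: ('o, 'a, 'r, 'r) fun_data"
    have mx: "ar F x e (to_terminal x) m \<in> carrier (ob F x)" if "x \<in> Obj C" for x
      by (rule cat_module_ar_closed[OF F that terminal(1) to_terminal_hom[OF that] m])
    let ?\<rho> = "\<lambda>x\<in>Obj C. \<lambda>r\<in>carrier (ob ?const x). r \<odot>\<^bsub>ob F x\<^esub> ar F x e (to_terminal x) m"
    have \<rho>: "transformation R C ?const F (\<lambda>x r. r \<odot>\<^bsub>ob F x\<^esub> ar F x e (to_terminal x) m)"
      unfolding transformation_def
    proof (intro conjI ballI)
      fix x assume x: "x \<in> Obj C"
      interpret Fx: module R "ob F x" by (rule cat_module_ob[OF F x])
      show "(\<lambda>r. r \<odot>\<^bsub>ob F x\<^esub> ar F x e (to_terminal x) m) \<in> module_hom R (ob ?const x) (ob F x)"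
        by (rule module_homI)
          (auto simp: const_functor_def regular_module_simps mx[OF x] Fx.smult_l_distr Fx.smult_assoc1)
      fix y a r assume "y \<in> Obj C" "a \<in> Hom C x y" "r \<in> carrier (ob ?const y)"
      then show "ar ?const x y a r \<odot>\<^bsub>ob F x\<^esub> ar F x e (to_terminal x) m =
          ar F x y a (r \<odot>\<^bsub>ob F y\<^esub> ar F y e (to_terminal y) m)"
        using x by (simp add: module_hom_smult[OF cat_module_ar[OF F]] mx to_terminal_natural[OF F] m
            const_functor_def regular_module_simps)
    qed
    have "\<exists>\<theta>\<in>carrier ?N. precomp C ?const T_class \<theta> = ?\<rho>"
    proof (rule transformation_factor[OF const_functor_cat_module[OF is_cring] T_cat_module F T_class_transformation])
      show "?\<rho> \<in> carrier (nat_module R C ?const F)"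
        by (rule restrict_transformation[OF \<rho> const_functor_cat_module[OF is_cring]])
    next
      fix x q assume "x \<in> Obj C" "q \<in> carrier (ob T x)"
      then show "\<exists>p\<in>carrier (ob ?const x). T_class x p = q"
        by (auto simp: T_carrier const_functor_def regular_module_simps)
    next
      fix x p assume x: "x \<in> Obj C" and p: "p \<in> carrier (ob ?const x)" and "T_class x p = \<zero>\<^bsub>ob T x\<^esub>"
      interpret Fx: module R "ob F x" by (rule cat_module_ob[OF F x])
      have "p \<in> carrier R" "p \<in> J x"
        using p \<open>T_class x p = \<zero>\<^bsub>ob T x\<^esub>\<close> T_class_zero_iff[of p x] by (auto simp: const_functor_def regular_module_simps)
      then have "p \<odot>\<^bsub>ob F x\<^esub> ar F x e (to_terminal x) m = \<zero>\<^bsub>ob F x\<^esub>"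
        using kill[OF x] mx[OF x] by (auto split: if_splits)
      then show "?\<rho> x p = \<zero>\<^bsub>ob F x\<^esub>"
        using x p by simp
    qed
    then obtain \<theta> where \<theta>: "\<theta> \<in> carrier ?N" and "precomp C ?const T_class \<theta> = ?\<rho>" by blast
    then have "precomp C ?const T_class \<theta> e \<one> = ?\<rho> e \<one>"
      by simp
    then have "?f \<theta> = m"
      using m terminal(1) by (simp add: precomp_def const_functor_def regular_module_simps to_terminal_ident
          cat_module_ident[OF F])
    with \<theta> show "m \<in> ?f ` carrier ?N" by blast
  qed (use closed in auto)
  ultimately show "module_isomorphic R ?N ?K" by (auto simp: module_isomorphic_def module_iso_def)
qed

subsection \<open>Extensions of the quotient\<close>

abbreviation P :: "('o, 'a, 'r, 'o \<times> 'r set \<times> 'a \<Rightarrow> 'r) fun_data" where "P \<equiv> free_functor R C T"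

abbreviation K :: "('o, 'a, 'r, 'o \<times> 'r set \<times> 'a \<Rightarrow> 'r) fun_data" where "K \<equiv> free_kernel R C T"

abbreviation subcat :: "('o, 'a) cat" where "subcat \<equiv> C\<lparr>Obj := Obj C \<inter> D\<rparr>"

text \<open>Representatives in \<open>R\<close> for the elements of \<open>T\<close>. Extended linearly, they lift the free cover \<open>P \<rightarrow> T\<close> to the
  augmentation \<open>P \<rightarrow> R\<close>.\<close>

definition lift :: "'o \<times> 'r set \<times> 'a \<Rightarrow> 'r" where
  "lift = (\<lambda>(X, t, a). SOME r. r \<in> carrier R \<and> T_class X r = t)"

definition aug :: "'o \<Rightarrow> ('o \<times> 'r set \<times> 'a \<Rightarrow> 'r) \<Rightarrow> 'r" where
  "aug x = lin_ext R (regular_module R) lift"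

text \<open>By Yoneda, \<open>P\<close> contains a copy of \<open>R Hom(-, e)\<close>, the constant functor \<open>R\<close>, for the generator of \<open>T\<close>. This is its
  basis element at \<open>x\<close>.\<close>

definition gen :: "'o \<Rightarrow> 'o \<times> 'r set \<times> 'a \<Rightarrow> 'r" where
  "gen x = basis_elem R (e, T_class e \<one>, to_terminal x)"

lemma lift:
  assumes "t \<in> carrier (ob T X)"
  shows "lift (X, t, a) \<in> carrier R" "T_class X (lift (X, t, a)) = t"
  using someI_ex[of "\<lambda>r. r \<in> carrier R \<and> T_class X r = t"] assms by (auto simp: lift_def T_carrier)

text \<open>The terminal object lies outside the sieve, so \<open>J e = 0\<close> and the representative is unique.\<close>

lemma lift_gen: "lift (e, T_class e \<one>, a) = \<one>"
proof -
  interpret N: module R "regular_module R" by (rule regular_module_module[OF is_cring])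
  let ?r = "lift (e, T_class e \<one>, a)"
  have r: "?r \<in> carrier R" "T_class e ?r = T_class e \<one>" using lift[OF T_class_closed[OF one_closed]] by auto
  have "?r \<ominus>\<^bsub>regular_module R\<^esub> \<one> \<in> J e"
    using r coset_eq_iff[OF N.module_axioms submodule_J, of ?r \<one> e]
    by (simp add: T_class_def regular_module_simps)
  then show ?thesis
    using r(1) proper N.minus_eq_zero_iff[of ?r \<one>] by (simp add: regular_module_simps)
qed

lemma aug_hom: "x \<in> Obj C \<Longrightarrow> aug x \<in> module_hom R (ob P x) (regular_module R)"
proof -
  interpret N: module R "regular_module R" by (rule regular_module_module[OF is_cring])
  show "aug x \<in> module_hom R (ob P x) (regular_module R)"
    unfolding aug_def free_functor_ob
    by (rule N.lin_ext_hom) (auto simp: free_basis_def regular_module_simps lift)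
qed

lemma aug_basis: "t \<in> carrier (ob T X) \<Longrightarrow> aug x (basis_elem R (X, t, a)) = lift (X, t, a)"
proof -
  interpret N: module R "regular_module R" by (rule regular_module_module[OF is_cring])
  show "t \<in> carrier (ob T X) \<Longrightarrow> aug x (basis_elem R (X, t, a)) = lift (X, t, a)"
    unfolding aug_def by (rule N.lin_ext_basis) (simp add: regular_module_simps lift)
qed

lemma aug_closed: "x \<in> Obj C \<Longrightarrow> c \<in> carrier (ob P x) \<Longrightarrow> aug x c \<in> carrier R"
  using module_hom_closed[OF aug_hom] by (simp add: regular_module_simps)

lemma aug_add: "x \<in> Obj C \<Longrightarrow> c \<in> carrier (ob P x) \<Longrightarrow> d \<in> carrier (ob P x) \<Longrightarrow>
    aug x (c \<oplus>\<^bsub>ob P x\<^esub> d) = aug x c \<oplus> aug x d"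
  and aug_smult: "x \<in> Obj C \<Longrightarrow> c \<in> carrier (ob P x) \<Longrightarrow> r \<in> carrier R \<Longrightarrow>
    aug x (r \<odot>\<^bsub>ob P x\<^esub> c) = r \<otimes> aug x c"
  using module_hom_add[OF aug_hom] module_hom_smult[OF aug_hom] by (simp_all add: regular_module_simps)

lemma aug_natural:
  assumes "x \<in> Obj C" "y \<in> Obj C" "a \<in> Hom C x y" "c \<in> carrier (ob P y)"
  shows "aug x (ar P x y a c) = aug y c"
  using assms(4)
  by (rule free_functor_hom_eq[OF regular_module_module[OF is_cring]
        module_hom_compose[OF free_functor_ar_hom[OF assms(1-3)] aug_hom[OF assms(1)]] aug_hom[OF assms(2)], rotated -1])
    (use assms in \<open>simp add: free_functor_ar_basis aug_basis, simp add: lift_def\<close>)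

text \<open>The augmentation lifts the counit along \<open>R \<rightarrow> T\<close>, so it maps the kernel \<open>K\<close> into \<open>J\<close>.\<close>

lemma T_class_aug:
  assumes x: "x \<in> Obj C" and c: "c \<in> carrier (ob P x)"
  shows "T_class x (aug x c) = free_counit R T x c"
  using c
proof (rule free_functor_hom_eq[OF cat_module_ob[OF T_cat_module x]
      module_hom_compose[OF aug_hom[OF x] T_class_hom[OF x]] free_counit_hom[OF T_cat_module x], rotated -1])
  fix X t a assume X: "X \<in> Obj C" and t: "t \<in> carrier (ob T X)" and a: "a \<in> Hom C x X"
  have "free_counit R T x (basis_elem R (X, t, a)) = ar T x X a (T_class X (lift (X, t, a)))"
    using free_counit_basis[OF T_cat_module x X t a] lift[OF t] by simp
  then show "T_class x (aug x (basis_elem R (X, t, a))) = free_counit R T x (basis_elem R (X, t, a))"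
    using T_class_natural[OF x X a lift(1)[OF t, of a]] lift(2)[OF t, of a] aug_basis[OF t, of x a] by simp
qed

lemma K_iff:
  assumes x: "x \<in> Obj C"
  shows "k \<in> carrier (ob K x) \<longleftrightarrow> k \<in> carrier (ob P x) \<and> (x \<notin> D \<longrightarrow> aug x k = \<zero>)"
proof -
  have "free_counit R T x k = \<zero>\<^bsub>ob T x\<^esub> \<longleftrightarrow> (x \<notin> D \<longrightarrow> aug x k = \<zero>)" if k: "k \<in> carrier (ob P x)"
    using T_class_zero_iff[OF aug_closed[OF x k], of x] aug_closed[OF x k] T_class_aug[OF x k] by auto
  then show ?thesis by (auto simp: free_kernel_carrier)
qed

lemma gen_closed: "x \<in> Obj C \<Longrightarrow> gen x \<in> carrier (ob P x)"
  unfolding gen_def by (rule free_functor_basis_closed[OF _ terminal(1) T_class_closed[OF one_closed] to_terminal_hom])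

lemma aug_gen: "aug x (gen x) = \<one>"
  by (simp add: gen_def aug_basis T_class_closed lift_gen)

lemma gen_natural: "x \<in> Obj C \<Longrightarrow> y \<in> Obj C \<Longrightarrow> a \<in> Hom C x y \<Longrightarrow> ar P x y a (gen y) = gen x"
  by (simp add: gen_def free_functor_ar_basis terminal to_terminal_hom T_class_closed comp_to_terminal)

lemma gen_in_K: "x \<in> Obj C \<Longrightarrow> x \<in> D \<Longrightarrow> gen x \<in> carrier (ob K x)"
  by (simp add: K_iff gen_closed)

text \<open>The homomorphism \<open>K \<rightarrow> F\<close> given by a compatible family on the sieve: restrict the augmentation
  to \<open>K \<rightarrow> J\<close> and let \<open>1 \<in> J x\<close> act as the member of the family.\<close>

definition family_hom :: "('o, 'a, 'r, 'm) fun_data \<Rightarrow> ('o \<Rightarrow> 'm) \<Rightarrow> 'o \<Rightarrow> ('o \<times> 'r set \<times> 'a \<Rightarrow> 'r) \<Rightarrow> 'm" where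
  "family_hom F v = (\<lambda>x\<in>Obj C. \<lambda>k\<in>carrier (ob K x). if x \<in> D then aug x k \<odot>\<^bsub>ob F x\<^esub> v x else \<zero>\<^bsub>ob F x\<^esub>)"

lemma family_hom_eq:
  "x \<in> Obj C \<Longrightarrow> k \<in> carrier (ob K x) \<Longrightarrow>
    family_hom F v x k = (if x \<in> D then aug x k \<odot>\<^bsub>ob F x\<^esub> v x else \<zero>\<^bsub>ob F x\<^esub>)"
  by (simp add: family_hom_def)

lemma lim_subcatD:
  assumes "v \<in> carrier (lim_module subcat F)"
  shows "x \<in> Obj C \<Longrightarrow> x \<in> D \<Longrightarrow> v x \<in> carrier (ob F x)"
    and "x \<in> Obj C \<Longrightarrow> y \<in> Obj C \<Longrightarrow> y \<in> D \<Longrightarrow> a \<in> Hom C x y \<Longrightarrow> ar F x y a (v y) = v x"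
  using assms sieve unfolding lim_module_carrier by (auto simp: PiE_iff)

text \<open>Naturality at a morphism whose target lies outside the sieve: the augmentation vanishes on \<open>K\<close> there, so both sides
  are zero, even if the source lies in the sieve.\<close>

lemma family_hom_closed:
  assumes F: "cat_module R C F" and v: "v \<in> carrier (lim_module subcat F)"
  shows "family_hom F v \<in> carrier (nat_module R C K F)"
  unfolding family_hom_def
proof (rule restrict_transformation[OF _ free_kernel_cat_module[OF T_cat_module]], unfold transformation_def, intro conjI ballI)
  fix x assume x: "x \<in> Obj C"
  interpret Fx: module R "ob F x" by (rule cat_module_ob[OF F x])
  note v' = lim_subcatD[OF v]
  show "(\<lambda>k. if x \<in> D then aug x k \<odot>\<^bsub>ob F x\<^esub> v x else \<zero>\<^bsub>ob F x\<^esub>) \<in> module_hom R (ob K x) (ob F x)"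
    by (rule module_homI)
      (auto simp: K_iff[OF x] free_kernel_ops aug_closed[OF x] aug_add[OF x] aug_smult[OF x] v'(1)[OF x]
        Fx.smult_l_distr Fx.smult_assoc1)
  fix y a k assume y: "y \<in> Obj C" and a: "a \<in> Hom C x y" and k: "k \<in> carrier (ob K y)"
  interpret Fy: module R "ob F y" by (rule cat_module_ob[OF F y])
  have k': "k \<in> carrier (ob P y)" "y \<notin> D \<Longrightarrow> aug y k = \<zero>" using k K_iff[OF y] by auto
  have aug: "aug x (ar K x y a k) = aug y k" unfolding free_kernel_ops by (rule aug_natural[OF x y a k'(1)])
  show "(if x \<in> D then aug x (ar K x y a k) \<odot>\<^bsub>ob F x\<^esub> v x else \<zero>\<^bsub>ob F x\<^esub>) =
      ar F x y a (if y \<in> D then aug y k \<odot>\<^bsub>ob F y\<^esub> v y else \<zero>\<^bsub>ob F y\<^esub>)"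
  proof (cases "y \<in> D")
    case True
    then show ?thesis
      using sieve[OF x y a True] aug v'(1)[OF y True] v'(2)[OF x y True a] aug_closed[OF y k'(1)]
      by (simp add: module_hom_smult[OF cat_module_ar[OF F x y a]])
  next
    case False
    then show ?thesis
      using aug k'(2) v'(1)[OF x] module_hom_zero[OF Fy.module_axioms Fx.module_axioms cat_module_ar[OF F x y a]]
      by simp
  qed
qed

lemma lim_subcat_ops:
  assumes "x \<in> Obj C" "x \<in> D"
  shows "(v \<oplus>\<^bsub>lim_module subcat F\<^esub> w) x = v x \<oplus>\<^bsub>ob F x\<^esub> w x"
    and "(r \<odot>\<^bsub>lim_module subcat F\<^esub> v) x = r \<odot>\<^bsub>ob F x\<^esub> v x"
  using assms by (simp_all add: lim_module_def prod_module_def)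

lemma subcat_cat_module: "cat_module R C F \<Longrightarrow> cat_module R subcat F"
  by (simp add: cat_module_def)

lemma family_hom_hom:
  assumes F: "cat_module R C F"
  shows "family_hom F \<in> module_hom R (lim_module subcat F) (nat_module R C K F)"
proof (rule module_homI)
  interpret L: module R "lim_module subcat F" by (rule lim_module_module[OF is_cring subcat_cat_module[OF F]])
  interpret N: module R "nat_module R C K F"
    by (rule nat_module_module[OF is_cring free_kernel_cat_module[OF T_cat_module] F])
  note Fmod = cat_module_ob[OF F]
  note Fam = abelian_group.axioms(1)[OF module.axioms(2)[OF Fmod]]
  fix v w r assume v: "v \<in> carrier (lim_module subcat F)"
  show "family_hom F v \<in> carrier (nat_module R C K F)" by (rule family_hom_closed[OF F v])
  show "family_hom F (v \<oplus>\<^bsub>lim_module subcat F\<^esub> w) = family_hom F v \<oplus>\<^bsub>nat_module R C K F\<^esub> family_hom F w"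
    if w: "w \<in> carrier (lim_module subcat F)"
    by (rule nat_module_eqI[OF family_hom_closed[OF F L.a_closed[OF v w]]
          N.a_closed[OF family_hom_closed[OF F v] family_hom_closed[OF F w]]])
      (auto simp: nat_module_add family_hom_eq lim_subcat_ops K_iff aug_closed lim_subcatD[OF v] lim_subcatD[OF w]
        module.smult_r_distr[OF Fmod] abelian_monoid.l_zero[OF Fam] abelian_monoid.zero_closed[OF Fam])
  show "family_hom F (r \<odot>\<^bsub>lim_module subcat F\<^esub> v) = r \<odot>\<^bsub>nat_module R C K F\<^esub> family_hom F v"
    if r: "r \<in> carrier R"
    by (rule nat_module_eqI[OF family_hom_closed[OF F L.smult_closed[OF r v]]
          N.smult_closed[OF r family_hom_closed[OF F v]]])
      (auto simp: nat_module_smult family_hom_eq lim_subcat_ops K_iff aug_closed lim_subcatD[OF v] r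
        module.smult_assoc1[OF Fmod, symmetric] m_comm module.smult_r_null[OF Fmod])
qed

text \<open>On the sieve, the family is the value of the homomorphism at \<open>gen\<close>, which lies in \<open>K\<close> there. An
  extension to \<open>P\<close> can be evaluated at \<open>gen e\<close> as well, and by naturality the family is the restriction of that
  element of \<open>F e\<close>. Conversely, if the family comes from \<open>m\<close>, then \<open>c \<mapsto> aug c \<cdot> m\<close> is an
  extension.\<close>

lemma family_hom_extends_iff:
  assumes F: "cat_module R C F" and v: "v \<in> carrier (lim_module subcat F)"
  shows "(\<exists>\<xi>\<in>carrier (nat_module R C P F). \<forall>x\<in>Obj C. \<forall>k\<in>carrier (ob K x). family_hom F v x k = \<xi> x k) \<longleftrightarrow>
    (\<exists>m\<in>carrier (ob F e). \<forall>x\<in>Obj C \<inter> D. v x = ar F x e (to_terminal x) m)" (is "?L \<longleftrightarrow> ?R")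
proof
  assume ?L
  then obtain \<xi> where \<xi>: "\<xi> \<in> carrier (nat_module R C P F)"
    and eq: "\<And>x k. x \<in> Obj C \<Longrightarrow> k \<in> carrier (ob K x) \<Longrightarrow> family_hom F v x k = \<xi> x k" by blast
  note t = nat_module_transformation[OF \<xi>]
  have "v x = ar F x e (to_terminal x) (\<xi> e (gen e))" if x: "x \<in> Obj C" "x \<in> D" for x
  proof -
    interpret Fx: module R "ob F x" by (rule cat_module_ob[OF F x(1)])
    have "v x = family_hom F v x (gen x)"
      using x lim_subcatD(1)[OF v x] by (simp add: family_hom_eq gen_in_K aug_gen)
    also have "\<dots> = \<xi> x (ar P x e (to_terminal x) (gen e))"
      using x by (simp add: eq gen_in_K gen_natural terminal to_terminal_hom)
    also have "\<dots> = ar F x e (to_terminal x) (\<xi> e (gen e))"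
      using x by (simp add: transformation_natural[OF t] terminal to_terminal_hom gen_closed)
    finally show ?thesis .
  qed
  moreover have "\<xi> e (gen e) \<in> carrier (ob F e)"
    by (rule transformation_closed[OF t terminal(1) gen_closed[OF terminal(1)]])
  ultimately show ?R by blast
next
  assume ?R
  then obtain m where m: "m \<in> carrier (ob F e)" and vm: "\<And>x. x \<in> Obj C \<Longrightarrow> x \<in> D \<Longrightarrow> v x = ar F x e (to_terminal x) m"
    by blast
  have mx: "ar F x e (to_terminal x) m \<in> carrier (ob F x)" if "x \<in> Obj C" for x
    by (rule cat_module_ar_closed[OF F that terminal(1) to_terminal_hom[OF that] m])
  have "transformation R C P F (\<lambda>x c. aug x c \<odot>\<^bsub>ob F x\<^esub> ar F x e (to_terminal x) m)"
    unfolding transformation_def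
  proof (intro conjI ballI)
    fix x assume x: "x \<in> Obj C"
    interpret Fx: module R "ob F x" by (rule cat_module_ob[OF F x])
    show "(\<lambda>c. aug x c \<odot>\<^bsub>ob F x\<^esub> ar F x e (to_terminal x) m) \<in> module_hom R (ob P x) (ob F x)"
      by (rule module_homI)
        (auto simp: aug_closed[OF x] aug_add[OF x] aug_smult[OF x] mx[OF x] Fx.smult_l_distr Fx.smult_assoc1)
    fix y a c assume "y \<in> Obj C" "a \<in> Hom C x y" "c \<in> carrier (ob P y)"
    then show "aug x (ar P x y a c) \<odot>\<^bsub>ob F x\<^esub> ar F x e (to_terminal x) m =
        ar F x y a (aug y c \<odot>\<^bsub>ob F y\<^esub> ar F y e (to_terminal y) m)"
      using x by (simp add: aug_natural aug_closed module_hom_smult[OF cat_module_ar[OF F]] mx to_terminal_natural[OF F] m)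
  qed
  from restrict_transformation[OF this free_functor_cat_module]
  have "(\<lambda>x\<in>Obj C. \<lambda>c\<in>carrier (ob P x). aug x c \<odot>\<^bsub>ob F x\<^esub> ar F x e (to_terminal x) m) \<in> carrier (nat_module R C P F)" .
  moreover have "family_hom F v x k =
      (\<lambda>x\<in>Obj C. \<lambda>c\<in>carrier (ob P x). aug x c \<odot>\<^bsub>ob F x\<^esub> ar F x e (to_terminal x) m) x k"
    if x: "x \<in> Obj C" and k: "k \<in> carrier (ob K x)" for x k
  proof -
    interpret Fx: module R "ob F x" by (rule cat_module_ob[OF F x])
    show ?thesis
      using x k by (auto simp: family_hom_eq vm mx K_iff)
  qed
  ultimately show ?L by blast
qed

text \<open>Since \<open>P = K + R \<cdot> gen\<close> at every object, subtracting the homomorphism of its own family from a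
  homomorphism \<open>\<theta> : K \<rightarrow> F\<close> leaves one that extends to \<open>P\<close>, by \<open>c \<mapsto> \<theta> (c - aug c \<cdot> gen)\<close>.\<close>

lemma hom_K_eq_family_hom_plus_extendable:
  assumes F: "cat_module R C F" and \<theta>: "\<theta> \<in> carrier (nat_module R C K F)"
  shows "\<exists>v\<in>carrier (lim_module subcat F). \<exists>\<xi>\<in>carrier (nat_module R C P F).
    \<forall>x\<in>Obj C. \<forall>k\<in>carrier (ob K x). \<theta> x k = \<xi> x k \<oplus>\<^bsub>ob F x\<^esub> family_hom F v x k"
proof -
  note t = nat_module_transformation[OF \<theta>]
  let ?v = "\<lambda>x\<in>Obj C \<inter> D. \<theta> x (gen x)"
  let ?split = "\<lambda>x c. c \<oplus>\<^bsub>ob P x\<^esub> (\<ominus> aug x c) \<odot>\<^bsub>ob P x\<^esub> gen x"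
  have v: "?v \<in> carrier (lim_module subcat F)"
    unfolding lim_module_carrier
  proof (intro conjI ballI)
    show "?v \<in> (\<Pi>\<^sub>E x\<in>Obj subcat. carrier (ob F x))"
      by (auto intro!: transformation_closed[OF t] gen_in_K)
    fix x y a assume "x \<in> Obj subcat" "y \<in> Obj subcat" "a \<in> Hom subcat x y"
    then have xy: "x \<in> Obj C" "x \<in> D" "y \<in> Obj C" "y \<in> D" "a \<in> Hom C x y" by auto
    then show "ar F x y a (?v y) = ?v x"
      using transformation_natural[OF t xy(1,3,5) gen_in_K[OF xy(3,4)]] gen_natural[OF xy(1,3,5)]
      by (simp add: free_kernel_ops)
  qed
  have split: "transformation R C P K ?split"
    unfolding transformation_def
  proof (intro conjI ballI)
    fix x assume x: "x \<in> Obj C"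
    interpret Px: module R "ob P x" by (rule cat_module_ob[OF free_functor_cat_module x])
    note g = gen_closed[OF x]
    have closed: "?split x c \<in> carrier (ob P x)" if "c \<in> carrier (ob P x)" for c
      using that g aug_closed[OF x] by simp
    show "?split x \<in> module_hom R (ob P x) (ob K x)"
    proof (rule module_homI)
      fix c d r assume c: "c \<in> carrier (ob P x)"
      have "aug x (?split x c) = \<zero>"
        using c g aug_closed[OF x c] by (simp add: aug_add[OF x] aug_smult[OF x] aug_gen r_neg)
      then show "?split x c \<in> carrier (ob K x)" using closed[OF c] by (simp add: K_iff[OF x])
      show "?split x (c \<oplus>\<^bsub>ob P x\<^esub> d) = ?split x c \<oplus>\<^bsub>ob K x\<^esub> ?split x d" if d: "d \<in> carrier (ob P x)"
        using c d g aug_closed[OF x c] aug_closed[OF x d]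
        by (simp add: free_kernel_ops aug_add[OF x] minus_add Px.smult_l_distr Px.a_ac)
      show "?split x (r \<odot>\<^bsub>ob P x\<^esub> c) = r \<odot>\<^bsub>ob K x\<^esub> ?split x c" if r: "r \<in> carrier R"
        using c r g aug_closed[OF x c]
        by (simp add: free_kernel_ops aug_smult[OF x] Px.smult_r_distr Px.smult_assoc1[symmetric] r_minus)
    qed
    fix y a c assume y: "y \<in> Obj C" and a: "a \<in> Hom C x y" and c: "c \<in> carrier (ob P y)"
    interpret Py: module R "ob P y" by (rule cat_module_ob[OF free_functor_cat_module y])
    show "?split x (ar P x y a c) = ar K x y a (?split y c)"
      using x y a c gen_closed[OF y] aug_closed[OF y c]
      by (simp add: free_kernel_ops aug_natural gen_natural module_hom_add[OF free_functor_ar_hom]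
          module_hom_smult[OF free_functor_ar_hom])
  qed
  let ?\<xi> = "\<lambda>x\<in>Obj C. \<lambda>c\<in>carrier (ob P x). \<theta> x (?split x c)"
  have \<xi>: "?\<xi> \<in> carrier (nat_module R C P F)"
    by (rule restrict_transformation[OF transformation_compose[OF split t] free_functor_cat_module])
  have "\<theta> x k = ?\<xi> x k \<oplus>\<^bsub>ob F x\<^esub> family_hom F ?v x k" if x: "x \<in> Obj C" and k: "k \<in> carrier (ob K x)" for x k
  proof -
    interpret Fx: module R "ob F x" by (rule cat_module_ob[OF F x])
    interpret Px: module R "ob P x" by (rule cat_module_ob[OF free_functor_cat_module x])
    interpret Kx: module R "ob K x" by (rule cat_module_ob[OF free_kernel_cat_module[OF T_cat_module] x])
    have kP: "k \<in> carrier (ob P x)" and k0: "x \<notin> D \<Longrightarrow> aug x k = \<zero>" using k K_iff[OF x] by auto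
    note th = module_homD[OF transformation_hom[OF t x]]
    show ?thesis
    proof (cases "x \<in> D")
      case True
      note g = gen_in_K[OF x True]
      have "\<theta> x (?split x k) = \<theta> x k \<oplus>\<^bsub>ob F x\<^esub> (\<ominus> aug x k) \<odot>\<^bsub>ob F x\<^esub> \<theta> x (gen x)"
        using th(2)[OF k Kx.smult_closed[OF _ g, of "\<ominus> aug x k"]] th(3)[OF _ g, of "\<ominus> aug x k"] aug_closed[OF x kP]
        by (simp add: free_kernel_ops)
      moreover have "\<theta> x k = (\<theta> x k \<oplus>\<^bsub>ob F x\<^esub> (\<ominus> aug x k) \<odot>\<^bsub>ob F x\<^esub> \<theta> x (gen x)) \<oplus>\<^bsub>ob F x\<^esub> aug x k \<odot>\<^bsub>ob F x\<^esub> \<theta> x (gen x)"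
        using th(1)[OF k] th(1)[OF g] aug_closed[OF x kP]
        by (simp add: Fx.a_assoc Fx.smult_l_distr[symmetric] l_neg)
      ultimately show ?thesis using x True k kP by (simp add: family_hom_eq)
    next
      case False
      then show ?thesis
        using x k kP k0 th(1)[OF k] gen_closed[OF x] by (simp add: family_hom_eq)
    qed
  qed
  with v \<xi> show ?thesis by blast
qed

text \<open>The end \<open>F e \<rightarrow> lim F \<rightarrow> Ext\<^sup>1(T, F) \<rightarrow> 0\<close> of the long exact sequence of \<open>0 \<rightarrow> J \<rightarrow> R \<rightarrow> T \<rightarrow> 0\<close>; the map
  \<open>q\<close> is the connecting homomorphism.\<close>

theorem ext_T_presentation:
  assumes F: "cat_module R C F"
  shows "\<exists>q\<in>module_hom R (lim_module subcat F) (Ext1 R C T F).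
    q ` carrier (lim_module subcat F) = carrier (Ext1 R C T F) \<and>
    (\<forall>v\<in>carrier (lim_module subcat F). q v = \<zero>\<^bsub>Ext1 R C T F\<^esub> \<longleftrightarrow>
      (\<exists>m\<in>carrier (ob F e). \<forall>x\<in>Obj C \<inter> D. v x = ar F x e (to_terminal x) m))"
proof (intro bexI conjI ballI)
  let ?q = "\<lambda>v. ext_class T F (family_hom F v)"
  note pres = ext_class_presentation[OF T_cat_module F]
  note fam = family_hom_hom[OF F]
  interpret E: module R "Ext1 R C T F" by (rule pres(1))
  interpret N: module R "nat_module R C K F"
    by (rule nat_module_module[OF is_cring free_kernel_cat_module[OF T_cat_module] F])
  note cls = module_homD[OF pres(2)]
  show "?q \<in> module_hom R (lim_module subcat F) (Ext1 R C T F)"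
    by (rule module_hom_compose[OF fam pres(2)])
  show "?q v = \<zero>\<^bsub>Ext1 R C T F\<^esub> \<longleftrightarrow> (\<exists>m\<in>carrier (ob F e). \<forall>x\<in>Obj C \<inter> D. v x = ar F x e (to_terminal x) m)"
    if v: "v \<in> carrier (lim_module subcat F)" for v
    unfolding pres(4)[OF family_hom_closed[OF F v]] by (rule family_hom_extends_iff[OF F v])
  show "?q ` carrier (lim_module subcat F) = carrier (Ext1 R C T F)"
  proof (intro equalityI subsetI)
    fix c assume "c \<in> carrier (Ext1 R C T F)"
    then obtain \<theta> where \<theta>: "\<theta> \<in> carrier (nat_module R C K F)" "c = ext_class T F \<theta>"
      unfolding pres(3)[symmetric] by blast
    from hom_K_eq_family_hom_plus_extendable[OF F \<theta>(1)] obtain v \<xi>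
      where v: "v \<in> carrier (lim_module subcat F)" and \<xi>: "\<xi> \<in> carrier (nat_module R C P F)"
        and eq: "\<And>x k. x \<in> Obj C \<Longrightarrow> k \<in> carrier (ob K x) \<Longrightarrow> \<theta> x k = \<xi> x k \<oplus>\<^bsub>ob F x\<^esub> family_hom F v x k"
      by blast
    note vN = family_hom_closed[OF F v]
    let ?\<delta> = "\<theta> \<ominus>\<^bsub>nat_module R C K F\<^esub> family_hom F v"
    have \<delta>: "?\<delta> \<in> carrier (nat_module R C K F)" using \<theta>(1) vN by (rule N.minus_closed)
    have sum: "\<theta> = ?\<delta> \<oplus>\<^bsub>nat_module R C K F\<^esub> family_hom F v"
      using \<theta>(1) vN by (simp add: N.minus_eq N.a_assoc N.l_neg)
    have "?\<delta> x k = \<xi> x k" if x: "x \<in> Obj C" and k: "k \<in> carrier (ob K x)" for x k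
    proof -
      interpret Fx: module R "ob F x" by (rule cat_module_ob[OF F x])
      have "?\<delta> x k \<oplus>\<^bsub>ob F x\<^esub> family_hom F v x k = \<xi> x k \<oplus>\<^bsub>ob F x\<^esub> family_hom F v x k"
        using eq[OF x k] nat_module_add[OF x k, of R F ?\<delta> "family_hom F v"] sum by simp
      then show ?thesis
        using transformation_closed[OF nat_module_transformation[OF \<delta>] x k]
          transformation_closed[OF nat_module_transformation[OF vN] x k]
          transformation_closed[OF nat_module_transformation[OF \<xi>] x] k
        by (simp add: free_kernel_carrier)
    qed
    then have "ext_class T F ?\<delta> = \<zero>\<^bsub>Ext1 R C T F\<^esub>"
      unfolding pres(4)[OF \<delta>] using \<xi> by blast
    moreover have "ext_class T F \<theta> = ext_class T F ?\<delta> \<oplus>\<^bsub>Ext1 R C T F\<^esub> ?q v"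
      using cls(2)[OF \<delta> vN] sum by simp
    ultimately have "c = ?q v" using \<theta>(2) cls(1)[OF vN] by simp
    then show "c \<in> ?q ` carrier (lim_module subcat F)" using v by blast
  qed (use module_hom_closed[OF module_hom_compose[OF fam pres(2)]] in auto)
qed

end

section \<open>The orbit category of sections\<close>

context group begin

lemma conj_set_image: "conj_set G g A = (\<lambda>a. g \<otimes> a \<otimes> inv g) ` A"
  by (auto simp: conj_set_def l_coset_def r_coset_def)

lemma conj_set_mono: "A \<subseteq> B \<Longrightarrow> conj_set G g A \<subseteq> conj_set G g B"
  by (auto simp: conj_set_image)

lemma conj_set_one: "A \<subseteq> carrier G \<Longrightarrow> conj_set G \<one> A = A"
  by (force simp: conj_set_image)

lemma conj_set_mult:
  assumes "g \<in> carrier G" "h \<in> carrier G" "A \<subseteq> carrier G"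
  shows "conj_set G (g \<otimes> h) A = conj_set G g (conj_set G h A)"
  unfolding conj_set_image image_image
  using assms by (intro image_cong) (auto simp: inv_mult_group m_assoc)

lemma conj_set_closed: "g \<in> carrier G \<Longrightarrow> A \<subseteq> carrier G \<Longrightarrow> conj_set G g A \<subseteq> carrier G"
  by (auto simp: conj_set_image)

lemma conj_set_inv:
  assumes "g \<in> carrier G" "A \<subseteq> carrier G"
  shows "conj_set G (inv g) (conj_set G g A) = A" "conj_set G g (conj_set G (inv g) A) = A"
  using assms by (simp_all add: conj_set_mult[symmetric] conj_set_one)

lemma conj_set_eq_iff:
  assumes "g \<in> carrier G" "A \<subseteq> carrier G" "B \<subseteq> carrier G"
  shows "conj_set G g A = conj_set G g B \<longleftrightarrow> A = B"
  by (metis assms conj_set_inv(1))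

lemma conj_set_subgroup:
  assumes g: "g \<in> carrier G" and H: "subgroup H G"
  shows "subgroup (conj_set G g H) G"
proof
  note [simp] = subgroup.mem_carrier[OF H]
  show "conj_set G g H \<subseteq> carrier G" using g H by (intro conj_set_closed subgroup.subset)
  show "x \<otimes> y \<in> conj_set G g H" if "x \<in> conj_set G g H" "y \<in> conj_set G g H" for x y
  proof -
    from that obtain a b where ab: "a \<in> H" "b \<in> H" "x = g \<otimes> a \<otimes> inv g" "y = g \<otimes> b \<otimes> inv g"
      by (auto simp: conj_set_image)
    have "x \<otimes> y = g \<otimes> (a \<otimes> b) \<otimes> inv g"
      using ab g m_assoc[of "inv g" g "b \<otimes> inv g"] by (simp add: m_assoc)
    then show ?thesis using ab subgroup.m_closed[OF H] by (auto simp: conj_set_image)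
  qed
  show "\<one> \<in> conj_set G g H"
    unfolding conj_set_image using g subgroup.one_closed[OF H] by (intro image_eqI[of _ _ \<one>]) auto
  show "inv x \<in> conj_set G g H" if "x \<in> conj_set G g H" for x
  proof -
    from that obtain a where a: "a \<in> H" "x = g \<otimes> a \<otimes> inv g" by (auto simp: conj_set_image)
    have "inv x = g \<otimes> inv a \<otimes> inv g" using a g by (simp add: inv_mult_group m_assoc)
    then show ?thesis using a subgroup.m_inv_closed[OF H] by (auto simp: conj_set_image)
  qed
qed

lemma conj_set_self:
  assumes H: "subgroup H G" and h: "h \<in> H"
  shows "conj_set G h H = H"
proof -
  have sub: "conj_set G h H \<subseteq> H" if "h \<in> H" for h
    using that by (auto simp: conj_set_image subgroup.m_closed[OF H] subgroup.m_inv_closed[OF H])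
  have "H = conj_set G h (conj_set G (inv h) H)"
    using h subgroup.subset[OF H] by (simp add: conj_set_inv subgroup.mem_carrier[OF H])
  also have "\<dots> \<subseteq> conj_set G h H"
    by (intro conj_set_mono sub subgroup.m_inv_closed[OF H] h)
  finally show ?thesis using sub[OF h] by blast
qed

lemma conj_set_trivial: "g \<in> carrier G \<Longrightarrow> conj_set G g {\<one>} = {\<one>}"
  by (simp add: conj_set_image)

lemma conj_set_trivial_iff: "g \<in> carrier G \<Longrightarrow> A \<subseteq> carrier G \<Longrightarrow> conj_set G g A = {\<one>} \<longleftrightarrow> A = {\<one>}"
  using conj_set_eq_iff[of g A "{\<one>}"] by (simp add: conj_set_trivial)

lemma mem_normalizer_iff:
  "H \<subseteq> carrier G \<Longrightarrow> g \<in> normalizer G H \<longleftrightarrow> g \<in> carrier G \<and> conj_set G g H = H"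
  by (simp add: normalizer_def stabilizer_def conj_set_def)

lemma subset_imp_conj_set_eq:
  assumes U: "subgroup U G" and V: "V \<subseteq> carrier G" and sub: "\<And>u. u \<in> U \<Longrightarrow> conj_set G u V \<subseteq> V" and u: "u \<in> U"
  shows "conj_set G u V = V"
proof -
  have "V = conj_set G u (conj_set G (inv u) V)"
    using u V by (simp add: conj_set_inv subgroup.mem_carrier[OF U])
  also have "\<dots> \<subseteq> conj_set G u V"
    by (intro conj_set_mono sub subgroup.m_inv_closed[OF U] u)
  finally show ?thesis using sub[OF u] by blast
qed

lemma normal_in_subgroup_iff:
  assumes U: "subgroup U G"
  shows "V \<lhd> G\<lparr>carrier := U\<rparr> \<longleftrightarrow> subgroup V G \<and> V \<subseteq> U \<and> U \<subseteq> normalizer G V"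
proof -
  interpret U: group "G\<lparr>carrier := U\<rparr>" by (rule subgroup_imp_group[OF U])
  have sub: "subgroup V (G\<lparr>carrier := U\<rparr>) \<longleftrightarrow> subgroup V G \<and> V \<subseteq> U"
    using subgroup_incl[OF _ U, of V] incl_subgroup[OF U, of V] subgroup.subset[of V "G\<lparr>carrier := U\<rparr>"]
    by auto
  have "(\<forall>u\<in>U. \<forall>v\<in>V. u \<otimes> v \<otimes> inv u \<in> V) \<longleftrightarrow> U \<subseteq> normalizer G V" if V: "subgroup V G"
  proof -
    have "(\<forall>u\<in>U. \<forall>v\<in>V. u \<otimes> v \<otimes> inv u \<in> V) \<longleftrightarrow> (\<forall>u\<in>U. conj_set G u V \<subseteq> V)"
      by (auto simp: conj_set_image)
    also have "\<dots> \<longleftrightarrow> (\<forall>u\<in>U. conj_set G u V = V)"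
      using subset_imp_conj_set_eq[OF U subgroup.subset[OF V]] by blast
    also have "\<dots> \<longleftrightarrow> U \<subseteq> normalizer G V"
      using subgroup.mem_carrier[OF U] by (simp add: mem_normalizer_iff[OF subgroup.subset[OF V]] subset_iff Ball_def)
    finally show ?thesis .
  qed
  then show ?thesis
    unfolding U.normal_inv_iff sub using m_inv_consistent[OF U] by auto
qed

lemma sections_iff:
  "(U, V) \<in> sections G \<longleftrightarrow> subgroup U G \<and> subgroup V G \<and> V \<subseteq> U \<and> U \<subseteq> normalizer G V"
  using normal_in_subgroup_iff[of U V] by (auto simp: sections_def)

lemma normalizer_subgroup: "subgroup H G \<Longrightarrow> subgroup (normalizer G H) G"
  using normalizer_imp_subgroup subgroup.subset by blast

lemma subgroup_le_normalizer:
  assumes "subgroup H G"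
  shows "H \<subseteq> normalizer G H"
  using subgroup.subset[OF assms] conj_set_self[OF assms] by (auto simp: mem_normalizer_iff[OF subgroup.subset[OF assms]])

lemma normalizer_conj_set:
  assumes g: "g \<in> carrier G" and H: "subgroup H G"
  shows "normalizer G (conj_set G g H) = conj_set G g (normalizer G H)"
proof -
  have incl: "conj_set G g (normalizer G H) \<subseteq> normalizer G (conj_set G g H)"
    if g: "g \<in> carrier G" and H: "subgroup H G" for g H
  proof
    note Hc = subgroup.subset[OF H]
    fix x assume "x \<in> conj_set G g (normalizer G H)"
    then obtain n where n: "n \<in> carrier G" "conj_set G n H = H" "x = g \<otimes> n \<otimes> inv g"
      by (auto simp: conj_set_image[of _ "normalizer G H"] mem_normalizer_iff[OF Hc])
    have "conj_set G x (conj_set G g H) = conj_set G (g \<otimes> n) H"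
      using n g Hc by (simp add: conj_set_mult conj_set_closed conj_set_inv)
    then show "x \<in> normalizer G (conj_set G g H)"
      using n g Hc by (simp add: mem_normalizer_iff conj_set_closed conj_set_mult)
  qed
  have nc: "normalizer G (conj_set G g H) \<subseteq> carrier G"
    by (rule subgroup.subset[OF normalizer_subgroup[OF conj_set_subgroup[OF g H]]])
  have "normalizer G (conj_set G g H) = conj_set G g (conj_set G (inv g) (normalizer G (conj_set G g H)))"
    using conj_set_inv(2)[OF g nc] by simp
  also have "\<dots> \<subseteq> conj_set G g (normalizer G H)"
    using incl[OF inv_closed[OF g] conj_set_subgroup[OF g H]]
    by (intro conj_set_mono) (simp add: conj_set_inv g subgroup.subset[OF H])
  finally show ?thesis using incl[OF g H] by blast
qed

lemma sectionsD:
  assumes "s \<in> sections G"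
  shows "subgroup (fst s) G" "subgroup (snd s) G" "snd s \<subseteq> fst s" "fst s \<subseteq> normalizer G (snd s)"
    "fst s \<subseteq> carrier G" "snd s \<subseteq> carrier G"
  using assms sections_iff[of "fst s" "snd s"] subgroup.subset[of "fst s" G] subgroup.subset[of "snd s" G]
  by auto

lemma conj_sec_simps: "fst (conj_sec G g s) = conj_set G g (fst s)" "snd (conj_sec G g s) = conj_set G g (snd s)"
  by (simp_all add: conj_sec_def split: prod.splits)

lemma sec_le_iff: "sec_le s t \<longleftrightarrow> snd t \<subseteq> snd s \<and> snd s \<subseteq> fst s \<and> fst s \<subseteq> fst t"
  by (simp add: sec_le_def split: prod.splits)

lemma sec_le_trans: "sec_le s t \<Longrightarrow> sec_le t u \<Longrightarrow> sec_le s u"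
  by (auto simp: sec_le_iff)

lemma conj_sec_section:
  assumes g: "g \<in> carrier G" and s: "s \<in> sections G"
  shows "conj_sec G g s \<in> sections G"
proof -
  note s' = sectionsD[OF s]
  have "(conj_set G g (fst s), conj_set G g (snd s)) \<in> sections G"
    unfolding sections_iff normalizer_conj_set[OF g s'(2)]
    using s' g by (intro conjI conj_set_subgroup conj_set_mono) auto
  then show ?thesis by (cases s) (simp add: conj_sec_def)
qed

lemma conj_sec_mult:
  assumes "g \<in> carrier G" "h \<in> carrier G" "s \<in> sections G"
  shows "conj_sec G (g \<otimes> h) s = conj_sec G g (conj_sec G h s)"
  using assms sectionsD[OF assms(3)] by (auto simp: conj_sec_def conj_set_mult split: prod.splits)

lemma conj_sec_one: "s \<in> sections G \<Longrightarrow> conj_sec G \<one> s = s"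
  using sectionsD[of s] by (auto simp: conj_sec_def conj_set_one split: prod.splits)

lemma conj_sec_mono: "sec_le s t \<Longrightarrow> sec_le (conj_sec G g s) (conj_sec G g t)"
  by (auto simp: sec_le_iff conj_sec_simps intro: conj_set_mono[THEN subsetD])

lemma sec_le_conj_mult:
  assumes "g \<in> carrier G" "h \<in> carrier G" "s \<in> sections G"
    and "sec_le (conj_sec G g s) t" "sec_le (conj_sec G h t) u"
  shows "sec_le (conj_sec G (h \<otimes> g) s) u"
  using sec_le_trans[OF conj_sec_mono[OF assms(4)] assms(5)] assms(1-3) by (simp add: conj_sec_mult)

lemma sec_le_refl: "s \<in> sections G \<Longrightarrow> sec_le s s"
  using sectionsD(3)[of s] by (simp add: sec_le_iff)

lemma orbit_cat_simps:
  "Obj (orbit_cat G \<C>) = \<C>" "Comp (orbit_cat G \<C>) = set_mult G" "Ident (orbit_cat G \<C>) = fst"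
  by (simp_all add: orbit_cat_def)

lemma orbit_cat_HomI:
  "g \<in> carrier G \<Longrightarrow> sec_le (conj_sec G g s) t \<Longrightarrow> fst t #> g \<in> Hom (orbit_cat G \<C>) s t"
  by (auto simp: orbit_cat_def)

lemma orbit_cat_HomE:
  assumes "a \<in> Hom (orbit_cat G \<C>) s t"
  obtains g where "g \<in> carrier G" "sec_le (conj_sec G g s) t" "a = fst t #> g"
  using assms by (auto simp: orbit_cat_def)

lemma orbit_cat_comp:
  assumes "t \<in> sections G" "u \<in> sections G" "g \<in> carrier G" "h \<in> carrier G" "sec_le (conj_sec G h t) u"
  shows "(fst u #> h) <#> (fst t #> g) = fst u #> (h \<otimes> g)"
  using assms sectionsD by (intro rcos_comp) (auto simp: sec_le_iff conj_sec_simps)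

lemma orbit_cat_category:
  assumes R: "cring R" and C: "\<C> \<subseteq> sections G"
  shows "category_over_ring (orbit_cat G \<C>) R"
proof (intro category_over_ring.intro R category_over_ring_axioms.intro; unfold orbit_cat_simps)
  have sub: "a \<subseteq> carrier G" if "s \<in> \<C>" "t \<in> \<C>" "a \<in> Hom (orbit_cat G \<C>) s t" for s t a
    using that(3) r_coset_subset_G[OF sectionsD(5)[OF subsetD[OF C that(2)]]] by (elim orbit_cat_HomE) blast
  note comp = orbit_cat_comp[OF subsetD[OF C] subsetD[OF C]]
  {
    fix s t u a b assume "s \<in> \<C>" "t \<in> \<C>" "u \<in> \<C>" "a \<in> Hom (orbit_cat G \<C>) s t" "b \<in> Hom (orbit_cat G \<C>) t u"
    then show "b <#> a \<in> Hom (orbit_cat G \<C>) s u"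
      using C by (elim orbit_cat_HomE) (auto simp: comp intro!: orbit_cat_HomI sec_le_conj_mult)
  next
    fix s assume "s \<in> \<C>"
    then have s: "s \<in> sections G" using C by auto
    show "fst s \<in> Hom (orbit_cat G \<C>) s s"
      using orbit_cat_HomI[of \<one> s s] s sectionsD(5)[OF s] by (simp add: conj_sec_one sec_le_refl)
  next
    fix s t u v a b c
    assume "s \<in> \<C>" "t \<in> \<C>" "u \<in> \<C>" "v \<in> \<C>" "a \<in> Hom (orbit_cat G \<C>) s t" "b \<in> Hom (orbit_cat G \<C>) t u"
      "c \<in> Hom (orbit_cat G \<C>) u v"
    then show "c <#> (b <#> a) = c <#> b <#> a"
      using sub by (intro set_mult_assoc[symmetric]) blast+
  next
    fix s t a assume st: "s \<in> \<C>" "t \<in> \<C>" "a \<in> Hom (orbit_cat G \<C>) s t"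
    then obtain g where g: "g \<in> carrier G" "sec_le (conj_sec G g s) t" "a = fst t #> g" by (elim orbit_cat_HomE)
    have S: "s \<in> sections G" "t \<in> sections G" using st C by auto
    show "a <#> fst s = a"
      using comp[OF st(1,2) one_closed g(1,2)] g sectionsD(5)[OF S(1)] by simp
    show "fst t <#> a = a"
      using comp[OF st(2,2) g(1) one_closed] g S sectionsD(5)[OF S(2)] by (simp add: conj_sec_one sec_le_refl)
  }
qed



lemma destriction_comp:
  assumes F: "destriction_functor R G F" and stu: "s \<in> sections G" "t \<in> sections G" "u \<in> sections G"
    and gh: "g \<in> carrier G" "h \<in> carrier G" "sec_le (conj_sec G g s) t" "sec_le (conj_sec G h t) u"
    and m: "m \<in> carrier (ob F u)"
  shows "ar F s t (fst t #> g) (ar F t u (fst u #> h) m) = ar F s u (fst u #> (h \<otimes> g)) m"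
  using cat_module_comp[OF F, unfolded orbit_cat_simps, OF stu orbit_cat_HomI[OF gh(1,3)] orbit_cat_HomI[OF gh(2,4)] m]
    orbit_cat_comp[OF stu(2,3) gh(1,2,4)] by simp

lemma destriction_ar:
  assumes F: "destriction_functor R G F" and "s \<in> sections G" "t \<in> sections G"
    and "g \<in> carrier G" "sec_le (conj_sec G g s) t"
  shows "ar F s t (fst t #> g) \<in> module_hom R (ob F t) (ob F s)"
  using cat_module_ar[OF F, unfolded orbit_cat_simps, OF assms(2,3) orbit_cat_HomI[OF assms(4,5)]] .

lemma destriction_ident:
  assumes F: "destriction_functor R G F" and "s \<in> sections G" "m \<in> carrier (ob F s)"
  shows "ar F s s (fst s) m = m"
  using cat_module_ident[OF F, unfolded orbit_cat_simps, OF assms(2,3)] .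

lemma norm_sec_section: "subgroup H G \<Longrightarrow> norm_sec G H \<in> sections G"
  by (simp add: norm_sec_def sections_iff normalizer_subgroup subgroup_le_normalizer)

lemma full_sec_section: "full_sec G \<in> sections G"
proof -
  have "carrier G \<subseteq> normalizer G {\<one>}" by (auto simp: mem_normalizer_iff conj_set_trivial)
  then show ?thesis by (simp add: full_sec_def sections_iff subgroup_self triv_subgroup)
qed

lemma sec_le_full: "s \<in> sections G \<Longrightarrow> sec_le s (full_sec G)"
  using sectionsD[of s] subgroup.one_closed[of "snd s" G] by (auto simp: sec_le_iff full_sec_def)

lemma sec_le_norm_sec: "s \<in> sections G \<Longrightarrow> sec_le s (norm_sec G (snd s))"
  using sectionsD[of s] by (auto simp: sec_le_iff norm_sec_def)

lemma norm_sec_conj: "g \<in> carrier G \<Longrightarrow> subgroup H G \<Longrightarrow> norm_sec G (conj_set G g H) = conj_sec G g (norm_sec G H)"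
  by (simp add: norm_sec_def conj_sec_def normalizer_conj_set)

lemma inter_norm_section:
  assumes "subgroup H G" "subgroup K G" "K \<lhd> G\<lparr>carrier := H\<rparr>"
  shows "(normalizer G H \<inter> normalizer G K, H) \<in> sections G"
    and "sec_le (normalizer G H \<inter> normalizer G K, H) (norm_sec G K)"
    and "sec_le (normalizer G H \<inter> normalizer G K, H) (norm_sec G H)"
  using assms subgroup_le_normalizer[OF assms(1)] normal_in_subgroup_iff[OF assms(1), of K]
  by (auto simp: sections_iff sec_le_iff norm_sec_def normalizer_subgroup subgroups_Inter_pair)

lemma defres_hom:
  assumes "destriction_functor R G F" "s \<in> sections G" "t \<in> sections G" "sec_le s t"
  shows "defres G F t s \<in> module_hom R (ob F t) (ob F s)"
  unfolding defres_def using destriction_ar[OF assms(1-3) one_closed] assms(2,4) by (simp add: conj_sec_one)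

lemma defres_defres:
  assumes F: "destriction_functor R G F" and "s \<in> sections G" "t \<in> sections G" "u \<in> sections G"
    and "sec_le s t" "sec_le t u" and m: "m \<in> carrier (ob F u)"
  shows "defres G F t s (defres G F u t m) = defres G F u s m"
  unfolding defres_def using destriction_comp[OF F assms(2-4) one_closed one_closed _ _ m] assms(2-6)
  by (simp add: conj_sec_one)

lemma defres_ident:
  assumes "destriction_functor R G F" "s \<in> sections G" "m \<in> carrier (ob F s)"
  shows "defres G F s s m = m"
  unfolding defres_def using destriction_ident[OF assms] sectionsD(5)[OF assms(2)] by simp

lemma conj_act_hom:
  assumes F: "destriction_functor R G F" and s: "s \<in> sections G" and g: "g \<in> carrier G"
  shows "conj_act G F g s \<in> module_hom R (ob F s) (ob F (conj_sec G g s))"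
  unfolding conj_act_def
  using g s by (intro destriction_ar[OF F] conj_sec_section)
    (simp_all add: conj_sec_mult[symmetric] conj_sec_one sec_le_refl)

section \<open>Gluing data and the limit over the proper sections\<close>

lemma nontrivial_subgroupsD: "H \<in> nontrivial_subgroups G \<Longrightarrow> subgroup H G" "H \<in> nontrivial_subgroups G \<Longrightarrow> H \<noteq> {\<one>}"
  by (auto simp: nontrivial_subgroups_def)

lemma conj_set_nontrivial:
  "g \<in> carrier G \<Longrightarrow> H \<in> nontrivial_subgroups G \<Longrightarrow> conj_set G g H \<in> nontrivial_subgroups G"
  unfolding nontrivial_subgroups_def mem_Collect_eq
  by (metis conj_set_subgroup conj_set_trivial_iff subgroup.subset)

lemma DG_star_obj: "s \<in> Obj (DG_star G) \<longleftrightarrow> s \<in> sections G \<and> snd s \<noteq> {\<one>}"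
  by (cases s) (simp add: orbit_cat_def)

lemma DG_star_snd: "s \<in> Obj (DG_star G) \<Longrightarrow> snd s \<in> nontrivial_subgroups G"
  using sectionsD(2) by (auto simp: DG_star_obj nontrivial_subgroups_def)

lemma norm_sec_DG_star: "H \<in> nontrivial_subgroups G \<Longrightarrow> norm_sec G H \<in> Obj (DG_star G)"
  by (simp add: DG_star_obj nontrivial_subgroups_def norm_sec_section) (simp add: norm_sec_def)

lemma DG_star_cat_module: "destriction_functor R G F \<Longrightarrow> cat_module R (DG_star G) F"
  by (auto simp: cat_module_def orbit_cat_def)


end

definition glue_to_lim ::
  "('g, 'l) monoid_scheme \<Rightarrow> ('g sec, 'g set, 'r, 'm) fun_data \<Rightarrow> ('g set \<Rightarrow> 'm) \<Rightarrow> 'g sec \<Rightarrow> 'm" where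
  "glue_to_lim G F f = (\<lambda>s\<in>Obj (DG_star G). defres G F (norm_sec G (snd s)) s (f (snd s)))"

context group begin

lemma gluing_module_carrier:
  "f \<in> carrier (gluing_module G F) \<longleftrightarrow>
    f \<in> (\<Pi>\<^sub>E H\<in>nontrivial_subgroups G. carrier (ob F (norm_sec G H))) \<and>
    (\<forall>g\<in>carrier G. \<forall>H\<in>nontrivial_subgroups G.
      conj_act G F g (norm_sec G H) (f H) = f (conj_set G g H)) \<and>
    (\<forall>H\<in>nontrivial_subgroups G. \<forall>K\<in>nontrivial_subgroups G. K \<lhd> G\<lparr>carrier := H\<rparr> \<longrightarrow>
      defres G F (norm_sec G K) (normalizer G H \<inter> normalizer G K, H) (f K)
        = defres G F (norm_sec G H) (normalizer G H \<inter> normalizer G K, H) (f H))"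
  by (simp add: gluing_module_def)

lemma gluing_moduleD:
  assumes "f \<in> carrier (gluing_module G F)"
  shows gluing_closed: "H \<in> nontrivial_subgroups G \<Longrightarrow> f H \<in> carrier (ob F (norm_sec G H))"
    and gluing_conj: "g \<in> carrier G \<Longrightarrow> H \<in> nontrivial_subgroups G \<Longrightarrow>
      conj_act G F g (norm_sec G H) (f H) = f (conj_set G g H)"
    and gluing_defres: "H \<in> nontrivial_subgroups G \<Longrightarrow> K \<in> nontrivial_subgroups G \<Longrightarrow> K \<lhd> G\<lparr>carrier := H\<rparr> \<Longrightarrow>
      defres G F (norm_sec G K) (normalizer G H \<inter> normalizer G K, H) (f K)
        = defres G F (norm_sec G H) (normalizer G H \<inter> normalizer G K, H) (f H)"
  using assms unfolding gluing_module_carrier by auto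

lemma gluing_module_ops:
  assumes "H \<in> nontrivial_subgroups G"
  shows "\<zero>\<^bsub>gluing_module G F\<^esub> H = \<zero>\<^bsub>ob F (norm_sec G H)\<^esub>"
    and "(f \<oplus>\<^bsub>gluing_module G F\<^esub> f') H = f H \<oplus>\<^bsub>ob F (norm_sec G H)\<^esub> f' H"
    and "(r \<odot>\<^bsub>gluing_module G F\<^esub> f) H = r \<odot>\<^bsub>ob F (norm_sec G H)\<^esub> f H"
  using assms by (simp_all add: gluing_module_def prod_module_def)

lemma gluing_module_module:
  assumes R: "cring R" and F: "destriction_functor R G F"
  shows "module R (gluing_module G F)"
proof -
  let ?N = "nontrivial_subgroups G"
  let ?P = "prod_module ?N (\<lambda>H. ob F (norm_sec G H))"
  have ns: "norm_sec G H \<in> sections G" if "H \<in> ?N" for H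
    using norm_sec_section nontrivial_subgroupsD(1)[OF that] by blast
  have mod: "module R (ob F s)" if "s \<in> sections G" for s
    using cat_module_ob[OF F] that by (simp add: orbit_cat_simps)
  interpret P: module R ?P by (intro prod_module_module R mod ns)
  have ch: "conj_act G F g (norm_sec G H) \<in> module_hom R (ob F (norm_sec G H)) (ob F (norm_sec G (conj_set G g H)))"
    if "g \<in> carrier G" "H \<in> ?N" for g H
    using conj_act_hom[OF F ns[OF that(2)] that(1)] norm_sec_conj[OF that(1) nontrivial_subgroupsD(1)[OF that(2)]]
    by simp
  have dh: "defres G F (norm_sec G K) (normalizer G H \<inter> normalizer G K, H)
        \<in> module_hom R (ob F (norm_sec G K)) (ob F (normalizer G H \<inter> normalizer G K, H))"
      "defres G F (norm_sec G H) (normalizer G H \<inter> normalizer G K, H)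
        \<in> module_hom R (ob F (norm_sec G H)) (ob F (normalizer G H \<inter> normalizer G K, H))"
      "module R (ob F (normalizer G H \<inter> normalizer G K, H))"
    if "H \<in> ?N" "K \<in> ?N" "K \<lhd> G\<lparr>carrier := H\<rparr>" for H K
    using inter_norm_section[OF nontrivial_subgroupsD(1)[OF that(1)] nontrivial_subgroupsD(1)[OF that(2)] that(3)] that ns mod
    by (auto intro!: defres_hom[OF F])
  let ?S = "{f \<in> \<Pi>\<^sub>E H\<in>?N. carrier (ob F (norm_sec G H)).
    (\<forall>g\<in>carrier G. \<forall>H\<in>?N. conj_act G F g (norm_sec G H) (f H) = f (conj_set G g H)) \<and>
    (\<forall>H\<in>?N. \<forall>K\<in>?N. K \<lhd> G\<lparr>carrier := H\<rparr> \<longrightarrow>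
      defres G F (norm_sec G K) (normalizer G H \<inter> normalizer G K, H) (f K)
        = defres G F (norm_sec G H) (normalizer G H \<inter> normalizer G K, H) (f H))}"
  have ops: "\<zero>\<^bsub>?P\<^esub> H = \<zero>\<^bsub>ob F (norm_sec G H)\<^esub>"
      "(f \<oplus>\<^bsub>?P\<^esub> f') H = f H \<oplus>\<^bsub>ob F (norm_sec G H)\<^esub> f' H"
      "(r \<odot>\<^bsub>?P\<^esub> f) H = r \<odot>\<^bsub>ob F (norm_sec G H)\<^esub> f H" if "H \<in> ?N" for H f f' r
    using that by (simp_all add: prod_module_def)
  have PiE: "f \<in> carrier ?P \<longleftrightarrow> f \<in> (\<Pi>\<^sub>E H\<in>?N. carrier (ob F (norm_sec G H)))" for f
    by (simp add: prod_module_def)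
  have "submodule ?S R ?P"
  proof (rule P.submoduleI_linear)
    show "?S \<subseteq> carrier ?P" using PiE by blast
    show "\<zero>\<^bsub>?P\<^esub> \<in> ?S"
      using P.zero_closed module_hom_zero[OF mod[OF ns] mod[OF ns[OF conj_set_nontrivial]] ch]
        module_hom_zero[OF mod[OF ns] dh(3) dh(1)] module_hom_zero[OF mod[OF ns] dh(3) dh(2)]
      by (simp add: ops PiE conj_set_nontrivial)
    fix f assume f: "f \<in> ?S"
    then have fc: "f H \<in> carrier (ob F (norm_sec G H))" if "H \<in> ?N" for H using that by auto
    {
      fix f' assume f': "f' \<in> ?S"
      then have fc': "f' H \<in> carrier (ob F (norm_sec G H))" if "H \<in> ?N" for H using that by auto
      have "f \<oplus>\<^bsub>?P\<^esub> f' \<in> carrier ?P" using f f' by (intro P.a_closed) (simp_all add: PiE)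
      then show "f \<oplus>\<^bsub>?P\<^esub> f' \<in> ?S"
        using f f' by (simp add: ops PiE conj_set_nontrivial module_hom_add[OF ch] module_hom_add[OF dh(1)]
            module_hom_add[OF dh(2)] fc fc')
    }
    fix r assume r: "r \<in> carrier R"
    have "r \<odot>\<^bsub>?P\<^esub> f \<in> carrier ?P" using f r by (intro P.smult_closed) (simp_all add: PiE)
    then show "r \<odot>\<^bsub>?P\<^esub> f \<in> ?S"
      using f r by (simp add: ops PiE conj_set_nontrivial module_hom_smult[OF ch] module_hom_smult[OF dh(1)]
          module_hom_smult[OF dh(2)] fc)
  qed
  then show ?thesis
    unfolding gluing_module_def by (rule submodule_carrier_module[OF P.module_axioms])
qed

text \<open>Why a gluing datum is compatible with an arbitrary morphism \<open>Mg : (U, V) \<rightarrow> (M, L)\<close>: \<open>L\<close> is normal in the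
  conjugate \<open>V'\<close> of \<open>V\<close>, because \<open>V' \<le> M \<le> N(L)\<close>, so the second gluing condition relates the members at \<open>L\<close> and \<open>V'\<close>
  over \<open>N(V') \<inter> N(L)\<close>, which contains the conjugate of \<open>U\<close>; the first condition moves from \<open>V'\<close> back to \<open>V\<close>.\<close>

lemma gluing_natural:
  assumes F: "destriction_functor R G F" and f: "f \<in> carrier (gluing_module G F)"
    and s: "s \<in> Obj (DG_star G)" and t: "t \<in> Obj (DG_star G)"
    and g: "g \<in> carrier G" and le: "sec_le (conj_sec G g s) t"
  shows "ar F s t (fst t #> g) (defres G F (norm_sec G (snd t)) t (f (snd t))) =
    defres G F (norm_sec G (snd s)) s (f (snd s))"
proof -
  define L where "L = snd t"
  define V where "V = snd s"
  define V' where "V' = conj_set G g V"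
  \<comment> \<open>The section over which the second gluing condition compares the members at \<open>L\<close> and at \<open>V'\<close>.\<close>
  define w where "w = (normalizer G V' \<inter> normalizer G L, V')"
  note S = s[unfolded DG_star_obj, THEN conjunct1] t[unfolded DG_star_obj, THEN conjunct1]
  have N: "V \<in> nontrivial_subgroups G" "L \<in> nontrivial_subgroups G"
    using DG_star_snd s t by (auto simp: V_def L_def)
  then have N': "V' \<in> nontrivial_subgroups G" unfolding V'_def by (intro conj_set_nontrivial g)
  note sg = nontrivial_subgroupsD(1)[OF N(1)] nontrivial_subgroupsD(1)[OF N(2)] nontrivial_subgroupsD(1)[OF N']
  note ns = norm_sec_section[OF sg(1)] norm_sec_section[OF sg(2)] norm_sec_section[OF sg(3)]
  have le': "L \<subseteq> V'" "V' \<subseteq> fst t" "conj_set G g (fst s) \<subseteq> fst t"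
    using le conj_set_mono[OF sectionsD(3)[OF S(1)], of g]
    by (auto simp: sec_le_iff conj_sec_simps L_def V'_def V_def)
  have tN: "fst t \<subseteq> normalizer G L" using sectionsD(4)[OF S(2)] by (simp add: L_def)
  have normal: "L \<lhd> G\<lparr>carrier := V'\<rparr>"
    using le' tN sg by (simp add: normal_in_subgroup_iff)
  have w: "w \<in> sections G" "sec_le w (norm_sec G L)" "sec_le w (norm_sec G V')"
    unfolding w_def by (rule inter_norm_section[OF sg(3,2) normal])+
  have "conj_set G g (fst s) \<subseteq> normalizer G V'"
    using sectionsD(4)[OF conj_sec_section[OF g S(1)]] by (simp add: conj_sec_simps V'_def V_def)
  then have sw: "sec_le (conj_sec G g s) w"
    using le' tN conj_set_mono[OF sectionsD(3)[OF S(1)], of g]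
    by (auto simp: sec_le_iff conj_sec_simps w_def V'_def V_def)
  have tL: "sec_le t (norm_sec G L)" using sec_le_norm_sec[OF S(2)] by (simp add: L_def)
  have V'_conj: "f V' = ar F (norm_sec G V') (norm_sec G V) (fst (norm_sec G V) #> inv g) (f V)"
    using gluing_conj[OF f g N(1)] norm_sec_conj[OF g sg(1)] by (simp add: conj_act_def V'_def)
  have invle: "sec_le (conj_sec G (inv g) (norm_sec G V')) (norm_sec G V)"
    using ns(1) g unfolding V'_def norm_sec_conj[OF g sg(1)]
    by (simp add: conj_sec_mult[symmetric] conj_sec_one sec_le_refl)
  have "ar F s t (fst t #> g) (defres G F (norm_sec G L) t (f L)) = ar F s (norm_sec G L) (fst (norm_sec G L) #> g) (f L)"
    unfolding defres_def using destriction_comp[OF F S ns(2) g one_closed le _ gluing_closed[OF f N(2)]] tL S g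
    by (simp add: conj_sec_one)
  also have "\<dots> = ar F s w (fst w #> g) (defres G F (norm_sec G L) w (f L))"
    unfolding defres_def using destriction_comp[OF F S(1) w(1) ns(2) g one_closed sw _ gluing_closed[OF f N(2)]] w g
    by (simp add: conj_sec_one)
  also have "defres G F (norm_sec G L) w (f L) = defres G F (norm_sec G V') w (f V')"
    unfolding w_def by (rule gluing_defres[OF f N' N(2) normal])
  also have "ar F s w (fst w #> g) (defres G F (norm_sec G V') w (f V')) =
      ar F s (norm_sec G V') (fst (norm_sec G V') #> g) (f V')"
    unfolding defres_def using destriction_comp[OF F S(1) w(1) ns(3) g one_closed sw _ gluing_closed[OF f N']] w g
    by (simp add: conj_sec_one)
  also have "\<dots> = ar F s (norm_sec G V) (fst (norm_sec G V) #> (inv g \<otimes> g)) (f V)"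
    unfolding V'_conj
    by (rule destriction_comp[OF F S(1) ns(3,1) g inv_closed[OF g] sec_le_trans[OF sw w(3)] invle gluing_closed[OF f N(1)]])
  also have "\<dots> = defres G F (norm_sec G V) s (f V)" using g by (simp add: defres_def)
  finally show ?thesis by (simp add: L_def V_def)
qed

lemma glue_to_lim_closed:
  assumes F: "destriction_functor R G F" and f: "f \<in> carrier (gluing_module G F)"
  shows "glue_to_lim G F f \<in> carrier (lim_module (DG_star G) F)"
  unfolding lim_module_carrier
proof (intro conjI ballI)
  have "defres G F (norm_sec G (snd s)) s (f (snd s)) \<in> carrier (ob F s)" if s: "s \<in> Obj (DG_star G)" for s
  proof -
    have S: "s \<in> sections G" using s by (simp add: DG_star_obj)
    show ?thesis
      by (rule module_hom_closed[OF defres_hom[OF F S norm_sec_section[OF sectionsD(2)[OF S]] sec_le_norm_sec[OF S]]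
            gluing_closed[OF f DG_star_snd[OF s]]])
  qed
  then show "glue_to_lim G F f \<in> (\<Pi>\<^sub>E s\<in>Obj (DG_star G). carrier (ob F s))" by (auto simp: glue_to_lim_def)
  fix s t a assume st: "s \<in> Obj (DG_star G)" "t \<in> Obj (DG_star G)" "a \<in> Hom (DG_star G) s t"
  from st(3) obtain g where "g \<in> carrier G" "sec_le (conj_sec G g s) t" "a = fst t #> g" by (elim orbit_cat_HomE)
  with gluing_natural[OF F f st(1,2)] show "ar F s t a (glue_to_lim G F f t) = glue_to_lim G F f s"
    using st by (simp add: glue_to_lim_def)
qed

lemma lim_defres:
  assumes v: "v \<in> carrier (lim_module (DG_star G) F)" and s: "s \<in> Obj (DG_star G)" and t: "t \<in> Obj (DG_star G)"
    and le: "sec_le s t"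
  shows "defres G F t s (v t) = v s"
proof -
  have "fst t #> \<one> \<in> Hom (DG_star G) s t"
    using s le by (intro orbit_cat_HomI) (auto simp: conj_sec_one DG_star_obj)
  then show ?thesis using v s t unfolding lim_module_carrier defres_def by blast
qed

lemma lim_to_glue_closed:
  assumes v: "v \<in> carrier (lim_module (DG_star G) F)"
  shows "(\<lambda>H\<in>nontrivial_subgroups G. v (norm_sec G H)) \<in> carrier (gluing_module G F)"
  unfolding gluing_module_carrier
proof (intro conjI ballI impI)
  show "(\<lambda>H\<in>nontrivial_subgroups G. v (norm_sec G H)) \<in> (\<Pi>\<^sub>E H\<in>nontrivial_subgroups G. carrier (ob F (norm_sec G H)))"
    using v norm_sec_DG_star by (auto simp: lim_module_carrier PiE_iff)
next
  fix g H assume g: "g \<in> carrier G" and H: "H \<in> nontrivial_subgroups G"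
  note H' = conj_set_nontrivial[OF g H] and sg = nontrivial_subgroupsD(1)[OF H]
  have eq: "norm_sec G (conj_set G g H) = conj_sec G g (norm_sec G H)" by (rule norm_sec_conj[OF g sg])
  have "fst (norm_sec G H) #> inv g \<in> Hom (DG_star G) (norm_sec G (conj_set G g H)) (norm_sec G H)"
    using g norm_sec_section[OF sg] unfolding eq
    by (intro orbit_cat_HomI) (simp_all add: conj_sec_mult[symmetric] conj_sec_one sec_le_refl)
  then show "conj_act G F g (norm_sec G H) ((\<lambda>H\<in>nontrivial_subgroups G. v (norm_sec G H)) H) =
      (\<lambda>H\<in>nontrivial_subgroups G. v (norm_sec G H)) (conj_set G g H)"
    using v norm_sec_DG_star[OF H] norm_sec_DG_star[OF H'] H H'
    by (auto simp: lim_module_carrier conj_act_def eq)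
next
  fix H K assume H: "H \<in> nontrivial_subgroups G" and K: "K \<in> nontrivial_subgroups G" and n: "K \<lhd> G\<lparr>carrier := H\<rparr>"
  note w = inter_norm_section[OF nontrivial_subgroupsD(1)[OF H] nontrivial_subgroupsD(1)[OF K] n]
  have "(normalizer G H \<inter> normalizer G K, H) \<in> Obj (DG_star G)"
    using w(1) nontrivial_subgroupsD(2)[OF H] by (simp add: DG_star_obj)
  then show "defres G F (norm_sec G K) (normalizer G H \<inter> normalizer G K, H) ((\<lambda>H\<in>nontrivial_subgroups G. v (norm_sec G H)) K) =
      defres G F (norm_sec G H) (normalizer G H \<inter> normalizer G K, H) ((\<lambda>H\<in>nontrivial_subgroups G. v (norm_sec G H)) H)"
    using H K w lim_defres[OF v _ norm_sec_DG_star] by simp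
qed

lemma lim_module_ops:
  assumes "s \<in> Obj (DG_star G)"
  shows "(v \<oplus>\<^bsub>lim_module (DG_star G) F\<^esub> w) s = v s \<oplus>\<^bsub>ob F s\<^esub> w s"
    and "(r \<odot>\<^bsub>lim_module (DG_star G) F\<^esub> v) s = r \<odot>\<^bsub>ob F s\<^esub> v s"
  using assms by (simp_all add: lim_module_def prod_module_def)

lemma lim_module_eqI:
  assumes "v \<in> carrier (lim_module C F)" "w \<in> carrier (lim_module C F)" "\<And>s. s \<in> Obj C \<Longrightarrow> v s = w s"
  shows "v = w"
  using assms unfolding lim_module_carrier by (intro extensionalityI[of _ "Obj C"]) (auto simp: PiE_iff)

lemma gluing_module_eqI:
  assumes "f \<in> carrier (gluing_module G F)" "f' \<in> carrier (gluing_module G F)"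
    "\<And>H. H \<in> nontrivial_subgroups G \<Longrightarrow> f H = f' H"
  shows "f = f'"
  using assms unfolding gluing_module_carrier by (intro extensionalityI[of _ "nontrivial_subgroups G"]) (auto simp: PiE_iff)

text \<open>The inverse takes a family to its members at the sections \<open>(N(H), H)\<close>. It recovers the family because
  every section \<open>(U, V)\<close> lies below \<open>(N(V), V)\<close>.\<close>

theorem glue_to_lim_iso:
  assumes R: "cring R" and F: "destriction_functor R G F"
  shows "glue_to_lim G F \<in> module_iso R (gluing_module G F) (lim_module (DG_star G) F)"
  unfolding module_iso_def
proof (intro CollectI conjI)
  interpret L: module R "lim_module (DG_star G) F" by (rule lim_module_module[OF R DG_star_cat_module[OF F]])
  interpret M: module R "gluing_module G F" by (rule gluing_module_module[OF R F])
  note closed = glue_to_lim_closed[OF F]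
  have eq: "glue_to_lim G F f s = defres G F (norm_sec G (snd s)) s (f (snd s))" if "s \<in> Obj (DG_star G)" for f s
    using that by (simp add: glue_to_lim_def)
  have hom: "defres G F (norm_sec G (snd s)) s \<in> module_hom R (ob F (norm_sec G (snd s))) (ob F s)"
    if "s \<in> Obj (DG_star G)" for s
    using that by (intro defres_hom[OF F]) (auto simp: DG_star_obj sec_le_norm_sec intro!: norm_sec_section sectionsD)
  show "glue_to_lim G F \<in> module_hom R (gluing_module G F) (lim_module (DG_star G) F)"
  proof (rule module_homI)
    fix f f' r assume f: "f \<in> carrier (gluing_module G F)"
    show "glue_to_lim G F f \<in> carrier (lim_module (DG_star G) F)" by (rule closed[OF f])
    show "glue_to_lim G F (f \<oplus>\<^bsub>gluing_module G F\<^esub> f') = glue_to_lim G F f \<oplus>\<^bsub>lim_module (DG_star G) F\<^esub> glue_to_lim G F f'"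
      if f': "f' \<in> carrier (gluing_module G F)"
      by (rule lim_module_eqI[OF closed[OF M.a_closed[OF f f']] L.a_closed[OF closed[OF f] closed[OF f']]])
        (simp add: eq lim_module_ops gluing_module_ops DG_star_snd module_hom_add[OF hom]
          gluing_closed[OF f] gluing_closed[OF f'])
    show "glue_to_lim G F (r \<odot>\<^bsub>gluing_module G F\<^esub> f) = r \<odot>\<^bsub>lim_module (DG_star G) F\<^esub> glue_to_lim G F f"
      if r: "r \<in> carrier R"
      by (rule lim_module_eqI[OF closed[OF M.smult_closed[OF r f]] L.smult_closed[OF r closed[OF f]]])
        (simp add: eq lim_module_ops gluing_module_ops DG_star_snd module_hom_smult[OF hom] r gluing_closed[OF f])
  qed
  show "bij_betw (glue_to_lim G F) (carrier (gluing_module G F)) (carrier (lim_module (DG_star G) F))"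
  proof (rule bij_betw_byWitness[where f' = "\<lambda>v. \<lambda>H\<in>nontrivial_subgroups G. v (norm_sec G H)"])
    show "\<forall>f\<in>carrier (gluing_module G F). (\<lambda>H\<in>nontrivial_subgroups G. glue_to_lim G F f (norm_sec G H)) = f"
    proof
      fix f assume f: "f \<in> carrier (gluing_module G F)"
      show "(\<lambda>H\<in>nontrivial_subgroups G. glue_to_lim G F f (norm_sec G H)) = f"
      proof (rule gluing_module_eqI[OF lim_to_glue_closed[OF closed[OF f]] f])
        fix H assume H: "H \<in> nontrivial_subgroups G"
        have "glue_to_lim G F f (norm_sec G H) = defres G F (norm_sec G H) (norm_sec G H) (f H)"
          using eq[OF norm_sec_DG_star[OF H]] by (simp add: norm_sec_def)
        then show "(\<lambda>H\<in>nontrivial_subgroups G. glue_to_lim G F f (norm_sec G H)) H = f H"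
          using H defres_ident[OF F norm_sec_section[OF nontrivial_subgroupsD(1)[OF H]] gluing_closed[OF f H]] by simp
      qed
    qed
    show "\<forall>v\<in>carrier (lim_module (DG_star G) F). glue_to_lim G F (\<lambda>H\<in>nontrivial_subgroups G. v (norm_sec G H)) = v"
    proof
      fix v assume v: "v \<in> carrier (lim_module (DG_star G) F)"
      show "glue_to_lim G F (\<lambda>H\<in>nontrivial_subgroups G. v (norm_sec G H)) = v"
      proof (rule lim_module_eqI[OF closed[OF lim_to_glue_closed[OF v]] v])
        fix s assume s: "s \<in> Obj (DG_star G)"
        then show "glue_to_lim G F (\<lambda>H\<in>nontrivial_subgroups G. v (norm_sec G H)) s = v s"
          using lim_defres[OF v s norm_sec_DG_star[OF DG_star_snd[OF s]]]
          by (simp add: eq DG_star_snd sec_le_norm_sec DG_star_obj)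
      qed
    qed
  qed (use closed lim_to_glue_closed in auto)
qed

lemma gluing_map_eq:
  "H \<in> nontrivial_subgroups G \<Longrightarrow> gluing_map G F m H = defres G F (full_sec G) (norm_sec G H) m"
  by (simp add: gluing_map_def)

lemma glue_to_lim_gluing_map:
  assumes F: "destriction_functor R G F" and m: "m \<in> carrier (ob F (full_sec G))"
  shows "glue_to_lim G F (gluing_map G F m) = lim_map G F m"
proof
  fix s
  show "glue_to_lim G F (gluing_map G F m) s = lim_map G F m s"
  proof (cases "s \<in> Obj (DG_star G)")
    case True
    then have S: "s \<in> sections G" by (simp add: DG_star_obj)
    note N = norm_sec_section[OF sectionsD(2)[OF S]]
    show ?thesis
      using True defres_defres[OF F S N full_sec_section sec_le_norm_sec[OF S] sec_le_full[OF N] m]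
      by (simp add: glue_to_lim_def lim_map_def gluing_map_eq DG_star_snd)
  qed (simp add: glue_to_lim_def lim_map_def)
qed

lemma gluing_map_closed:
  assumes F: "destriction_functor R G F" and m: "m \<in> carrier (ob F (full_sec G))"
  shows "gluing_map G F m \<in> carrier (gluing_module G F)"
proof -
  have "lim_map G F m \<in> carrier (lim_module (DG_star G) F)"
    unfolding lim_module_carrier
  proof (intro conjI ballI)
    show "lim_map G F m \<in> (\<Pi>\<^sub>E s\<in>Obj (DG_star G). carrier (ob F s))"
      using m by (auto simp: lim_map_def DG_star_obj sec_le_full
          intro!: module_hom_closed[OF defres_hom[OF F _ full_sec_section]])
    fix s t a assume st: "s \<in> Obj (DG_star G)" "t \<in> Obj (DG_star G)" "a \<in> Hom (DG_star G) s t"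
    from st(3) obtain g where g: "g \<in> carrier G" "sec_le (conj_sec G g s) t" "a = fst t #> g" by (elim orbit_cat_HomE)
    have S: "s \<in> sections G" "t \<in> sections G" using st by (auto simp: DG_star_obj)
    have "ar F s t a (defres G F (full_sec G) t m) = ar F s (full_sec G) (fst (full_sec G) #> (\<one> \<otimes> g)) m"
      unfolding defres_def g(3)
      using S sec_le_full[OF S(2)] by (intro destriction_comp[OF F S full_sec_section g(1) one_closed g(2) _ m]) (simp add: conj_sec_one)
    also have "fst (full_sec G) #> (\<one> \<otimes> g) = fst (full_sec G) #> \<one>"
      using g(1) coset_join2[OF g(1) subgroup_self g(1)] by (simp add: full_sec_def)
    finally show "ar F s t a (lim_map G F m t) = lim_map G F m s"
      using st by (simp add: lim_map_def defres_def)
  qed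
  from lim_to_glue_closed[OF this] show ?thesis
    by (simp add: lim_map_def gluing_map_def norm_sec_DG_star cong: restrict_cong)
qed

end

section \<open>The theorem for destriction functors\<close>

context group begin

lemma DG_terminal_sieve:
  assumes R: "cring R"
  shows "terminal_sieve (DG G) R (full_sec G) {s. snd s \<noteq> {\<one>}}"
proof (intro terminal_sieve.intro terminal_sieve_axioms.intro orbit_cat_category[OF R] subset_refl; (unfold orbit_cat_simps)?)
  show "full_sec G \<in> sections G" by (rule full_sec_section)
  show "full_sec G \<notin> {s. snd s \<noteq> {\<one>}}" by (simp add: full_sec_def)
  show "\<exists>a. Hom (DG G) s (full_sec G) = {a}" if s: "s \<in> sections G" for s
  proof (intro exI equalityI subsetI)
    fix a assume "a \<in> Hom (DG G) s (full_sec G)"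
    then show "a \<in> {carrier G}"
      by (elim orbit_cat_HomE) (simp add: full_sec_def coset_join2 subgroup_self)
  next
    fix a assume "a \<in> {carrier G}"
    then show "a \<in> Hom (DG G) s (full_sec G)"
      using orbit_cat_HomI[of \<one> s "full_sec G"] s sec_le_full[OF s]
      by (simp add: conj_sec_one) (simp add: full_sec_def coset_join2 subgroup_self)
  qed
  show "s \<in> {s. snd s \<noteq> {\<one>}}"
    if st: "s \<in> sections G" "t \<in> sections G" "a \<in> Hom (DG G) s t" "t \<in> {s. snd s \<noteq> {\<one>}}" for s t a
  proof -
    from st(3) obtain g where g: "g \<in> carrier G" "sec_le (conj_sec G g s) t" by (elim orbit_cat_HomE)
    have "snd t \<subseteq> conj_set G g (snd s)" using g(2) by (simp add: sec_le_iff conj_sec_simps)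
    moreover have "\<one> \<in> snd t" using subgroup.one_closed[OF sectionsD(2)[OF st(2)]] .
    ultimately have "snd s \<noteq> {\<one>}" using st(4) conj_set_trivial[OF g(1)] by auto
    then show ?thesis by simp
  qed
qed

text \<open>The map from \<open>F(G)\<close> to \<open>F(U/V)\<close> passes through \<open>F(N(V)/V)\<close>. So an element of \<open>F(G)\<close> dies on all sections with
  \<open>V \<noteq> 1\<close> exactly if its gluing datum is zero, and a gluing datum comes from \<open>F(G)\<close> exactly if its family on
  these sections does.\<close>

theorem destriction_gluing_ext:
  assumes R: "cring R" and F: "destriction_functor R G F"
  shows "module_isomorphic R (Obs G F) (Ext1 R (DG G) (T_functor R G) F)"
    and "module_isomorphic R (gluing_kernel G F) (nat_module R (DG G) (T_functor R G) F)"
proof -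
  let ?D = "{s. snd s \<noteq> {\<one>}}" and ?e = "full_sec G"
  interpret S: terminal_sieve "DG G" R ?e ?D by (rule DG_terminal_sieve[OF R])
  have T: "S.T = T_functor R G"
    unfolding S.T_def T_functor_def
    by (rule arg_cong[of _ _ "quot_functor (const_functor R)"]) (simp add: fun_eq_iff)
  have "sections G \<inter> ?D = {(U, V) \<in> sections G. V \<noteq> {\<one>}}"
    by (rule Set.set_eqI) (simp add: split_beta)
  then have sub: "(DG G)\<lparr>Obj := sections G \<inter> ?D\<rparr> = DG_star G" by (simp add: orbit_cat_def)
  have obj: "s \<in> sections G \<inter> ?D \<longleftrightarrow> s \<in> Obj (DG_star G)" for s
    by (simp add: DG_star_obj)
  have to_terminal: "ar F s ?e (S.to_terminal s) m = defres G F ?e s m" if "s \<in> sections G" for s m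
  proof -
    have "fst ?e #> \<one> \<in> Hom (DG G) s ?e"
      using that sec_le_full[OF that] by (intro orbit_cat_HomI) (simp_all add: conj_sec_one)
    then show ?thesis using S.to_terminal_unique[of s] that by (simp add: defres_def orbit_cat_simps)
  qed
  interpret L: module R "lim_module (DG_star G) F" by (rule lim_module_module[OF R DG_star_cat_module[OF F]])
  interpret M: module R "gluing_module G F" by (rule gluing_module_module[OF R F])
  have ext: "module R (Ext1 R (DG G) (T_functor R G) F)"
    using S.ext_module[OF S.T_cat_module F] by (simp add: T)
  note iso = glue_to_lim_iso[OF R F]
  then have hom: "glue_to_lim G F \<in> module_hom R (gluing_module G F) (lim_module (DG_star G) F)"
    and bij: "bij_betw (glue_to_lim G F) (carrier (gluing_module G F)) (carrier (lim_module (DG_star G) F))"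
    by (auto simp: module_iso_def)
  have "S.cone_kernel F = carrier (gluing_kernel G F)"
  proof -
    have "(\<forall>s\<in>sections G \<inter> ?D. defres G F ?e s m = \<zero>\<^bsub>ob F s\<^esub>) \<longleftrightarrow>
        gluing_map G F m = \<zero>\<^bsub>gluing_module G F\<^esub>" if m: "m \<in> carrier (ob F ?e)" for m
    proof
      assume z: "\<forall>s\<in>sections G \<inter> ?D. defres G F ?e s m = \<zero>\<^bsub>ob F s\<^esub>"
      show "gluing_map G F m = \<zero>\<^bsub>gluing_module G F\<^esub>"
      proof (rule gluing_module_eqI[OF gluing_map_closed[OF F m] M.zero_closed])
        fix H assume H: "H \<in> nontrivial_subgroups G"
        have "defres G F ?e (norm_sec G H) m = \<zero>\<^bsub>ob F (norm_sec G H)\<^esub>"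
          by (rule bspec[OF z obj[THEN iffD2, OF norm_sec_DG_star[OF H]]])
        then show "gluing_map G F m H = \<zero>\<^bsub>gluing_module G F\<^esub> H"
          unfolding gluing_map_eq[OF H] gluing_module_ops(1)[OF H] .
      qed
    next
      assume z: "gluing_map G F m = \<zero>\<^bsub>gluing_module G F\<^esub>"
      show "\<forall>s\<in>sections G \<inter> ?D. defres G F ?e s m = \<zero>\<^bsub>ob F s\<^esub>"
      proof
        fix s assume "s \<in> sections G \<inter> ?D"
        then have s: "s \<in> sections G" "s \<in> Obj (DG_star G)" unfolding obj by (simp_all add: DG_star_obj)
        note H = DG_star_snd[OF s(2)]
        note N = norm_sec_section[OF nontrivial_subgroupsD(1)[OF H]]
        have mod: "module R (ob F t)" if "t \<in> sections G" for t
          using cat_module_ob[OF F] that by (simp add: orbit_cat_simps)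
        have "defres G F ?e s m = defres G F (norm_sec G (snd s)) s (gluing_map G F m (snd s))"
          using defres_defres[OF F s(1) N full_sec_section sec_le_norm_sec[OF s(1)] sec_le_full[OF N] m] H
          by (simp add: gluing_map_eq)
        then show "defres G F ?e s m = \<zero>\<^bsub>ob F s\<^esub>"
          using module_hom_zero[OF mod[OF N] mod[OF s(1)] defres_hom[OF F s(1) N sec_le_norm_sec[OF s(1)]]] H
          by (simp add: z gluing_module_ops)
      qed
    qed
    then show ?thesis
      by (auto simp: S.cone_kernel_def gluing_kernel_def to_terminal orbit_cat_simps)
  qed
  then show "module_isomorphic R (gluing_kernel G F) (nat_module R (DG G) (T_functor R G) F)"
    using S.hom_T_isomorphic[OF F] by (simp add: T gluing_kernel_def)
  obtain q where q: "q \<in> module_hom R (lim_module (DG_star G) F) (Ext1 R (DG G) (T_functor R G) F)"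
    and surj_ker: "q ` carrier (lim_module (DG_star G) F) = carrier (Ext1 R (DG G) (T_functor R G) F) \<and>
      (\<forall>v\<in>carrier (lim_module (DG_star G) F). q v = \<zero>\<^bsub>Ext1 R (DG G) (T_functor R G) F\<^esub> \<longleftrightarrow>
        (\<exists>m\<in>carrier (ob F ?e). \<forall>s\<in>sections G \<inter> ?D. v s = ar F s ?e (S.to_terminal s) m))"
    by (rule bexE[OF S.ext_T_presentation[OF F, unfolded T orbit_cat_simps sub]])
  note surj = conjunct1[OF surj_ker] and ker = bspec[OF conjunct2[OF surj_ker]]
  show "module_isomorphic R (Obs G F) (Ext1 R (DG G) (T_functor R G) F)"
    unfolding Obs_def
  proof (rule quot_module_kernel_isomorphic[OF M.module_axioms ext module_hom_compose[OF hom q]])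
    show "(\<lambda>f. q (glue_to_lim G F f)) ` carrier (gluing_module G F) = carrier (Ext1 R (DG G) (T_functor R G) F)"
      using surj bij by (simp add: bij_betw_def image_image[symmetric])
    show "gluing_map G F ` carrier (ob F ?e) \<subseteq> carrier (gluing_module G F)"
      using gluing_map_closed[OF F] by auto
    fix f assume f: "f \<in> carrier (gluing_module G F)"
    note v = module_hom_closed[OF hom f]
    have "q (glue_to_lim G F f) = \<zero>\<^bsub>Ext1 R (DG G) (T_functor R G) F\<^esub> \<longleftrightarrow>
        (\<exists>m\<in>carrier (ob F ?e). glue_to_lim G F f = glue_to_lim G F (gluing_map G F m))"
    proof -
      have "(\<forall>s\<in>sections G \<inter> ?D. glue_to_lim G F f s = ar F s ?e (S.to_terminal s) m) \<longleftrightarrow>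
          glue_to_lim G F f = glue_to_lim G F (gluing_map G F m)" if m: "m \<in> carrier (ob F ?e)" for m
      proof
        assume eq: "\<forall>s\<in>sections G \<inter> ?D. glue_to_lim G F f s = ar F s ?e (S.to_terminal s) m"
        show "glue_to_lim G F f = glue_to_lim G F (gluing_map G F m)"
        proof (rule lim_module_eqI[OF v module_hom_closed[OF hom gluing_map_closed[OF F m]]])
          fix s assume s: "s \<in> Obj (DG_star G)"
          then show "glue_to_lim G F f s = glue_to_lim G F (gluing_map G F m) s"
            using eq obj[of s] to_terminal[of s m] by (simp add: glue_to_lim_gluing_map[OF F m] lim_map_def)
        qed
      next
        assume eq: "glue_to_lim G F f = glue_to_lim G F (gluing_map G F m)"
        show "\<forall>s\<in>sections G \<inter> ?D. glue_to_lim G F f s = ar F s ?e (S.to_terminal s) m"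
        proof
          fix s assume s: "s \<in> sections G \<inter> ?D"
          then have "s \<in> Obj (DG_star G)" unfolding obj .
          then show "glue_to_lim G F f s = ar F s ?e (S.to_terminal s) m"
            using s by (simp add: eq glue_to_lim_gluing_map[OF F m] lim_map_def to_terminal)
        qed
      qed
      then show ?thesis using ker[OF v] by blast
    qed
    also have "\<dots> \<longleftrightarrow> (\<exists>m\<in>carrier (ob F ?e). f = gluing_map G F m)"
      using bij f gluing_map_closed[OF F] by (auto simp: bij_betw_def inj_on_eq_iff)
    finally show "q (glue_to_lim G F f) = \<zero>\<^bsub>Ext1 R (DG G) (T_functor R G) F\<^esub> \<longleftrightarrow>
        f \<in> gluing_map G F ` carrier (ob F ?e)" by blast
  qed
qed

end

section \<open>Bisets\<close>

lemma fin_bisetD: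
  assumes "fin_biset K H X"
  shows fin_biset_finite: "finite (pts X)"
    and lact_closed: "k \<in> carrier K \<Longrightarrow> x \<in> pts X \<Longrightarrow> lact X k x \<in> pts X"
    and lact_one: "x \<in> pts X \<Longrightarrow> lact X \<one>\<^bsub>K\<^esub> x = x"
    and lact_mult: "k \<in> carrier K \<Longrightarrow> k' \<in> carrier K \<Longrightarrow> x \<in> pts X \<Longrightarrow>
      lact X (k \<otimes>\<^bsub>K\<^esub> k') x = lact X k (lact X k' x)"
    and ract_closed: "h \<in> carrier H \<Longrightarrow> x \<in> pts X \<Longrightarrow> ract X x h \<in> pts X"
    and ract_one: "x \<in> pts X \<Longrightarrow> ract X x \<one>\<^bsub>H\<^esub> = x"
    and ract_mult: "h \<in> carrier H \<Longrightarrow> h' \<in> carrier H \<Longrightarrow> x \<in> pts X \<Longrightarrow>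
      ract X x (h \<otimes>\<^bsub>H\<^esub> h') = ract X (ract X x h) h'"
    and lact_ract: "k \<in> carrier K \<Longrightarrow> h \<in> carrier H \<Longrightarrow> x \<in> pts X \<Longrightarrow>
      lact X k (ract X x h) = ract X (lact X k x) h"
  using assms by (auto simp: fin_biset_def)

lemma biset_iso_sym:
  assumes X: "fin_biset K H X" and iso: "biset_iso K H X Y"
  shows "biset_iso K H Y X"
proof -
  from iso obtain f where bij: "bij_betw f (pts X) (pts Y)"
    and f: "\<And>k x. k \<in> carrier K \<Longrightarrow> x \<in> pts X \<Longrightarrow> f (lact X k x) = lact Y k (f x)"
      "\<And>h x. h \<in> carrier H \<Longrightarrow> x \<in> pts X \<Longrightarrow> f (ract X x h) = ract Y (f x) h"
    by (auto simp: biset_iso_def)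
  let ?g = "inv_into (pts X) f"
  have g: "?g y \<in> pts X" "f (?g y) = y" if "y \<in> pts Y" for y
    using bij that by (auto simp: bij_betw_def inv_into_into f_inv_into_f)
  have gf: "?g (f x) = x" if "x \<in> pts X" for x
    using bij that by (simp add: bij_betw_def)
  show ?thesis
    unfolding biset_iso_def
  proof (intro exI conjI ballI)
    show "bij_betw ?g (pts Y) (pts X)" by (rule bij_betw_inv_into[OF bij])
    show "?g (lact Y k y) = lact X k (?g y)" if k: "k \<in> carrier K" and y: "y \<in> pts Y" for k y
      using gf[OF lact_closed[OF X k g(1)[OF y]]] f(1)[OF k g(1)[OF y]] g(2)[OF y] by simp
    show "?g (ract Y y h) = ract X (?g y) h" if h: "h \<in> carrier H" and y: "y \<in> pts Y" for h y
      using gf[OF ract_closed[OF X h g(1)[OF y]]] f(2)[OF h g(1)[OF y]] g(2)[OF y] by simp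
  qed
qed

lemma biset_iso_trans:
  assumes "biset_iso K H X Y" "biset_iso K H Y Z"
  shows "biset_iso K H X Z"
proof -
  from assms obtain f g where f: "bij_betw f (pts X) (pts Y)"
      "\<And>k x. k \<in> carrier K \<Longrightarrow> x \<in> pts X \<Longrightarrow> f (lact X k x) = lact Y k (f x)"
      "\<And>h x. h \<in> carrier H \<Longrightarrow> x \<in> pts X \<Longrightarrow> f (ract X x h) = ract Y (f x) h"
    and g: "bij_betw g (pts Y) (pts Z)"
      "\<And>k x. k \<in> carrier K \<Longrightarrow> x \<in> pts Y \<Longrightarrow> g (lact Y k x) = lact Z k (g x)"
      "\<And>h x. h \<in> carrier H \<Longrightarrow> x \<in> pts Y \<Longrightarrow> g (ract Y x h) = ract Z (g x) h"
    by (auto simp: biset_iso_def)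
  have "f x \<in> pts Y" if "x \<in> pts X" for x using f(1) that by (auto simp: bij_betw_def)
  then show ?thesis
    unfolding biset_iso_def
    by (intro exI[of _ "g \<circ> f"] conjI bij_betw_trans[OF f(1) g(1)]) (simp_all add: f g)
qed

lemma biset_iso_fin:
  assumes X: "fin_biset K H X" and iso: "biset_iso K H X Y" and K: "group K" and H: "group H"
  shows "fin_biset K H Y"
proof -
  interpret K: group K by fact
  interpret H: group H by fact
  from iso obtain f where bij: "bij_betw f (pts X) (pts Y)"
    and f: "\<And>k x. k \<in> carrier K \<Longrightarrow> x \<in> pts X \<Longrightarrow> lact Y k (f x) = f (lact X k x)"
      "\<And>h x. h \<in> carrier H \<Longrightarrow> x \<in> pts X \<Longrightarrow> ract Y (f x) h = f (ract X x h)"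
    by (auto simp: biset_iso_def)
  have Y: "pts Y = f ` pts X" using bij by (simp add: bij_betw_def)
  show ?thesis
    unfolding fin_biset_def Y
    by (auto simp: f fin_bisetD[OF X])
qed

text \<open>Transport of structure along an injection of the finite set of points into the natural numbers.\<close>

lemma biset_nat_representative:
  fixes X :: "('k, 'h, 'x) biset"
  assumes X: "fin_biset K H X" and K: "group K" and H: "group H"
  shows "\<exists>Z :: ('k, 'h, nat) biset. fin_biset K H Z \<and> biset_iso K H X Z"
proof -
  from finite_imp_inj_to_nat_seg[OF fin_biset_finite[OF X]]
  obtain f :: "'x \<Rightarrow> nat" where inj: "inj_on f (pts X)" by blast
  let ?g = "inv_into (pts X) f"
  let ?Z = "\<lparr>pts = f ` pts X, lact = (\<lambda>k n. f (lact X k (?g n))), ract = (\<lambda>n h. f (ract X (?g n) h))\<rparr>"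
  have iso: "biset_iso K H X ?Z"
    unfolding biset_iso_def by (intro exI[of _ f]) (auto simp: inj bij_betw_def)
  show ?thesis using iso biset_iso_fin[OF X iso K H] by blast
qed

lemma biset_class_cong:
  assumes X: "fin_biset K H X" and iso: "biset_iso K H X Y"
  shows "biset_class K H X = biset_class K H Y"
  using iso biset_iso_trans[OF biset_iso_sym[OF X iso]] biset_iso_trans[OF iso]
  by (auto simp: biset_class_def)

lemma biset_class_in_classes:
  fixes X :: "('k, 'h, 'x) biset"
  assumes X: "fin_biset K H X" and K: "group K" and H: "group H"
  shows "biset_class K H X \<in> biset_classes K H"
proof -
  obtain Z :: "('k, 'h, nat) biset" where "fin_biset K H Z" "biset_iso K H X Z"
    using biset_nat_representative[OF X K H] by blast
  then show ?thesis using biset_class_cong[OF X] by (auto simp: biset_classes_def)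
qed

subsection \<open>Products\<close>

definition orbit_of :: "('h, 'l) monoid_scheme \<Rightarrow> ('k, 'h, 'x) biset \<Rightarrow> ('h, 'j, 'y) biset \<Rightarrow> 'x \<Rightarrow> 'y \<Rightarrow> ('x \<times> 'y) set" where
  "orbit_of H X Y x y = {(ract X x h, lact Y (inv\<^bsub>H\<^esub> h) y) | h. h \<in> carrier H}"

lemma biset_prod_pts: "pts (biset_prod H X Y) = {orbit_of H X Y x y | x y. x \<in> pts X \<and> y \<in> pts Y}"
  by (simp add: biset_prod_def orbit_of_def)

context
  fixes K :: "('k, 'l1) monoid_scheme" and H :: "('h, 'l2) monoid_scheme" and J :: "('j, 'l3) monoid_scheme"
  assumes K: "group K" and H: "group H" and J: "group J"
begin

interpretation K: group K by (rule K)
interpretation H: group H by (rule H)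
interpretation J: group J by (rule J)

lemma orbit_of_self:
  assumes X: "fin_biset K H X" and Y: "fin_biset H J Y" and "x \<in> pts X" "y \<in> pts Y"
  shows "(x, y) \<in> orbit_of H X Y x y"
  unfolding orbit_of_def
  using assms(3,4) by (auto intro!: exI[of _ "\<one>\<^bsub>H\<^esub>"] simp: ract_one[OF X] lact_one[OF Y])

lemma orbit_of_eq_iff:
  assumes X: "fin_biset K H X" and Y: "fin_biset H J Y"
    and x: "x \<in> pts X" and y: "y \<in> pts Y" and x': "x' \<in> pts X" and y': "y' \<in> pts Y"
  shows "orbit_of H X Y x y = orbit_of H X Y x' y' \<longleftrightarrow>
    (\<exists>h\<in>carrier H. x' = ract X x h \<and> y' = lact Y (inv\<^bsub>H\<^esub> h) y)"
proof
  assume "orbit_of H X Y x y = orbit_of H X Y x' y'"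
  then have "(x', y') \<in> orbit_of H X Y x y" using orbit_of_self[OF X Y x' y'] by simp
  then show "\<exists>h\<in>carrier H. x' = ract X x h \<and> y' = lact Y (inv\<^bsub>H\<^esub> h) y" by (auto simp: orbit_of_def)
next
  have sub: "orbit_of H X Y (ract X x h) (lact Y (inv\<^bsub>H\<^esub> h) y) \<subseteq> orbit_of H X Y x y"
    if "x \<in> pts X" "y \<in> pts Y" "h \<in> carrier H" for x y h
  proof
    fix p assume "p \<in> orbit_of H X Y (ract X x h) (lact Y (inv\<^bsub>H\<^esub> h) y)"
    then obtain h' where h': "h' \<in> carrier H"
      "p = (ract X (ract X x h) h', lact Y (inv\<^bsub>H\<^esub> h') (lact Y (inv\<^bsub>H\<^esub> h) y))" by (auto simp: orbit_of_def)
    then have "p = (ract X x (h \<otimes>\<^bsub>H\<^esub> h'), lact Y (inv\<^bsub>H\<^esub> (h \<otimes>\<^bsub>H\<^esub> h')) y)"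
      using that by (simp add: ract_mult[OF X] lact_mult[OF Y, symmetric] H.inv_mult_group)
    then show "p \<in> orbit_of H X Y x y" using that h' by (auto simp: orbit_of_def)
  qed
  assume "\<exists>h\<in>carrier H. x' = ract X x h \<and> y' = lact Y (inv\<^bsub>H\<^esub> h) y"
  then obtain h where h: "h \<in> carrier H" "x' = ract X x h" "y' = lact Y (inv\<^bsub>H\<^esub> h) y" by blast
  have "x = ract X x' (inv\<^bsub>H\<^esub> h)" "y = lact Y (inv\<^bsub>H\<^esub> (inv\<^bsub>H\<^esub> h)) y'"
    using h x y by (simp_all add: ract_mult[OF X, symmetric] lact_mult[OF Y, symmetric] ract_one[OF X] lact_one[OF Y])
  then have "orbit_of H X Y x y \<subseteq> orbit_of H X Y x' y'"
    using sub[OF x' y' H.inv_closed[OF h(1)]] by simp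
  then show "orbit_of H X Y x y = orbit_of H X Y x' y'" using sub[OF x y h(1)] h by blast
qed

lemma biset_prod_lact:
  assumes X: "fin_biset K H X" and "k \<in> carrier K" "x \<in> pts X"
  shows "lact (biset_prod H X Y) k (orbit_of H X Y x y) = orbit_of H X Y (lact X k x) y"
  using assms(2,3) by (force simp: biset_prod_def orbit_of_def lact_ract[OF X])

lemma biset_prod_ract:
  assumes Y: "fin_biset H J Y" and "j \<in> carrier J" "y \<in> pts Y"
  shows "ract (biset_prod H X Y) (orbit_of H X Y x y) j = orbit_of H X Y x (ract Y y j)"
  using assms(2,3) by (force simp: biset_prod_def orbit_of_def lact_ract[OF Y])

text \<open>To identify a product it is enough to give an equivariant surjection from the pairs whose fibres
  are the orbits.\<close>

lemma biset_prod_isoI: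
  assumes X: "fin_biset K H X" and Y: "fin_biset H J Y"
    and mem: "\<And>x y. x \<in> pts X \<Longrightarrow> y \<in> pts Y \<Longrightarrow> \<mu> x y \<in> pts W"
    and surj: "\<And>w. w \<in> pts W \<Longrightarrow> \<exists>x\<in>pts X. \<exists>y\<in>pts Y. \<mu> x y = w"
    and fibre: "\<And>x y x' y'. x \<in> pts X \<Longrightarrow> y \<in> pts Y \<Longrightarrow> x' \<in> pts X \<Longrightarrow> y' \<in> pts Y \<Longrightarrow>
      \<mu> x y = \<mu> x' y' \<longleftrightarrow> (\<exists>h\<in>carrier H. x' = ract X x h \<and> y' = lact Y (inv\<^bsub>H\<^esub> h) y)"
    and l: "\<And>k x y. k \<in> carrier K \<Longrightarrow> x \<in> pts X \<Longrightarrow> y \<in> pts Y \<Longrightarrow> \<mu> (lact X k x) y = lact W k (\<mu> x y)"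
    and r: "\<And>j x y. j \<in> carrier J \<Longrightarrow> x \<in> pts X \<Longrightarrow> y \<in> pts Y \<Longrightarrow> \<mu> x (ract Y y j) = ract W (\<mu> x y) j"
  shows "biset_iso K J (biset_prod H X Y) W"
proof -
  let ?o = "orbit_of H X Y"
  define f where "f Q = (SOME w. \<exists>x\<in>pts X. \<exists>y\<in>pts Y. Q = ?o x y \<and> w = \<mu> x y)" for Q
  have eq: "?o x y = ?o x' y' \<longleftrightarrow> \<mu> x y = \<mu> x' y'"
    if "x \<in> pts X" "y \<in> pts Y" "x' \<in> pts X" "y' \<in> pts Y" for x y x' y'
    using orbit_of_eq_iff[OF X Y that] fibre[OF that] by simp
  have f: "f (?o x y) = \<mu> x y" if "x \<in> pts X" "y \<in> pts Y" for x y
    unfolding f_def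
  proof (rule some_equality)
    show "\<exists>x'\<in>pts X. \<exists>y'\<in>pts Y. ?o x y = ?o x' y' \<and> \<mu> x y = \<mu> x' y'" using that by blast
    show "w = \<mu> x y" if "\<exists>x'\<in>pts X. \<exists>y'\<in>pts Y. ?o x y = ?o x' y' \<and> w = \<mu> x' y'" for w
      using that eq[OF \<open>x \<in> pts X\<close> \<open>y \<in> pts Y\<close>] by metis
  qed
  have "bij_betw f (pts (biset_prod H X Y)) (pts W)"
    unfolding bij_betw_def
  proof
    show "inj_on f (pts (biset_prod H X Y))"
      by (rule inj_onI, unfold biset_prod_pts, clarify) (simp only: f eq)
    show "f ` pts (biset_prod H X Y) = pts W"
    proof (intro equalityI subsetI)
      fix w assume "w \<in> pts W"
      then obtain x y where "x \<in> pts X" "y \<in> pts Y" "\<mu> x y = w" using surj by blast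
      then show "w \<in> f ` pts (biset_prod H X Y)"
        by (intro image_eqI[of _ _ "?o x y"]) (auto simp: biset_prod_pts f)
    qed (auto simp: biset_prod_pts f mem)
  qed
  moreover have "f (lact (biset_prod H X Y) k Q) = lact W k (f Q)"
    if "k \<in> carrier K" "Q \<in> pts (biset_prod H X Y)" for k Q
    using that by (auto simp: biset_prod_pts biset_prod_lact[OF X] f l lact_closed[OF X])
  moreover have "f (ract (biset_prod H X Y) Q j) = ract W (f Q) j"
    if "j \<in> carrier J" "Q \<in> pts (biset_prod H X Y)" for j Q
    using that by (auto simp: biset_prod_pts biset_prod_ract[OF Y] f r ract_closed[OF Y])
  ultimately show ?thesis by (auto simp: biset_iso_def)
qed

lemma biset_prod_fin:
  assumes X: "fin_biset K H X" and Y: "fin_biset H J Y"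
  shows "fin_biset K J (biset_prod H X Y)"
proof -
  have pts: "pts (biset_prod H X Y) = (\<lambda>(x, y). orbit_of H X Y x y) ` (pts X \<times> pts Y)"
    by (auto simp: biset_prod_pts)
  have "finite (pts (biset_prod H X Y))"
    unfolding pts using fin_biset_finite[OF X] fin_biset_finite[OF Y] by blast
  then show ?thesis
    unfolding fin_biset_def
    by (auto simp: pts biset_prod_lact[OF X] biset_prod_ract[OF Y] fin_bisetD[OF X] fin_bisetD[OF Y])
qed

lemma biset_prod_cong:
  assumes X: "fin_biset K H X" and Y: "fin_biset H J Y"
    and isoX: "biset_iso K H X X'" and isoY: "biset_iso H J Y Y'"
  shows "biset_iso K J (biset_prod H X Y) (biset_prod H X' Y')"
proof -
  have X': "fin_biset K H X'" and Y': "fin_biset H J Y'"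
    using biset_iso_fin[OF X isoX K H] biset_iso_fin[OF Y isoY H J] .
  from isoX obtain f where f: "bij_betw f (pts X) (pts X')"
      "\<And>k x. k \<in> carrier K \<Longrightarrow> x \<in> pts X \<Longrightarrow> f (lact X k x) = lact X' k (f x)"
      "\<And>h x. h \<in> carrier H \<Longrightarrow> x \<in> pts X \<Longrightarrow> f (ract X x h) = ract X' (f x) h"
    by (auto simp: biset_iso_def)
  from isoY obtain g where g: "bij_betw g (pts Y) (pts Y')"
      "\<And>k x. k \<in> carrier H \<Longrightarrow> x \<in> pts Y \<Longrightarrow> g (lact Y k x) = lact Y' k (g x)"
      "\<And>h x. h \<in> carrier J \<Longrightarrow> x \<in> pts Y \<Longrightarrow> g (ract Y x h) = ract Y' (g x) h"
    by (auto simp: biset_iso_def)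
  have X'_eq: "pts X' = f ` pts X" and Y'_eq: "pts Y' = g ` pts Y"
    and inj: "\<And>x x'. x \<in> pts X \<Longrightarrow> x' \<in> pts X \<Longrightarrow> f x = f x' \<longleftrightarrow> x = x'"
      "\<And>y y'. y \<in> pts Y \<Longrightarrow> y' \<in> pts Y \<Longrightarrow> g y = g y' \<longleftrightarrow> y = y'"
    using f(1) g(1) by (auto simp: bij_betw_def inj_on_def)
  have fX: "f x \<in> pts X'" if "x \<in> pts X" for x using that X'_eq by auto
  have gY: "g y \<in> pts Y'" if "y \<in> pts Y" for y using that Y'_eq by auto
  show ?thesis
  proof (rule biset_prod_isoI[OF X Y, of "\<lambda>x y. orbit_of H X' Y' (f x) (g y)"])
    fix x y x' y' assume xy: "x \<in> pts X" "y \<in> pts Y" "x' \<in> pts X" "y' \<in> pts Y"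
    show "orbit_of H X' Y' (f x) (g y) = orbit_of H X' Y' (f x') (g y') \<longleftrightarrow>
        (\<exists>h\<in>carrier H. x' = ract X x h \<and> y' = lact Y (inv\<^bsub>H\<^esub> h) y)"
      unfolding orbit_of_eq_iff[OF X' Y' fX[OF xy(1)] gY[OF xy(2)] fX[OF xy(3)] gY[OF xy(4)]]
      using xy by (intro bex_cong refl)
        (simp add: f(3)[symmetric] g(2)[symmetric] inj ract_closed[OF X] lact_closed[OF Y])
  next
    fix w assume "w \<in> pts (biset_prod H X' Y')"
    then show "\<exists>x\<in>pts X. \<exists>y\<in>pts Y. orbit_of H X' Y' (f x) (g y) = w"
      by (auto simp: biset_prod_pts X'_eq Y'_eq)
  qed (use fX gY in \<open>auto simp: biset_prod_pts f g biset_prod_lact[OF X'] biset_prod_ract[OF Y']\<close>)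
qed

end

subsection \<open>Sums\<close>

lemma bex_Plus: "(\<exists>z\<in>A <+> B. P z) \<longleftrightarrow> (\<exists>x\<in>A. P (Inl x)) \<or> (\<exists>y\<in>B. P (Inr y))"
  by (auto simp: Plus_def bex_Un)

lemma biset_sum_fin:
  assumes X: "fin_biset K H X" and Y: "fin_biset K H Y"
  shows "fin_biset K H (biset_sum X Y)"
  unfolding fin_biset_def biset_sum_def
  by (auto simp: fin_bisetD[OF X] fin_bisetD[OF Y])

lemma biset_sum_cong:
  assumes isoX: "biset_iso K H X X'" and isoY: "biset_iso K H Y Y'"
  shows "biset_iso K H (biset_sum X Y) (biset_sum X' Y')"
proof -
  from isoX obtain f where f: "bij_betw f (pts X) (pts X')"
      "\<And>k x. k \<in> carrier K \<Longrightarrow> x \<in> pts X \<Longrightarrow> f (lact X k x) = lact X' k (f x)"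
      "\<And>h x. h \<in> carrier H \<Longrightarrow> x \<in> pts X \<Longrightarrow> f (ract X x h) = ract X' (f x) h"
    by (auto simp: biset_iso_def)
  from isoY obtain g where g: "bij_betw g (pts Y) (pts Y')"
      "\<And>k x. k \<in> carrier K \<Longrightarrow> x \<in> pts Y \<Longrightarrow> g (lact Y k x) = lact Y' k (g x)"
      "\<And>h x. h \<in> carrier H \<Longrightarrow> x \<in> pts Y \<Longrightarrow> g (ract Y x h) = ract Y' (g x) h"
    by (auto simp: biset_iso_def)
  show ?thesis
    unfolding biset_iso_def
  proof (intro exI conjI ballI)
    have inj: "x \<in> pts X \<Longrightarrow> x' \<in> pts X \<Longrightarrow> f x = f x' \<longleftrightarrow> x = x'"
        "y \<in> pts Y \<Longrightarrow> y' \<in> pts Y \<Longrightarrow> g y = g y' \<longleftrightarrow> y = y'" for x x' y y'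
      using f(1) g(1) by (meson bij_betw_imp_inj_on inj_onD)+
    have img: "pts X' = f ` pts X" "pts Y' = g ` pts Y" using f(1) g(1) by (simp_all add: bij_betw_def)
    show "bij_betw (map_sum f g) (pts (biset_sum X Y)) (pts (biset_sum X' Y'))"
      by (rule bij_betwI') (auto simp: biset_sum_def img inj Plus_def bex_Un)
  qed (auto simp: biset_sum_def f g)
qed

context
  fixes K :: "('k, 'l1) monoid_scheme" and H :: "('h, 'l2) monoid_scheme" and J :: "('j, 'l3) monoid_scheme"
  assumes K: "group K" and H: "group H" and J: "group J"
begin

interpretation H: group H by (rule H)

lemma biset_prod_sum_left:
  assumes X: "fin_biset K H X" and X': "fin_biset K H X'" and Y: "fin_biset H J Y"
  shows "biset_iso K J (biset_prod H (biset_sum X X') Y) (biset_sum (biset_prod H X Y) (biset_prod H X' Y))"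
proof (rule biset_prod_isoI[OF K H J biset_sum_fin[OF X X'] Y, where
      \<mu> = "\<lambda>z y. map_sum (\<lambda>x. orbit_of H X Y x y) (\<lambda>x. orbit_of H X' Y x y) z"])
  fix z y z' y' assume zy: "z \<in> pts (biset_sum X X')" "y \<in> pts Y" "z' \<in> pts (biset_sum X X')" "y' \<in> pts Y"
  then show "map_sum (\<lambda>x. orbit_of H X Y x y) (\<lambda>x. orbit_of H X' Y x y) z =
      map_sum (\<lambda>x. orbit_of H X Y x y') (\<lambda>x. orbit_of H X' Y x y') z' \<longleftrightarrow>
      (\<exists>h\<in>carrier H. z' = ract (biset_sum X X') z h \<and> y' = lact Y (inv\<^bsub>H\<^esub> h) y)"
    by (auto simp: biset_sum_def orbit_of_eq_iff[OF K H J X Y] orbit_of_eq_iff[OF K H J X' Y])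
qed (auto simp: biset_sum_def biset_prod_pts biset_prod_lact[OF K H J X] biset_prod_lact[OF K H J X']
    biset_prod_ract[OF K H J Y] bex_Plus, blast+)

lemma biset_prod_sum_right:
  assumes X: "fin_biset K H X" and Y: "fin_biset H J Y" and Y': "fin_biset H J Y'"
  shows "biset_iso K J (biset_prod H X (biset_sum Y Y')) (biset_sum (biset_prod H X Y) (biset_prod H X Y'))"
proof (rule biset_prod_isoI[OF K H J X biset_sum_fin[OF Y Y'], where
      \<mu> = "\<lambda>x z. map_sum (\<lambda>y. orbit_of H X Y x y) (\<lambda>y. orbit_of H X Y' x y) z"])
  fix x z x' z' assume "x \<in> pts X" "z \<in> pts (biset_sum Y Y')" "x' \<in> pts X" "z' \<in> pts (biset_sum Y Y')"
  then show "map_sum (\<lambda>y. orbit_of H X Y x y) (\<lambda>y. orbit_of H X Y' x y) z =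
      map_sum (\<lambda>y. orbit_of H X Y x' y) (\<lambda>y. orbit_of H X Y' x' y) z' \<longleftrightarrow>
      (\<exists>h\<in>carrier H. x' = ract X x h \<and> z' = lact (biset_sum Y Y') (inv\<^bsub>H\<^esub> h) z)"
    by (auto simp: biset_sum_def orbit_of_eq_iff[OF K H J X Y] orbit_of_eq_iff[OF K H J X Y'])
qed (auto simp: biset_sum_def biset_prod_pts biset_prod_lact[OF K H J X] biset_prod_ract[OF K H J Y]
    biset_prod_ract[OF K H J Y'] bex_Plus, blast+)

text \<open>The union in the definition of the composite of classes is one over equal classes, because isomorphic
  factors have isomorphic products.\<close>

lemma class_comp_eq:
  fixes X :: "('k, 'h, 'x) biset" and Y :: "('h, 'j, 'y) biset"
  assumes X: "fin_biset K H X" and Y: "fin_biset H J Y"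
  shows "class_comp K H J (biset_class K H X) (biset_class H J Y) = biset_class K J (biset_prod H X Y)"
proof -
  obtain X0 :: "('k, 'h, nat) biset" where X0: "X0 \<in> biset_class K H X"
    using biset_nat_representative[OF X K H] by (auto simp: biset_class_def)
  obtain Y0 :: "('h, 'j, nat) biset" where Y0: "Y0 \<in> biset_class H J Y"
    using biset_nat_representative[OF Y H J] by (auto simp: biset_class_def)
  have "biset_class K J (biset_prod H X' Y') = biset_class K J (biset_prod H X Y)"
    if "X' \<in> biset_class K H X" "Y' \<in> biset_class H J Y" for X' Y'
    using that
    by (intro biset_class_cong[OF biset_prod_fin[OF K H J X Y], symmetric] biset_prod_cong[OF K H J X Y])
      (auto simp: biset_class_def)
  then show ?thesis unfolding class_comp_def using X0 Y0 by blast
qed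

end

section \<open>Burnside modules\<close>

abbreviation chains :: "('r, 'c) ring_scheme \<Rightarrow> ('k, 'l1) monoid_scheme \<Rightarrow> ('h, 'l2) monoid_scheme
    \<Rightarrow> ('r, ('k, 'h, nat) biset set \<Rightarrow> 'r) module" where
  "chains R K H \<equiv> free_module R (biset_classes K H)"

abbreviation chain_of :: "('r, 'c) ring_scheme \<Rightarrow> ('k, 'l1) monoid_scheme \<Rightarrow> ('h, 'l2) monoid_scheme
    \<Rightarrow> ('k, 'h, 'x) biset \<Rightarrow> ('k, 'h, nat) biset set \<Rightarrow> 'r" where
  "chain_of R K H X \<equiv> basis_elem R (biset_class K H X)"

definition sum_rel :: "('r, 'c) ring_scheme \<Rightarrow> ('k, 'l1) monoid_scheme \<Rightarrow> ('h, 'l2) monoid_scheme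
    \<Rightarrow> ('k, 'h, 'x) biset \<Rightarrow> ('k, 'h, 'y) biset \<Rightarrow> ('k, 'h, nat) biset set \<Rightarrow> 'r" where
  "sum_rel R K H X Y = chain_of R K H (biset_sum X Y) \<ominus>\<^bsub>chains R K H\<^esub>
     (chain_of R K H X \<oplus>\<^bsub>chains R K H\<^esub> chain_of R K H Y)"

lemma burnside_rels_eq:
  "burnside_rels R K H = gen_submodule R (chains R K H)
    {sum_rel R K H X Y | (X :: (_, _, nat) biset) (Y :: (_, _, nat) biset). fin_biset K H X \<and> fin_biset K H Y}"
  by (simp add: burnside_rels_def sum_rel_def Let_def)

context cring begin

context
  fixes K :: "('k, 'l1) monoid_scheme" and H :: "('h, 'l2) monoid_scheme"
  assumes K: "group K" and H: "group H"
begin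

lemma chain_of_closed: "fin_biset K H X \<Longrightarrow> chain_of R K H X \<in> carrier (chains R K H)"
  by (intro basis_elem_closed biset_class_in_classes K H)

lemma sum_rel_closed:
  assumes "fin_biset K H X" "fin_biset K H Y"
  shows "sum_rel R K H X Y \<in> carrier (chains R K H)"
proof -
  interpret E: module R "chains R K H" by (rule free_module_module[OF is_cring])
  show ?thesis
    unfolding sum_rel_def using assms by (intro E.minus_closed E.a_closed chain_of_closed biset_sum_fin)
qed

lemma burnside_rels_submodule: "submodule (burnside_rels R K H) R (chains R K H)"
  unfolding burnside_rels_eq
  by (rule gen_submodule_submodule[OF free_module_module[OF is_cring]]) (auto intro: sum_rel_closed)

text \<open>The relations are imposed for bisets of natural numbers; relabelling gives them for all finite bisets, in
  particular for products, whose points are sets of pairs.\<close>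

lemma sum_rel_in_burnside_rels:
  fixes X :: "('k, 'h, 'x) biset" and Y :: "('k, 'h, 'y) biset"
  assumes X: "fin_biset K H X" and Y: "fin_biset K H Y"
  shows "sum_rel R K H X Y \<in> burnside_rels R K H"
proof -
  obtain X' :: "('k, 'h, nat) biset" where X': "fin_biset K H X'" "biset_iso K H X X'"
    using biset_nat_representative[OF X K H] by blast
  obtain Y' :: "('k, 'h, nat) biset" where Y': "fin_biset K H Y'" "biset_iso K H Y Y'"
    using biset_nat_representative[OF Y K H] by blast
  have "sum_rel R K H X Y = sum_rel R K H X' Y'"
    unfolding sum_rel_def biset_class_cong[OF X X'(2)] biset_class_cong[OF Y Y'(2)]
      biset_class_cong[OF biset_sum_fin[OF X Y] biset_sum_cong[OF X'(2) Y'(2)]] ..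
  also have "\<dots> \<in> burnside_rels R K H"
    unfolding burnside_rels_eq using X'(1) Y'(1) by (intro subsetD[OF gen_submodule_incl]) blast
  finally show ?thesis .
qed

lemma burnside_elem_closed:
  "fin_biset K H X \<Longrightarrow> burnside_elem R K H X \<in> carrier (burnside R K H)"
  unfolding burnside_def burnside_elem_def
    quot_module_carrier[OF free_module_module[OF is_cring] burnside_rels_submodule]
  by (intro imageI chain_of_closed)

end

subsection \<open>Composition\<close>

definition tensor :: "('s \<Rightarrow> 'a) \<Rightarrow> ('t \<Rightarrow> 'a) \<Rightarrow> 's \<times> 't \<Rightarrow> 'a" where
  "tensor c d = (\<lambda>p. c (fst p) \<otimes> d (snd p))"

lemma tensor_closed:
  assumes c: "c \<in> carrier (free_module R S)" and d: "d \<in> carrier (free_module R T)"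
  shows "tensor c d \<in> carrier (free_module R (S \<times> T))"
proof -
  note c' = free_moduleD[OF c] and d' = free_moduleD[OF d]
  have supp: "c (fst p) \<noteq> \<zero> \<and> d (snd p) \<noteq> \<zero>" if "tensor c d p \<noteq> \<zero>" for p
    using that c'(1) d'(1) by (auto simp: tensor_def)
  have "finite {p. tensor c d p \<noteq> \<zero>}"
    by (rule finite_subset[OF _ finite_cartesian_product[OF c'(2) d'(2)]]) (use supp in \<open>auto simp: mem_Times_iff\<close>)
  moreover have "tensor c d p = \<zero>" if "p \<notin> S \<times> T" for p
    using that supp[of p] c'(3)[of "fst p"] d'(3)[of "snd p"] unfolding mem_Times_iff by blast
  moreover have "tensor c d p \<in> carrier R" for p
    using c'(1) d'(1) by (simp add: tensor_def)
  ultimately show ?thesis by (simp only: free_module_def) (simp del: split_paired_All)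
qed

lemma tensor_hom_left:
  assumes d: "d \<in> carrier (free_module R T)"
  shows "(\<lambda>c. tensor c d) \<in> module_hom R (free_module R S) (free_module R (S \<times> T))"
  by (intro module_homI tensor_closed d)
    (simp_all add: fun_eq_iff tensor_def free_module_add free_module_smult free_module_coeff[OF d]
      free_module_coeff[where S = S] l_distr m_assoc)

lemma tensor_hom_right:
  assumes c: "c \<in> carrier (free_module R S)"
  shows "tensor c \<in> module_hom R (free_module R T) (free_module R (S \<times> T))"
  by (intro module_homI tensor_closed c)
    (simp_all add: fun_eq_iff tensor_def free_module_add free_module_smult free_module_coeff[OF c]
      free_module_coeff[where S = T] r_distr m_lcomm)

lemma tensor_basis: "tensor (basis_elem R s) (basis_elem R t) = basis_elem R (s, t)"
  by (auto simp: tensor_def basis_elem_def fun_eq_iff)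

context
  fixes K :: "('k, 'l1) monoid_scheme" and H :: "('h, 'l2) monoid_scheme" and J :: "('j, 'l3) monoid_scheme"
  assumes K: "group K" and H: "group H" and J: "group J"
begin

lemma class_comp_closed:
  assumes "A \<in> biset_classes K H" "B \<in> biset_classes H J"
  shows "class_comp K H J A B \<in> biset_classes K J"
proof -
  from assms obtain X :: "('k, 'h, nat) biset" and Y :: "('h, 'j, nat) biset"
    where "fin_biset K H X" "A = biset_class K H X" "fin_biset H J Y" "B = biset_class H J Y"
    by (auto simp: biset_classes_def)
  then show ?thesis
    by (simp add: class_comp_eq[OF K H J] biset_class_in_classes[OF biset_prod_fin[OF K H J] K J])
qed

text \<open>The composition of chains is bilinear because it is a linear map applied to a tensor product.\<close>

lemma chain_comp_eq_lin_ext: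
  assumes c: "c \<in> carrier (chains R K H)" and d: "d \<in> carrier (chains R H J)"
  shows "chain_comp R K H J c d = lin_ext R (chains R K J)
    (\<lambda>p. basis_elem R (class_comp K H J (fst p) (snd p))) (tensor c d)"
proof (rule ext)
  fix Z
  note cd = tensor_closed[OF c d]
  have "chain_comp R K H J c d Z = (\<Oplus>p\<in>{p. tensor c d p \<noteq> \<zero> \<and> class_comp K H J (fst p) (snd p) = Z}. tensor c d p)"
    unfolding chain_comp_def
  proof (rule add.finprod_mono_neutral_cong_right)
    show "finite {(A, B). c A \<noteq> \<zero> \<and> d B \<noteq> \<zero> \<and> class_comp K H J A B = Z}"
      by (rule finite_subset[OF _ finite_cartesian_product[OF free_module_finite[OF c] free_module_finite[OF d]]]) auto
  qed (use free_module_coeff[OF c] free_module_coeff[OF d] in \<open>auto simp: tensor_def\<close>)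
  also have "\<dots> = lin_ext R (chains R K J) (\<lambda>p. basis_elem R (class_comp K H J (fst p) (snd p))) (tensor c d) Z"
    by (rule lin_ext_pushforward_eval[OF cd, symmetric]) (auto intro: class_comp_closed)
  finally show "chain_comp R K H J c d Z =
    lin_ext R (chains R K J) (\<lambda>p. basis_elem R (class_comp K H J (fst p) (snd p))) (tensor c d) Z" .
qed

lemma class_comp_lin_ext_hom:
  "lin_ext R (chains R K J) (\<lambda>p. basis_elem R (class_comp K H J (fst p) (snd p)))
    \<in> module_hom R (free_module R (biset_classes K H \<times> biset_classes H J)) (chains R K J)"
proof -
  interpret E: module R "chains R K J" by (rule free_module_module[OF is_cring])
  show ?thesis by (rule E.lin_ext_hom) (auto intro!: basis_elem_closed class_comp_closed)
qed

lemma chain_comp_hom_left: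
  assumes d: "d \<in> carrier (chains R H J)"
  shows "(\<lambda>c. chain_comp R K H J c d) \<in> module_hom R (chains R K H) (chains R K J)"
  by (rule module_hom_cong[OF module_hom_compose[OF tensor_hom_left[OF d] class_comp_lin_ext_hom]
        free_module_module[OF is_cring]])
    (rule chain_comp_eq_lin_ext[OF _ d, symmetric])

lemma chain_comp_hom_right:
  assumes c: "c \<in> carrier (chains R K H)"
  shows "chain_comp R K H J c \<in> module_hom R (chains R H J) (chains R K J)"
  by (rule module_hom_cong[OF module_hom_compose[OF tensor_hom_right[OF c] class_comp_lin_ext_hom]
        free_module_module[OF is_cring]])
    (rule chain_comp_eq_lin_ext[OF c, symmetric])

lemma chain_comp_chain_of:
  assumes X: "fin_biset K H X" and Y: "fin_biset H J Y"
  shows "chain_comp R K H J (chain_of R K H X) (chain_of R H J Y) = chain_of R K J (biset_prod H X Y)"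
proof -
  interpret E: module R "chains R K J" by (rule free_module_module[OF is_cring])
  note prod = biset_prod_fin[OF K H J X Y]
  show ?thesis
    unfolding chain_comp_eq_lin_ext[OF chain_of_closed[OF K H X] chain_of_closed[OF H J Y]] tensor_basis
    using E.lin_ext_basis[of "\<lambda>p. basis_elem R (class_comp K H J (fst p) (snd p))" "(biset_class K H X, biset_class H J Y)"]
      chain_of_closed[OF K J prod]
    by (simp add: class_comp_eq[OF K H J X Y])
qed

lemma chain_comp_sum_rel_left:
  assumes X: "fin_biset K H X" and X': "fin_biset K H X'" and Y: "fin_biset H J Y"
  shows "chain_comp R K H J (sum_rel R K H X X') (chain_of R H J Y)
    = sum_rel R K J (biset_prod H X Y) (biset_prod H X' Y)"
proof -
  interpret E: module R "chains R K H" by (rule free_module_module[OF is_cring])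
  note hom = chain_comp_hom_left[OF chain_of_closed[OF H J Y]]
  note cl = chain_of_closed[OF K H X] chain_of_closed[OF K H X'] chain_of_closed[OF K H biset_sum_fin[OF X X']]
  have "chain_comp R K H J (sum_rel R K H X X') (chain_of R H J Y) =
    chain_comp R K H J (chain_of R K H (biset_sum X X')) (chain_of R H J Y) \<ominus>\<^bsub>chains R K J\<^esub>
    (chain_comp R K H J (chain_of R K H X) (chain_of R H J Y) \<oplus>\<^bsub>chains R K J\<^esub>
     chain_comp R K H J (chain_of R K H X') (chain_of R H J Y))"
    unfolding sum_rel_def
    by (simp add: module_hom_minus[OF free_module_module[OF is_cring] free_module_module[OF is_cring] hom]
        module_hom_add[OF hom] cl)
  also have "\<dots> = sum_rel R K J (biset_prod H X Y) (biset_prod H X' Y)"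
    unfolding sum_rel_def chain_comp_chain_of[OF X Y] chain_comp_chain_of[OF X' Y]
      chain_comp_chain_of[OF biset_sum_fin[OF X X'] Y]
      biset_class_cong[OF biset_prod_fin[OF K H J biset_sum_fin[OF X X'] Y] biset_prod_sum_left[OF K H J X X' Y]] ..
  finally show ?thesis .
qed

lemma chain_comp_sum_rel_right:
  assumes X: "fin_biset K H X" and Y: "fin_biset H J Y" and Y': "fin_biset H J Y'"
  shows "chain_comp R K H J (chain_of R K H X) (sum_rel R H J Y Y')
    = sum_rel R K J (biset_prod H X Y) (biset_prod H X Y')"
proof -
  interpret E: module R "chains R H J" by (rule free_module_module[OF is_cring])
  note hom = chain_comp_hom_right[OF chain_of_closed[OF K H X]]
  note cl = chain_of_closed[OF H J Y] chain_of_closed[OF H J Y'] chain_of_closed[OF H J biset_sum_fin[OF Y Y']]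
  have "chain_comp R K H J (chain_of R K H X) (sum_rel R H J Y Y') =
    chain_comp R K H J (chain_of R K H X) (chain_of R H J (biset_sum Y Y')) \<ominus>\<^bsub>chains R K J\<^esub>
    (chain_comp R K H J (chain_of R K H X) (chain_of R H J Y) \<oplus>\<^bsub>chains R K J\<^esub>
     chain_comp R K H J (chain_of R K H X) (chain_of R H J Y'))"
    unfolding sum_rel_def
    by (simp add: module_hom_minus[OF free_module_module[OF is_cring] free_module_module[OF is_cring] hom]
        module_hom_add[OF hom] cl)
  also have "\<dots> = sum_rel R K J (biset_prod H X Y) (biset_prod H X Y')"
    unfolding sum_rel_def chain_comp_chain_of[OF X Y] chain_comp_chain_of[OF X Y']
      chain_comp_chain_of[OF X biset_sum_fin[OF Y Y']]
      biset_class_cong[OF biset_prod_fin[OF K H J X biset_sum_fin[OF Y Y']] biset_prod_sum_right[OF K H J X Y Y']] ..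
  finally show ?thesis .
qed

text \<open>By linearity in each argument, \<open>c\<close> may be taken to be one of the generating relations and \<open>d\<close> to be the class of
  a biset. Then the claim is that products of bisets distribute over disjoint unions.\<close>

lemma chain_comp_rels_left:
  assumes c: "c \<in> burnside_rels R K H" and d: "d \<in> carrier (chains R H J)"
  shows "chain_comp R K H J c d \<in> burnside_rels R K J"
proof -
  note mod = free_module_module[OF is_cring]
  let ?rel = "{sum_rel R K H X Y | (X :: ('k, 'h, nat) biset) (Y :: ('k, 'h, nat) biset).
    fin_biset K H X \<and> fin_biset K H Y}"
  have "?rel \<subseteq> {c \<in> carrier (chains R K H). chain_comp R K H J c d \<in> burnside_rels R K J}"
  proof
    fix r assume "r \<in> ?rel"
    then obtain X X' :: "('k, 'h, nat) biset" where X: "fin_biset K H X" "fin_biset K H X'"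
      and r: "r = sum_rel R K H X X'" by blast
    have rc: "r \<in> carrier (chains R K H)" unfolding r by (rule sum_rel_closed[OF K H X])
    have "d \<in> {d \<in> carrier (chains R H J). chain_comp R K H J r d \<in> burnside_rels R K J}"
    proof (rule free_module_span[OF submodule_preimage[OF mod mod chain_comp_hom_right[OF rc] burnside_rels_submodule[OF K J]] _ d])
      fix B assume B: "B \<in> biset_classes H J"
      then obtain Y :: "('h, 'j, nat) biset" where Y: "fin_biset H J Y" "B = biset_class H J Y"
        by (auto simp: biset_classes_def)
      have "chain_comp R K H J r (chain_of R H J Y) \<in> burnside_rels R K J"
        unfolding r chain_comp_sum_rel_left[OF X Y(1)]
        by (intro sum_rel_in_burnside_rels[OF K J] biset_prod_fin[OF K H J] X Y)
      then show "basis_elem R B \<in> {d \<in> carrier (chains R H J). chain_comp R K H J r d \<in> burnside_rels R K J}"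
        using B Y by (simp add: basis_elem_closed)
    qed
    then show "r \<in> {c \<in> carrier (chains R K H). chain_comp R K H J c d \<in> burnside_rels R K J}"
      using rc by simp
  qed
  from gen_submodule_least[OF submodule_preimage[OF mod mod chain_comp_hom_left[OF d] burnside_rels_submodule[OF K J]] this]
  show ?thesis using c unfolding burnside_rels_eq[of R K H] by blast
qed

lemma chain_comp_rels_right:
  assumes c: "c \<in> carrier (chains R K H)" and d: "d \<in> burnside_rels R H J"
  shows "chain_comp R K H J c d \<in> burnside_rels R K J"
proof -
  note mod = free_module_module[OF is_cring]
  let ?rel = "{sum_rel R H J X Y | (X :: ('h, 'j, nat) biset) (Y :: ('h, 'j, nat) biset).
    fin_biset H J X \<and> fin_biset H J Y}"
  have "?rel \<subseteq> {d \<in> carrier (chains R H J). chain_comp R K H J c d \<in> burnside_rels R K J}"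
  proof
    fix r assume "r \<in> ?rel"
    then obtain Y Y' :: "('h, 'j, nat) biset" where Y: "fin_biset H J Y" "fin_biset H J Y'"
      and r: "r = sum_rel R H J Y Y'" by blast
    have rc: "r \<in> carrier (chains R H J)" unfolding r by (rule sum_rel_closed[OF H J Y])
    have "c \<in> {c \<in> carrier (chains R K H). chain_comp R K H J c r \<in> burnside_rels R K J}"
    proof (rule free_module_span[OF submodule_preimage[OF mod mod chain_comp_hom_left[OF rc] burnside_rels_submodule[OF K J]] _ c])
      fix A assume A: "A \<in> biset_classes K H"
      then obtain X :: "('k, 'h, nat) biset" where X: "fin_biset K H X" "A = biset_class K H X"
        by (auto simp: biset_classes_def)
      have "chain_comp R K H J (chain_of R K H X) r \<in> burnside_rels R K J"
        unfolding r chain_comp_sum_rel_right[OF X(1) Y]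
        by (intro sum_rel_in_burnside_rels[OF K J] biset_prod_fin[OF K H J] X Y)
      then show "basis_elem R A \<in> {c \<in> carrier (chains R K H). chain_comp R K H J c r \<in> burnside_rels R K J}"
        using A X by (simp add: basis_elem_closed)
    qed
    then show "r \<in> {d \<in> carrier (chains R H J). chain_comp R K H J c d \<in> burnside_rels R K J}"
      using rc by simp
  qed
  from gen_submodule_least[OF submodule_preimage[OF mod mod chain_comp_hom_right[OF c] burnside_rels_submodule[OF K J]] this]
  show ?thesis using d unfolding burnside_rels_eq[of R H J] by blast
qed

text \<open>The union in the definition of the composition is one over equal cosets, by
  \<open>c d - x y = (c - x) d + x (d - y)\<close>.\<close>

lemma burnside_comp_elem:
  assumes X: "fin_biset K H X" and Y: "fin_biset H J Y"
  shows "burnside_comp R K H J (burnside_elem R K H X) (burnside_elem R H J Y) = burnside_elem R K J (biset_prod H X Y)"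
proof -
  note mod = free_module_module[OF is_cring]
  note sub = burnside_rels_submodule
  interpret E: module R "chains R K J" by (rule mod)
  interpret E1: module R "chains R K H" by (rule mod)
  interpret E2: module R "chains R H J" by (rule mod)
  let ?x = "chain_of R K H X" and ?y = "chain_of R H J Y"
  note x = chain_of_closed[OF K H X] and y = chain_of_closed[OF H J Y]
  have const: "burnside_rels R K J +>\<^bsub>chains R K J\<^esub> chain_comp R K H J c d = burnside_elem R K J (biset_prod H X Y)"
    if "c \<in> burnside_elem R K H X" "d \<in> burnside_elem R H J Y" for c d
  proof -
    have c: "c \<in> carrier (chains R K H)" "c \<ominus>\<^bsub>chains R K H\<^esub> ?x \<in> burnside_rels R K H"
      and d: "d \<in> carrier (chains R H J)" "d \<ominus>\<^bsub>chains R H J\<^esub> ?y \<in> burnside_rels R H J"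
      using that coset_mem_iff[OF mod sub[OF K H] x] coset_mem_iff[OF mod sub[OF H J] y]
      by (auto simp: burnside_elem_def)
    note l = chain_comp_hom_left[OF d(1)] and r = chain_comp_hom_right[OF x]
    have cl: "chain_comp R K H J c d \<in> carrier (chains R K J)" "chain_comp R K H J ?x d \<in> carrier (chains R K J)"
      "chain_comp R K H J ?x ?y \<in> carrier (chains R K J)"
      using module_hom_closed[OF l c(1)] module_hom_closed[OF l x] module_hom_closed[OF r y] by auto
    have "chain_comp R K H J c d \<ominus>\<^bsub>chains R K J\<^esub> chain_comp R K H J ?x ?y =
        (chain_comp R K H J c d \<ominus>\<^bsub>chains R K J\<^esub> chain_comp R K H J ?x d) \<oplus>\<^bsub>chains R K J\<^esub>
        (chain_comp R K H J ?x d \<ominus>\<^bsub>chains R K J\<^esub> chain_comp R K H J ?x ?y)"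
    proof -
      have "\<ominus>\<^bsub>chains R K J\<^esub> chain_comp R K H J ?x d \<oplus>\<^bsub>chains R K J\<^esub>
          (chain_comp R K H J ?x d \<oplus>\<^bsub>chains R K J\<^esub> \<ominus>\<^bsub>chains R K J\<^esub> chain_comp R K H J ?x ?y) =
          \<ominus>\<^bsub>chains R K J\<^esub> chain_comp R K H J ?x ?y"
        using cl by (simp add: E.a_assoc[symmetric] E.l_neg)
      then show ?thesis using cl by (simp add: E.minus_eq E.a_assoc)
    qed
    also have "\<dots> = chain_comp R K H J (c \<ominus>\<^bsub>chains R K H\<^esub> ?x) d \<oplus>\<^bsub>chains R K J\<^esub>
        chain_comp R K H J ?x (d \<ominus>\<^bsub>chains R H J\<^esub> ?y)"
      by (simp only: module_hom_minus[OF mod mod l c(1) x] module_hom_minus[OF mod mod r d(1) y])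
    also have "\<dots> \<in> burnside_rels R K J"
      by (rule submodule_add[OF mod sub[OF K J] chain_comp_rels_left[OF c(2) d(1)] chain_comp_rels_right[OF x d(2)]])
    finally have "burnside_rels R K J +>\<^bsub>chains R K J\<^esub> chain_comp R K H J c d =
        burnside_rels R K J +>\<^bsub>chains R K J\<^esub> chain_comp R K H J ?x ?y"
      using coset_eq_iff[OF mod sub[OF K J] cl(1,3)] by blast
    then show ?thesis
      unfolding chain_comp_chain_of[OF X Y] burnside_elem_def .
  qed
  have "?x \<in> burnside_elem R K H X"
    unfolding burnside_elem_def coset_mem_iff[OF mod sub[OF K H] x]
    using x submodule_zero[OF mod sub[OF K H]] by (simp add: E1.minus_eq E1.r_neg)
  moreover have "?y \<in> burnside_elem R H J Y"
    unfolding burnside_elem_def coset_mem_iff[OF mod sub[OF H J] y]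
    using y submodule_zero[OF mod sub[OF H J]] by (simp add: E2.minus_eq E2.r_neg)
  ultimately show ?thesis
    unfolding burnside_comp_def using const by blast
qed

end

end

section \<open>Biset functors are destriction functors\<close>

text \<open>For a coset \<open>a = Mg : (U, V) \<rightarrow> (M, L)\<close> and \<open>s = (U, V)\<close> this is a \<open>(U/V, M/L)\<close>-biset, whose points are cosets of \<open>V\<close>
  in \<open>G\<close>; the elements of both quotient groups are subsets of \<open>G\<close> too, and act by multiplication of subsets. Inverses
  appear since \<open>Mg\<close> is a right coset of \<open>M\<close>, while \<open>M/L\<close> acts from the right.\<close>

definition coset_biset :: "('g, 'l) monoid_scheme \<Rightarrow> 'g sec \<Rightarrow> 'g set \<Rightarrow> ('g set, 'g set, 'g set) biset" where
  "coset_biset G s a = \<lparr>pts = (\<lambda>z. snd s #>\<^bsub>G\<^esub> inv\<^bsub>G\<^esub> z) ` a, lact = set_mult G, ract = set_mult G\<rparr>"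

context group begin

lemma sec_quot_ops:
  assumes s: "s \<in> sections G"
  shows sec_quot_carrier: "carrier (sec_quot G s) = (\<lambda>u. snd s #> u) ` fst s"
    and sec_quot_mult: "mult (sec_quot G s) = set_mult G"
    and sec_quot_one: "\<one>\<^bsub>sec_quot G s\<^esub> = snd s"
    and sec_quot_group: "group (sec_quot G s)"
proof -
  obtain U V where UV: "s = (U, V)" by (cases s)
  show "carrier (sec_quot G s) = (\<lambda>u. snd s #> u) ` fst s"
    by (auto simp: UV sec_quot_def FactGroup_def RCOSETS_def r_coset_def)
  show "mult (sec_quot G s) = set_mult G"
    by (simp add: UV sec_quot_def FactGroup_def set_mult_def fun_eq_iff)
  show "\<one>\<^bsub>sec_quot G s\<^esub> = snd s" by (simp add: UV sec_quot_def FactGroup_def)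
  have "V \<lhd> G\<lparr>carrier := U\<rparr>" using s by (simp add: UV sections_def)
  then show "group (sec_quot G s)"
    by (simp add: UV sec_quot_def normal.factorgroup_is_group)
qed

lemma rcos_left_mem:
  "subgroup V G \<Longrightarrow> v \<in> V \<Longrightarrow> y \<in> carrier G \<Longrightarrow> V #> (v \<otimes> y) = V #> y"
  by (simp add: coset_mult_assoc[symmetric] subgroup.subset subgroup.mem_carrier coset_join2)

lemma rcos_eqD:
  assumes "subgroup V G" "y \<in> carrier G" "V #> y = V #> z"
  shows "\<exists>v\<in>V. y = v \<otimes> z"
  using rcos_self[OF assms(2,1)] assms(3) by (auto simp: r_coset_def)

lemma sec_quot_inv:
  assumes s: "s \<in> sections G" and u: "u \<in> fst s"
  shows "inv\<^bsub>sec_quot G s\<^esub> (snd s #> u) = snd s #> inv u"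
proof -
  interpret Q: group "sec_quot G s" by (rule sec_quot_group[OF s])
  note s' = sectionsD[OF s]
  have uc: "u \<in> carrier G" "inv u \<in> fst s" using u s' subgroup.m_inv_closed[OF s'(1)] by auto
  have "conj_set G (inv u) (snd s) \<subseteq> snd s"
    using uc(2) s'(4) mem_normalizer_iff[OF s'(6)] by auto
  then have "(snd s #> inv u) <#> (snd s #> u) = snd s"
    using rcos_comp[OF s'(2,2), of "inv u" u] uc(1) s'(6) by simp
  then show ?thesis
    using u uc by (intro Q.inv_equality) (auto simp: sec_quot_ops[OF s])
qed

lemma conj_sec_self:
  assumes "t \<in> sections G" "m \<in> fst t"
  shows "conj_sec G m t = t"
  using assms sectionsD[OF assms(1)] mem_normalizer_iff[OF sectionsD(6)[OF assms(1)], of m]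
  by (intro prod_eqI) (auto simp: conj_sec_simps conj_set_self)

lemma Hom_memD:
  assumes s: "s \<in> sections G" and t: "t \<in> sections G" and a: "a \<in> Hom (orbit_cat G \<C>) s t" and z: "z \<in> a"
  shows "z \<in> carrier G" "sec_le (conj_sec G z s) t" "a = fst t #> z"
proof -
  from a obtain g where g: "g \<in> carrier G" "sec_le (conj_sec G g s) t" "a = fst t #> g" by (elim orbit_cat_HomE)
  from z g(3) obtain m where m: "m \<in> fst t" "z = m \<otimes> g" by (auto simp: r_coset_def)
  have mc: "m \<in> carrier G" using m sectionsD(5)[OF t] by auto
  show "z \<in> carrier G" using m g mc by simp
  show "sec_le (conj_sec G z s) t"
    using sec_le_conj_mult[OF g(1) mc s g(2), of t] by (simp add: conj_sec_self[OF t m(1)] sec_le_refl[OF t] m)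
  show "a = fst t #> z"
    using rcos_left_mem[OF sectionsD(1)[OF t] m(1) g(1)] by (simp add: g m)
qed

lemma Hom_inv:
  assumes s: "s \<in> sections G" and t: "t \<in> sections G" and a: "a \<in> Hom (orbit_cat G \<C>) s t"
    and z: "z \<in> a"
  shows Hom_inv_left: "u \<in> fst s \<Longrightarrow> \<exists>z'\<in>a. u \<otimes> inv z = inv z'"
    and Hom_inv_right: "m \<in> fst t \<Longrightarrow> \<exists>z'\<in>a. inv z \<otimes> m = inv z'"
    and Hom_inv_conj: "conj_set G (inv z) (snd t) \<subseteq> snd s"
    and Hom_inv_diff: "z' \<in> a \<Longrightarrow> z \<otimes> inv z' \<in> fst t"
proof -
  note z' = Hom_memD[OF s t a z]
  note S = sectionsD[OF s] and T = sectionsD[OF t]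
  show "\<exists>z'\<in>a. u \<otimes> inv z = inv z'" if u: "u \<in> fst s"
  proof
    have uc: "u \<in> carrier G" using u S by auto
    show "u \<otimes> inv z = inv (z \<otimes> inv u)" using uc z'(1) by (simp add: inv_mult_group)
    have "z \<otimes> inv u \<otimes> inv z \<in> fst t"
      using z'(2) subgroup.m_inv_closed[OF S(1) u] by (auto simp: sec_le_iff conj_sec_simps conj_set_image[of z "fst s"])
    moreover have "z \<otimes> inv u = (z \<otimes> inv u \<otimes> inv z) \<otimes> z" using uc z'(1) by (simp add: m_assoc)
    ultimately show "z \<otimes> inv u \<in> a" unfolding z'(3) r_coset_def by blast
  qed
  show "\<exists>z'\<in>a. inv z \<otimes> m = inv z'" if m: "m \<in> fst t"
  proof
    have mc: "m \<in> carrier G" using m T by auto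
    show "inv z \<otimes> m = inv (inv m \<otimes> z)" using mc z'(1) by (simp add: inv_mult_group)
    show "inv m \<otimes> z \<in> a" unfolding z'(3) r_coset_def using subgroup.m_inv_closed[OF T(1) m] by blast
  qed
  show "conj_set G (inv z) (snd t) \<subseteq> snd s"
    using conj_set_mono[of "snd t" "conj_set G z (snd s)" "inv z"] z'(1,2) S(6)
    by (simp add: sec_le_iff conj_sec_simps conj_set_inv)
  show "z \<otimes> inv z' \<in> fst t" if "z' \<in> a"
  proof -
    note z'' = Hom_memD[OF s t a that]
    obtain m where m: "m \<in> fst t" "z = m \<otimes> z'" using z unfolding z''(3) r_coset_def by blast
    then show ?thesis using z'' T(5) by (auto simp: m_assoc)
  qed
qed

lemma section_rcos_mult:
  assumes s: "s \<in> sections G" and u: "u \<in> fst s" and y: "y \<in> carrier G"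
  shows "(snd s #> u) <#> (snd s #> y) = snd s #> (u \<otimes> y)"
  using sectionsD[OF s] u y mem_normalizer_iff[OF sectionsD(6)[OF s], of u] by (intro rcos_comp) auto

lemma Hom_rcos_mult:
  assumes "s \<in> sections G" "t \<in> sections G" "a \<in> Hom (orbit_cat G \<C>) s t" "z \<in> a" "m \<in> carrier G"
  shows "(snd s #> inv z) <#> (snd t #> m) = snd s #> (inv z \<otimes> m)"
  using sectionsD(2)[OF assms(1)] sectionsD(2)[OF assms(2)] Hom_memD(1)[OF assms(1-4)] Hom_inv_conj[OF assms(1-4)] assms(5)
  by (intro rcos_comp) auto

lemma coset_biset_simps:
  "pts (coset_biset G s a) = (\<lambda>z. snd s #> inv z) ` a" "lact (coset_biset G s a) = set_mult G" "ract (coset_biset G s a) = set_mult G"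
  by (simp_all add: coset_biset_def)

lemma coset_biset_fin:
  assumes fin: "finite (carrier G)" and s: "s \<in> sections G" and t: "t \<in> sections G" and a: "a \<in> Hom (orbit_cat G \<C>) s t"
  shows "fin_biset (sec_quot G s) (sec_quot G t) (coset_biset G s a)"
proof -
  note S = sectionsD[OF s] and T = sectionsD[OF t]
  have ac: "a \<subseteq> carrier G" using Hom_memD(1)[OF s t a] by auto
  then have zc: "z \<in> carrier G" if "z \<in> a" for z using that by auto
  have Uc: "u \<in> carrier G" if "u \<in> fst s" for u using that S by auto
  have Mc: "m \<in> carrier G" if "m \<in> fst t" for m using that T by auto
  have l: "(snd s #> u) <#> (snd s #> inv z) \<in> (\<lambda>z. snd s #> inv z) ` a" if "u \<in> fst s" "z \<in> a" for u z
    using Hom_inv_left[OF s t a that(2,1)] section_rcos_mult[OF s that(1)] zc[OF that(2)] by auto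
  have r: "(snd s #> inv z) <#> (snd t #> m) \<in> (\<lambda>z. snd s #> inv z) ` a" if "m \<in> fst t" "z \<in> a" for m z
    using Hom_inv_right[OF s t a that(2,1)] Hom_rcos_mult[OF s t a that(2) Mc[OF that(1)]] by auto
  have one: "snd s <#> (snd s #> inv z) = snd s #> inv z" "(snd s #> inv z) <#> snd t = snd s #> inv z" if "z \<in> a" for z
    using section_rcos_mult[OF s subgroup.one_closed[OF S(1)], of "inv z"] Hom_rcos_mult[OF s t a that one_closed]
      zc[OF that] S(6) T(6) by simp_all
  have sub: "snd s #> g \<subseteq> carrier G" "snd t #> g \<subseteq> carrier G" if "g \<in> carrier G" for g
    using that S T by (simp_all add: r_coset_subset_G)
  show ?thesis
    unfolding fin_biset_def coset_biset_simps sec_quot_ops[OF s] sec_quot_ops[OF t]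
  proof (intro conjI ballI)
    show "finite ((\<lambda>z. snd s #> inv z) ` a)" using finite_subset[OF ac fin] by simp
  qed (auto simp: l r one set_mult_assoc sub zc Uc Mc)
qed

text \<open>The bisets of composable cosets multiply like the cosets, through the product of subsets of \<open>G\<close>.\<close>

lemma coset_biset_prod:
  assumes fin: "finite (carrier G)" and s: "s \<in> sections G" and t: "t \<in> sections G" and u: "u \<in> sections G"
    and a: "a \<in> Hom (orbit_cat G \<C>) s t" and b: "b \<in> Hom (orbit_cat G \<C>) t u"
  shows "biset_iso (sec_quot G s) (sec_quot G u)
    (biset_prod (sec_quot G t) (coset_biset G s a) (coset_biset G t b)) (coset_biset G s (b <#> a))"
proof (rule biset_prod_isoI[OF sec_quot_group[OF s] sec_quot_group[OF t] sec_quot_group[OF u]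
      coset_biset_fin[OF fin s t a] coset_biset_fin[OF fin t u b], where \<mu> = "set_mult G"];
    unfold coset_biset_simps sec_quot_ops[OF s] sec_quot_ops[OF t] sec_quot_ops[OF u])
  note S = sectionsD[OF s] and T = sectionsD[OF t] and U = sectionsD[OF u]
  have ac: "z \<in> carrier G" if "z \<in> a" for z using that Hom_memD(1)[OF s t a] by auto
  have bc: "z \<in> carrier G" if "z \<in> b" for z using that Hom_memD(1)[OF t u b] by auto
  have mult: "(snd s #> inv z) <#> (snd t #> inv w) = snd s #> inv (w \<otimes> z)" if "z \<in> a" "w \<in> b" for z w
    using Hom_rcos_mult[OF s t a that(1), of "inv w"] ac[OF that(1)] bc[OF that(2)] by (simp add: inv_mult_group)
  have sub: "snd s #> g \<subseteq> carrier G" "snd t #> g \<subseteq> carrier G" "snd u #> g \<subseteq> carrier G" if "g \<in> carrier G" for g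
    using that S T U by (simp_all add: r_coset_subset_G)
  show "x <#> y \<in> (\<lambda>z. snd s #> inv z) ` (b <#> a)"
    if "x \<in> (\<lambda>z. snd s #> inv z) ` a" "y \<in> (\<lambda>z. snd t #> inv z) ` b" for x y
    using that mult by (auto simp: set_mult_def[of G b a])
  show "\<exists>x\<in>(\<lambda>z. snd s #> inv z) ` a. \<exists>y\<in>(\<lambda>z. snd t #> inv z) ` b. x <#> y = w"
    if "w \<in> (\<lambda>z. snd s #> inv z) ` (b <#> a)" for w
    using that mult by (auto simp: set_mult_def[of G b a])
  show "k <#> x <#> y = k <#> (x <#> y)"
    if "k \<in> (\<lambda>v. snd s #> v) ` fst s" "x \<in> (\<lambda>z. snd s #> inv z) ` a" "y \<in> (\<lambda>z. snd t #> inv z) ` b" for k x y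
    using that by (auto simp: set_mult_assoc ac bc sub subsetD[OF S(5)])
  show "x <#> (y <#> j) = x <#> y <#> j"
    if "j \<in> (\<lambda>v. snd u #> v) ` fst u" "x \<in> (\<lambda>z. snd s #> inv z) ` a" "y \<in> (\<lambda>z. snd t #> inv z) ` b" for j x y
    using that by (auto simp: set_mult_assoc ac bc sub subsetD[OF U(5)])
  fix x y x' y'
  assume "x \<in> (\<lambda>z. snd s #> inv z) ` a" "y \<in> (\<lambda>z. snd t #> inv z) ` b"
    "x' \<in> (\<lambda>z. snd s #> inv z) ` a" "y' \<in> (\<lambda>z. snd t #> inv z) ` b"
  then obtain z w z' w' where z: "z \<in> a" "z' \<in> a" and w: "w \<in> b" "w' \<in> b"
    and xy: "x = snd s #> inv z" "y = snd t #> inv w" "x' = snd s #> inv z'" "y' = snd t #> inv w'" by blast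
  note zc = ac[OF z(1)] ac[OF z(2)] and wc = bc[OF w(1)] bc[OF w(2)]
  show "x <#> y = x' <#> y' \<longleftrightarrow>
    (\<exists>h\<in>(\<lambda>v. snd t #> v) ` fst t. x' = x <#> h \<and> y' = inv\<^bsub>sec_quot G t\<^esub> h <#> y)"
  proof
    assume "x <#> y = x' <#> y'"
    then have "snd s #> (inv z' \<otimes> inv w') = snd s #> (inv z \<otimes> inv w)"
      using mult[OF z(1) w(1)] mult[OF z(2) w(2)] zc wc by (simp add: xy inv_mult_group)
    from rcos_eqD[OF S(2) _ this] zc wc obtain v where v: "v \<in> snd s" "inv z' \<otimes> inv w' = v \<otimes> (inv z \<otimes> inv w)"
      by auto
    have vs: "v \<in> fst s" "v \<in> carrier G" using v S by auto
    obtain z1 where z1: "z1 \<in> a" "v \<otimes> inv z = inv z1" using Hom_inv_left[OF s t a z(1) vs(1)] by blast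
    \<comment> \<open>The point \<open>V z\<inverse>\<close> is also \<open>V z1\<inverse>\<close>, and with this representative \<open>z1 z'\<inverse> \<in> M\<close> moves \<open>x\<close> to \<open>x'\<close>.\<close>
    let ?m = "z1 \<otimes> inv z'"
    have m: "?m \<in> fst t" by (rule Hom_inv_diff[OF s t a z1(1) z(2)])
    have mc: "?m \<in> carrier G" using m T by auto
    have z1c: "z1 \<in> carrier G" by (rule ac[OF z1(1)])
    have z1m: "inv z1 \<otimes> ?m = inv z'" using z1c zc by (simp add: m_assoc[symmetric])
    have xz1: "x = snd s #> inv z1"
      using rcos_left_mem[OF S(2) v(1), of "inv z"] zc by (simp add: xy z1(2))
    have "x' = x <#> (snd t #> ?m)"
      using Hom_rcos_mult[OF s t a z1(1) mc] by (simp add: xz1 z1m xy(3))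
    moreover have "y' = inv\<^bsub>sec_quot G t\<^esub> (snd t #> ?m) <#> y"
    proof -
      have "inv w' = z' \<otimes> (inv z' \<otimes> inv w')" using zc wc by (simp add: m_assoc[symmetric])
      also have "\<dots> = z' \<otimes> (inv z1 \<otimes> inv w)"
        using v(2) z1(2) zc wc vs by (simp add: m_assoc[symmetric])
      also have "\<dots> = inv ?m \<otimes> inv w" using zc wc z1c by (simp add: inv_mult_group m_assoc)
      finally have "inv w' = inv ?m \<otimes> inv w" .
      then show ?thesis
        using section_rcos_mult[OF t subgroup.m_inv_closed[OF T(1) m], of "inv w"] wc
        by (simp add: xy sec_quot_inv[OF t m])
    qed
    ultimately show "\<exists>h\<in>(\<lambda>v. snd t #> v) ` fst t. x' = x <#> h \<and> y' = inv\<^bsub>sec_quot G t\<^esub> h <#> y"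
      using m by blast
  next
    assume "\<exists>h\<in>(\<lambda>v. snd t #> v) ` fst t. x' = x <#> h \<and> y' = inv\<^bsub>sec_quot G t\<^esub> h <#> y"
    then obtain m where m: "m \<in> fst t" "x' = x <#> (snd t #> m)" "y' = inv\<^bsub>sec_quot G t\<^esub> (snd t #> m) <#> y" by blast
    have mc: "m \<in> carrier G" "inv m \<in> fst t" using m(1) T subgroup.m_inv_closed[OF T(1)] by auto
    have x': "x' = snd s #> (inv z \<otimes> m)" using m(2) Hom_rcos_mult[OF s t a z(1) mc(1)] by (simp add: xy)
    obtain z2 where z2: "z2 \<in> a" "inv z \<otimes> m = inv z2" using Hom_inv_right[OF s t a z(1) m(1)] by blast
    have y': "y' = snd t #> (inv m \<otimes> inv w)"
      using m(3) section_rcos_mult[OF t mc(2), of "inv w"] wc by (simp add: xy sec_quot_inv[OF t m(1)])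
    have "x' <#> y' = snd s #> (inv z2 \<otimes> (inv m \<otimes> inv w))"
      unfolding x' y' z2(2) using mc wc by (intro Hom_rcos_mult[OF s t a z2(1)]) simp
    also have "inv z2 \<otimes> (inv m \<otimes> inv w) = inv z \<otimes> inv w"
      unfolding z2(2)[symmetric] using zc wc mc m_assoc[of m "inv m" "inv w"] by (simp add: m_assoc)
    also have "snd s #> (inv z \<otimes> inv w) = x <#> y"
      using mult[OF z(1) w(1)] zc wc by (simp add: xy inv_mult_group)
    finally show "x <#> y = x' <#> y'" by simp
  qed
qed

lemma coset_biset_full:
  assumes t: "t \<in> sections G" and s: "snd s = snd t"
  shows "coset_biset G s (fst t) = mult_biset (sec_quot G t)"
proof -
  note T = sectionsD[OF t]
  have "(\<lambda>z. snd t #> inv z) ` fst t = (\<lambda>u. snd t #> u) ` fst t"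
  proof (intro equalityI subsetI)
    fix x assume "x \<in> (\<lambda>z. snd t #> inv z) ` fst t"
    then show "x \<in> (\<lambda>u. snd t #> u) ` fst t" using subgroup.m_inv_closed[OF T(1)] by auto
  next
    fix x assume "x \<in> (\<lambda>u. snd t #> u) ` fst t"
    then obtain u where u: "u \<in> fst t" "x = snd t #> u" by auto
    then have "u = inv (inv u)" using T by auto
    then show "x \<in> (\<lambda>z. snd t #> inv z) ` fst t"
      using u subgroup.m_inv_closed[OF T(1) u(1)] by (metis imageI)
  qed
  then show ?thesis by (simp add: coset_biset_def mult_biset_def sec_quot_ops[OF t] s)
qed

lemma coset_biset_deflation:
  assumes s: "s \<in> sections G" and t: "t \<in> sections G" and eq: "fst s = fst t" and le: "snd t \<subseteq> snd s"
  shows "biset_iso (sec_quot G s) (sec_quot G t) (coset_biset G s (fst s))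
    (twist_biset (sec_quot G s) (\<lambda>x. snd s <#> x))"
proof -
  note S = sectionsD[OF s] and T = sectionsD[OF t]
  have full: "coset_biset G s (fst s) = mult_biset (sec_quot G s)" by (rule coset_biset_full[OF s refl])
  show ?thesis
    unfolding biset_iso_def full
  proof (intro exI[of _ "\<lambda>x. x"] conjI ballI)
    fix h x assume "h \<in> carrier (sec_quot G t)" "x \<in> pts (mult_biset (sec_quot G s))"
    then obtain w u where w: "w \<in> fst t" "h = snd t #> w" and u: "u \<in> fst s" "x = snd s #> u"
      by (auto simp: sec_quot_ops[OF t] mult_biset_def sec_quot_ops[OF s])
    have c: "w \<in> carrier G" "u \<in> carrier G" using w u S T by auto
    have "snd s #> u <#> (snd s <#> (snd t #> w)) = (snd s #> u <#> snd s) <#> (snd t #> w)"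
      using c S T by (intro set_mult_assoc[symmetric]) (auto simp: r_coset_subset_G intro: r_coset_subset_G[THEN subsetD])
    also have "snd s #> u <#> snd s = snd s #> u"
      using section_rcos_mult[OF s u(1) one_closed] c S by simp
    finally show "ract (mult_biset (sec_quot G s)) x h = ract (twist_biset (sec_quot G s) (\<lambda>x. snd s <#> x)) x h"
      by (simp add: mult_biset_def twist_biset_def sec_quot_ops[OF s] w u)
  qed (simp_all add: mult_biset_def twist_biset_def bij_betw_def)
qed

lemma coset_biset_conj:
  assumes s: "s \<in> sections G" and g: "g \<in> carrier G"
  shows "biset_iso (sec_quot G s) (sec_quot G (conj_sec G g s)) (coset_biset G s (conj_set G g (fst s) #> g))
    (twist_biset (sec_quot G s) (conj_set G (inv g)))"
proof -
  note S = sectionsD[OF s]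
  let ?a = "conj_set G g (fst s) #> g"
  note t = conj_sec_section[OF g s]
  have a: "?a = (\<lambda>u. g \<otimes> u) ` fst s"
  proof -
    have "g \<otimes> u \<otimes> inv g \<otimes> g = g \<otimes> u" if "u \<in> fst s" for u
    proof -
      have "u \<in> carrier G" using that S by auto
      then show ?thesis using g by (simp add: m_assoc)
    qed
    then show ?thesis by (auto simp: r_coset_def conj_set_image)
  qed
  have pts: "pts (coset_biset G s ?a) = (\<lambda>u. snd s #> (u \<otimes> inv g)) ` fst s"
  proof -
    have "(\<lambda>u. snd s #> inv (g \<otimes> u)) ` fst s = (\<lambda>u. snd s #> (u \<otimes> inv g)) ` fst s"
    proof (intro equalityI subsetI)
      fix x assume "x \<in> (\<lambda>u. snd s #> inv (g \<otimes> u)) ` fst s"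
      then obtain u where u: "u \<in> fst s" "x = snd s #> inv (g \<otimes> u)" by auto
      have "u \<in> carrier G" using u S by auto
      then show "x \<in> (\<lambda>u. snd s #> (u \<otimes> inv g)) ` fst s"
        using u g subgroup.m_inv_closed[OF S(1) u(1)] by (intro image_eqI[of _ _ "inv u"]) (auto simp: inv_mult_group)
    next
      fix x assume "x \<in> (\<lambda>u. snd s #> (u \<otimes> inv g)) ` fst s"
      then obtain u where u: "u \<in> fst s" "x = snd s #> (u \<otimes> inv g)" by auto
      have "u \<in> carrier G" using u S by auto
      then show "x \<in> (\<lambda>u. snd s #> inv (g \<otimes> u)) ` fst s"
        using u g subgroup.m_inv_closed[OF S(1) u(1)] by (intro image_eqI[of _ _ "inv u"]) (auto simp: inv_mult_group)
    qed
    then show ?thesis by (simp add: coset_biset_simps a image_image)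
  qed
  have ptsc: "x \<subseteq> carrier G" if "x \<in> pts (coset_biset G s ?a)" for x
  proof -
    from that obtain u where "u \<in> fst s" "x = snd s #> (u \<otimes> inv g)" unfolding pts by blast
    then show ?thesis using g subsetD[OF S(5)] by (simp add: r_coset_subset_G[OF S(6)])
  qed
  have quotc: "x \<subseteq> carrier G" if "x \<in> carrier (sec_quot G r)" "r \<in> sections G" for x r
    using that sectionsD(5,6)[OF that(2)] by (auto simp: sec_quot_ops[OF that(2)] r_coset_def)
  show ?thesis
    unfolding biset_iso_def
  proof (intro exI[of _ "\<lambda>x. x #> g"] conjI ballI)
    show "bij_betw (\<lambda>x. x #> g) (pts (coset_biset G s ?a)) (pts (twist_biset (sec_quot G s) (conj_set G (inv g))))"
    proof (rule bij_betw_byWitness[where f' = "\<lambda>x. x #> inv g"])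
      have uc: "u \<in> carrier G" if "u \<in> fst s" for u using that S by auto
      have 1: "snd s #> (u \<otimes> inv g) #> g = snd s #> u" "snd s #> u #> inv g = snd s #> (u \<otimes> inv g)" if "u \<in> fst s" for u
        using uc[OF that] g S by (simp_all add: coset_mult_assoc m_assoc)
      show "\<forall>x\<in>pts (coset_biset G s ?a). x #> g #> inv g = x"
        using 1 by (auto simp: pts)
      show "\<forall>x\<in>pts (twist_biset (sec_quot G s) (conj_set G (inv g))). x #> inv g #> g = x"
        using 1 by (auto simp: twist_biset_def sec_quot_ops[OF s])
      show "(\<lambda>x. x #> g) ` pts (coset_biset G s ?a) \<subseteq> pts (twist_biset (sec_quot G s) (conj_set G (inv g)))"
        using 1 by (auto simp: pts twist_biset_def sec_quot_ops[OF s])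
      show "(\<lambda>x. x #> inv g) ` pts (twist_biset (sec_quot G s) (conj_set G (inv g))) \<subseteq> pts (coset_biset G s ?a)"
        using 1 by (auto simp: pts twist_biset_def sec_quot_ops[OF s])
    qed
  next
    fix k x assume k: "k \<in> carrier (sec_quot G s)" and x: "x \<in> pts (coset_biset G s ?a)"
    show "lact (coset_biset G s ?a) k x #> g = lact (twist_biset (sec_quot G s) (conj_set G (inv g))) k (x #> g)"
      using setmult_rcos_assoc[OF quotc[OF k s] ptsc[OF x] g]
      by (simp add: coset_biset_simps twist_biset_def sec_quot_ops[OF s])
  next
    fix h x assume h: "h \<in> carrier (sec_quot G (conj_sec G g s))" and x: "x \<in> pts (coset_biset G s ?a)"
    note hc = quotc[OF h t] and xc = ptsc[OF x]
    have elem: "p \<otimes> g \<otimes> (inv g \<otimes> q \<otimes> g) = p \<otimes> q \<otimes> g" if "p \<in> x" "q \<in> h" for p q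
    proof -
      have "p \<in> carrier G" "q \<in> carrier G" using that xc hc by auto
      then show ?thesis using g m_assoc[of g "inv g" "q \<otimes> g"] by (simp add: m_assoc)
    qed
    have "x <#> h #> g = (\<Union>p\<in>x. \<Union>q\<in>h. {p \<otimes> q \<otimes> g})" by (auto simp: set_mult_def r_coset_def)
    also have "\<dots> = (\<Union>p\<in>x. \<Union>q\<in>h. {p \<otimes> g \<otimes> (inv g \<otimes> q \<otimes> g)})" using elem by simp
    also have "\<dots> = (x #> g) <#> conj_set G (inv g) h"
      using g by (auto simp: set_mult_def r_coset_def conj_set_image)
    finally show "ract (coset_biset G s ?a) x h #> g = ract (twist_biset (sec_quot G s) (conj_set G (inv g))) (x #> g) h"
      by (simp add: coset_biset_simps twist_biset_def sec_quot_ops[OF s])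
  qed
qed

end

subsection \<open>The action of bisets\<close>

context
  fixes R :: "('r, 'k) ring_scheme" and G :: "('g, 'l) monoid_scheme" (structure)
    and B :: "('g sec, ('g, 'r) biset_mor, 'r, 'm) fun_data"
  assumes R: "cring R" and G: "group G" and fin: "finite (carrier G)" and B: "biset_functor R G B"
begin

interpretation R: cring R by (rule R)
interpretation G: group G by (rule G)

lemma biset_functorD:
  shows biset_functor_module: "s \<in> sections G \<Longrightarrow> module R (ob B s)"
    and biset_functor_hom: "s \<in> sections G \<Longrightarrow> t \<in> sections G \<Longrightarrow>
      \<alpha> \<in> carrier (burnside R (sec_quot G t) (sec_quot G s)) \<Longrightarrow> ar B s t \<alpha> \<in> module_hom R (ob B s) (ob B t)"
    and biset_functor_ident: "s \<in> sections G \<Longrightarrow> m \<in> carrier (ob B s) \<Longrightarrow>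
      ar B s s (burnside_elem R (sec_quot G s) (sec_quot G s) (mult_biset (sec_quot G s))) m = m"
    and biset_functor_comp: "s \<in> sections G \<Longrightarrow> t \<in> sections G \<Longrightarrow> u \<in> sections G \<Longrightarrow>
      \<beta> \<in> carrier (burnside R (sec_quot G u) (sec_quot G t)) \<Longrightarrow>
      \<alpha> \<in> carrier (burnside R (sec_quot G t) (sec_quot G s)) \<Longrightarrow> m \<in> carrier (ob B s) \<Longrightarrow>
      ar B s u (burnside_comp R (sec_quot G u) (sec_quot G t) (sec_quot G s) \<beta> \<alpha>) m = ar B t u \<beta> (ar B s t \<alpha> m)"
  using B unfolding biset_functor_def by (elim conjE; simp only: Ball_def)+

lemma biset_act_hom:
  assumes s: "s \<in> sections G" and t: "t \<in> sections G" and X: "fin_biset (sec_quot G t) (sec_quot G s) X"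
  shows "biset_act R G B s t X \<in> module_hom R (ob B s) (ob B t)"
proof -
  have "burnside_elem R (sec_quot G t) (sec_quot G s) X \<in> carrier (burnside R (sec_quot G t) (sec_quot G s))"
    by (rule R.burnside_elem_closed[OF G.sec_quot_group[OF t] G.sec_quot_group[OF s] X])
  then show ?thesis unfolding biset_act_def by (rule biset_functor_hom[OF s t])
qed

lemma biset_act_cong:
  assumes "fin_biset (sec_quot G t) (sec_quot G s) X" "biset_iso (sec_quot G t) (sec_quot G s) X Y"
  shows "biset_act R G B s t Y = biset_act R G B s t X"
  unfolding biset_act_def burnside_elem_def biset_class_cong[OF assms] ..

lemma biset_act_prod:
  assumes s: "s \<in> sections G" and t: "t \<in> sections G" and u: "u \<in> sections G"
    and X: "fin_biset (sec_quot G u) (sec_quot G t) X" and Y: "fin_biset (sec_quot G t) (sec_quot G s) Y"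
    and m: "m \<in> carrier (ob B s)"
  shows "biset_act R G B t u X (biset_act R G B s t Y m) = biset_act R G B s u (biset_prod (sec_quot G t) X Y) m"
proof -
  note gr = G.sec_quot_group[OF u] G.sec_quot_group[OF t] G.sec_quot_group[OF s]
  show ?thesis
    unfolding biset_act_def R.burnside_comp_elem[OF gr X Y, symmetric]
    by (rule biset_functor_comp[OF s t u R.burnside_elem_closed[OF gr(1,2) X]
          R.burnside_elem_closed[OF gr(2,3) Y] m, symmetric])
qed

definition coset_act :: "'g sec \<Rightarrow> 'g sec \<Rightarrow> 'g set \<Rightarrow> 'm \<Rightarrow> 'm" where
  "coset_act s t a = biset_act R G B t s (coset_biset G s a)"

lemma coset_act_hom:
  assumes "s \<in> sections G" "t \<in> sections G" "a \<in> Hom (DG G) s t"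
  shows "coset_act s t a \<in> module_hom R (ob B t) (ob B s)"
  unfolding coset_act_def by (rule biset_act_hom[OF assms(2,1) G.coset_biset_fin[OF fin assms]])

lemma coset_act_ident:
  assumes s: "s \<in> sections G" and m: "m \<in> carrier (ob B s)"
  shows "coset_act s s (fst s) m = m"
  unfolding coset_act_def G.coset_biset_full[OF s refl] biset_act_def by (rule biset_functor_ident[OF s m])

lemma coset_act_comp:
  assumes s: "s \<in> sections G" and t: "t \<in> sections G" and u: "u \<in> sections G"
    and a: "a \<in> Hom (DG G) s t" and b: "b \<in> Hom (DG G) t u" and m: "m \<in> carrier (ob B u)"
  shows "coset_act s t a (coset_act t u b m) = coset_act s u (b <#> a) m"
proof -
  note X = G.coset_biset_fin[OF fin s t a] and Y = G.coset_biset_fin[OF fin t u b]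
  show ?thesis
    unfolding coset_act_def biset_act_prod[OF u t s X Y m]
    by (subst biset_act_cong[OF biset_prod_fin[OF G.sec_quot_group[OF s] G.sec_quot_group[OF t] G.sec_quot_group[OF u] X Y]
          G.coset_biset_prod[OF fin s t u a b]]) (rule refl)
qed

text \<open>Restriction, deflation and the conjugation isomorphism are the actions of three cosets with
  product \<open>Mg\<close>.\<close>

lemma biset_to_destriction_ar:
  assumes s: "s \<in> sections G" and t: "t \<in> sections G" and a: "a \<in> Hom (DG G) s t" and m: "m \<in> carrier (ob B t)"
  shows "ar (biset_to_destriction R G B) s t a m = coset_act s t a m"
proof -
  define g where "g = (SOME g. g \<in> a)"
  have "a \<noteq> {}"
    using a G.sectionsD(1)[OF t] subgroup.one_closed by (elim G.orbit_cat_HomE) (auto simp: r_coset_def)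
  then have ga: "g \<in> a" by (auto simp: g_def intro: someI)
  note g = G.Hom_memD[OF s t a ga]
  define s' where "s' = conj_sec G g s"
  define w where "w = (fst s', snd t)"
  have s': "s' \<in> sections G" unfolding s'_def by (rule G.conj_sec_section[OF g(1) s])
  have le: "snd t \<subseteq> snd s'" "snd s' \<subseteq> fst s'" "fst s' \<subseteq> fst t"
    using g(2) by (auto simp: s'_def G.sec_le_iff)
  have w: "w \<in> sections G"
    unfolding w_def G.sections_iff using G.sectionsD[OF s'] G.sectionsD[OF t] le by blast
  have "sec_le w t" "sec_le s' w"
    using le by (auto simp: w_def G.sec_le_iff)
  then have wt: "fst t \<in> Hom (DG G) w t" and s'w: "fst s' \<in> Hom (DG G) s' w"
    using G.orbit_cat_HomI[of \<one> w t] G.orbit_cat_HomI[of \<one> s' w] w s' G.sectionsD(5)[OF t] G.sectionsD(5)[OF s']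
    by (simp_all add: G.conj_sec_one w_def)
  have ss': "fst s' #> g \<in> Hom (DG G) s s'"
    using g(1) G.sec_le_refl[OF s'] by (intro G.orbit_cat_HomI) (simp_all add: s'_def)
  have isom: "biset_act R G B s' s (twist_biset (sec_quot G s) (conj_set G (inv g))) = coset_act s s' (fst s' #> g)"
    unfolding coset_act_def
    using biset_act_cong[OF G.coset_biset_fin[OF fin s s' ss']] G.coset_biset_conj[OF s g(1)]
    by (simp add: s'_def G.conj_sec_simps)
  have defl: "biset_act R G B w s' (twist_biset (sec_quot G s') (\<lambda>x. snd s' <#> x)) = coset_act s' w (fst s')"
    unfolding coset_act_def
    by (rule biset_act_cong[OF G.coset_biset_fin[OF fin s' w s'w] G.coset_biset_deflation[OF s' w]])
      (use le in \<open>simp_all add: w_def\<close>)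
  have rest: "biset_act R G B t w (mult_biset (sec_quot G t)) = coset_act w t (fst t)"
    unfolding coset_act_def by (subst G.coset_biset_full[OF t]) (simp_all add: w_def)
  have "ar (biset_to_destriction R G B) s t a m =
      biset_act R G B s' s (twist_biset (sec_quot G s) (conj_set G (inv g)))
        (biset_act R G B w s' (twist_biset (sec_quot G s') (\<lambda>x. snd s' <#> x))
          (biset_act R G B t w (mult_biset (sec_quot G t)) m))"
    by (cases s, cases t) (simp add: biset_to_destriction_def Let_def g_def s'_def w_def conj_sec_def)
  also have "\<dots> = coset_act s s' (fst s' #> g) (coset_act s' w (fst s') (coset_act w t (fst t) m))"
    unfolding isom defl rest ..
  also have "\<dots> = coset_act s s' (fst s' #> g) (coset_act s' t (fst t <#> fst s') m)"
    by (simp only: coset_act_comp[OF s' w t s'w wt m])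
  also have "fst t <#> fst s' = fst t"
    using G.orbit_cat_comp[OF s' t G.one_closed G.one_closed] le G.sectionsD(5)[OF t] G.sectionsD(5)[OF s'] s'
    by (simp add: G.conj_sec_one G.sec_le_iff)
  also have "coset_act s s' (fst s' #> g) (coset_act s' t (fst t) m) = coset_act s t (fst t <#> (fst s' #> g)) m"
  proof (rule coset_act_comp[OF s s' t ss' _ m])
    show "fst t \<in> Hom (DG G) s' t"
      using G.orbit_cat_HomI[of \<one> s' t] s' le G.sectionsD(5)[OF t] by (simp add: G.conj_sec_one G.sec_le_iff)
  qed
  also have "fst t <#> (fst s' #> g) = a"
    using G.orbit_cat_comp[OF s' t g(1) G.one_closed] le g G.sectionsD(5)[OF t] s'
    by (simp add: G.conj_sec_one G.sec_le_iff)
  finally show ?thesis .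
qed

theorem biset_to_destriction_destriction_functor: "destriction_functor R G (biset_to_destriction R G B)"
  unfolding cat_module_def G.orbit_cat_simps
proof (intro conjI ballI)
  let ?F = "biset_to_destriction R G B"
  have ob: "ob ?F = ob B" by (simp add: biset_to_destriction_def)
  interpret C: category_over_ring "DG G" R by (rule G.orbit_cat_category[OF R subset_refl])
  fix s assume s: "s \<in> sections G"
  show "module R (ob ?F s)" unfolding ob by (rule biset_functor_module[OF s])
  have id: "fst s \<in> Hom (DG G) s s" using C.ident_closed[of s] s by (simp add: G.orbit_cat_simps)
  show "ar ?F s s (fst s) m = m" if "m \<in> carrier (ob ?F s)" for m
    using that unfolding ob by (simp add: biset_to_destriction_ar[OF s s id] coset_act_ident[OF s])
  fix t a assume t: "t \<in> sections G" and a: "a \<in> Hom (DG G) s t"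
  show "ar ?F s t a \<in> module_hom R (ob ?F t) (ob ?F s)"
    unfolding ob
    by (rule module_hom_cong[OF coset_act_hom[OF s t a] biset_functor_module[OF t]])
      (rule biset_to_destriction_ar[OF s t a, symmetric])
  fix u b m assume u: "u \<in> sections G" and b: "b \<in> Hom (DG G) t u" and m: "m \<in> carrier (ob ?F u)"
  have ba: "b <#> a \<in> Hom (DG G) s u"
    using C.comp_closed[of s t u a b] s t u a b by (simp add: G.orbit_cat_simps)
  show "ar ?F s u (b <#> a) m = ar ?F s t a (ar ?F t u b m)"
    using m module_hom_closed[OF coset_act_hom[OF t u b]] unfolding ob
    by (simp add: biset_to_destriction_ar s t u a b ba coset_act_comp)
qed

end

section \<open>The theorem\<close>

theorem theorem1p3:
  fixes R :: "('r, 'k) ring_scheme"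
    and G :: "('g, 'l) monoid_scheme"
    and F :: "('g sec, 'g set, 'r, 'm) fun_data"
  assumes "cring R"
    and "group G"
    and "finite (carrier G)"
    and "destriction_functor R G F \<or>
         (\<exists>B. biset_functor R G B \<and> F = biset_to_destriction R G B)"
  shows "(\<exists>\<phi> \<in> module_iso R (gluing_module G F) (lim_module (DG_star G) F).
            \<forall>x \<in> carrier (ob F (full_sec G)). \<phi> (gluing_map G F x) = lim_map G F x) \<and>
         module_isomorphic R (Obs G F) (Ext1 R (DG G) (T_functor R G) F) \<and>
         module_isomorphic R (gluing_kernel G F) (nat_module R (DG G) (T_functor R G) F)"
proof -
  interpret group G by fact
  have F: "destriction_functor R G F"
    using assms(4) biset_to_destriction_destriction_functor[OF assms(1-3)] by blast
  have "\<forall>x\<in>carrier (ob F (full_sec G)). glue_to_lim G F (gluing_map G F x) = lim_map G F x"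
    using glue_to_lim_gluing_map[OF F] by blast
  then show ?thesis
    using glue_to_lim_iso[OF assms(1) F] destriction_gluing_ext[OF assms(1) F] by blast
qed

end
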